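(* Let $d\ge 1$, $p\in(1,\infty)$, $q=p/(p-1)$, and let $\mu_0,\mu_1\in\mathcal P_p(\mathbb R^d)$. Let $\mathcal D$ be a nonnegative discrepancy between probability measures on $\mathbb R^d$ with $\mathcal D(P,Q)=0\Leftrightarrow P=Q$, let $\lambda_{\mathrm{PM}},\lambda_{\mathrm{term}}>0$ be fixed, and let $\mathcal L_{\mathrm{PMOT}}=\lambda_{\mathrm{PM}}\mathcal L_{\mathrm{PM}}+\lambda_{\mathrm{term}}\mathcal L_{\mathrm{term}}$ be the PMOT objective, with domain $\operatorname{dom}(\mathcal L_{\mathrm{PMOT}})$, as defined in the context. Assume that $\mu_0$ is absolutely continuous with respect to Lebesgue measure. Assume that the $p$-Benamou--Brenier problem from $\mu_0$ to $\mu_1$ admits a minimizer $(\rho^\star,v^\star)$ of the form $(\rho^\star,v^\star)=(\rho^{\Phi^\star},v_{\Phi^\star})$ for some $\Phi^\star\in\operatorname{dom}(\mathcal L_{\mathrm{PMOT}})$. Then \[ \min_{\Phi\in\operatorname{dom}(\mathcal L_{\mathrm{PMOT}})}\mathcal L_{\mathrm{PMOT}}(\Phi)=\mathcal L_{\mathrm{PMOT}}(\Phi^\star)=0 . \] Furthermore, let $\Phi\in\operatorname{dom}(\mathcal L_{\mathrm{PMOT}})$ be a global minimizer of $\mathcal L_{\mathrm{PMOT}}$ over $\operatorname{dom}(\mathcal L_{\mathrm{PMOT}})$. If $\Phi\in C^2((0,1)\times\mathbb R^d)$ and $\operatorname{supp}(\rho_t^\Phi)=\mathbb R^d$ for every $t\in(0,1)$,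 then \[ v_\Phi=v^\star\qquad \mathrm dt\,\rho_t^\Phi(\mathrm dx)\text{-almost everywhere on }(0,1)\times\mathbb R^d, \] and the terminal map $F_\Phi$ is the unique (up to $\mu_0$-almost everywhere equality) optimal Monge map from $\mu_0$ to $\mu_1$ for the cost $\lVert x-y\rVert^p$.
   Context: $\lVert\cdot\rVert$ is the Euclidean norm on $\mathbb R^d$, $\mathcal P_p(\mathbb R^d)$ is the set of Borel probability measures on $\mathbb R^d$ with finite $p$-th moment, $T_\#\mu$ denotes the pushforward of $\mu$ under $T$, and $\mathrm{AC}([0,1];\mathbb R^d)$ is the set of absolutely continuous curves. **Induced velocity.** For a scalar potential $\Phi:[0,1]\times\mathbb R^d\to\mathbb R$, the induced velocity field is \[ v_\Phi(t,x)=-\lVert\nabla_x\Phi(t,x)\rVert^{q-2}\nabla_x\Phi(t,x), \] with the convention $v_\Phi(t,x)=0$ where $\nabla_x\Phi(t,x)=0$. More generally $\lVert w\rVert^{r-2}w:=0$ at $w=0$ for $r>1$. **Induced flow.** For $x\in\mathbb R^d$ consider the initial-value problem \[ \partial_t z(t)=v_\Phi(t,z(t))\ \text{ for almost every }t\in(0,1),\qquad z(0)=x. \tag{IVP} \] Only potentials $\Phi$ satisfying the following two requirements are considered: (i) for every $x\in\mathbb R^d$, (IVP) admits a unique solution in $\mathrm{AC}([0,1];\mathbb R^d)$, denoted $z_\Phi(\cdot,x)$; (ii) the solution map $z_\Phi:[0,1]\times\mathbb R^d\to\mathbb R^d$ is jointly Borel measurable. The terminal flow map is $F_\Phi(x)=z_\Phi(1,x)$,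 and the induced distribution at time $t\in[0,1]$ is $\rho_t^\Phi=(z_\Phi(t,\cdot))_\#\mu_0$; write $\rho^\Phi=(\rho^\Phi_t)_{t\in[0,1]}$. In particular $\rho_0^\Phi=\mu_0$ and $\rho_1^\Phi=(F_\Phi)_\#\mu_0$. **PMOT objective.** The potential matching loss is \[ \mathcal L_{\mathrm{PM}}(\Phi)=\int_{\mathbb R^d}\int_0^1\Bigl\lVert \nabla_x\Phi\bigl(t,(1-t)x+tF_\Phi(x)\bigr)+\lVert F_\Phi(x)-x\rVert^{p-2}\bigl(F_\Phi(x)-x\bigr)\Bigr\rVert^2\,\mathrm dt\,\mu_0(\mathrm dx), \] the terminal loss is $\mathcal L_{\mathrm{term}}(\Phi)=\mathcal D(\rho_1^\Phi,\mu_1)$, and \[ \mathcal L_{\mathrm{PMOT}}(\Phi)=\lambda_{\mathrm{PM}}\mathcal L_{\mathrm{PM}}(\Phi)+\lambda_{\mathrm{term}}\mathcal L_{\mathrm{term}}(\Phi). \] The domain $\operatorname{dom}(\mathcal L_{\mathrm{PMOT}})$ consists of all potentials $\Phi:[0,1]\times\mathbb R^d\to\mathbb R$ satisfying (i) and (ii) for which both $\mathcal L_{\mathrm{PM}}(\Phi)$ and $\mathcal L_{\mathrm{term}}(\Phi)$ are well defined. **$p$-Benamou--Brenier problem.** This is the problem of minimizing \[ \frac1p\int_0^1\int_{\mathbb R^d}\lVert v(t,x)\rVert^p\,\rho_t(\mathrm dx)\,\mathrm dt \] over pairs $(\rho,v)$, where $\rho=(\rho_t)_{t\in[0,1]}$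 is a curve of probability measures and $v$ a time-dependent velocity field, subject to $\rho_0=\mu_0$, $\rho_1=\mu_1$ and the continuity equation $\partial_t\rho_t+\nabla_x\cdot(\rho_t v)=0$ in the distributional sense. **Optimal Monge map.** An optimal Monge map from $\mu_0$ to $\mu_1$ for the cost $\lVert x-y\rVert^p$ is a Borel map $T$ with $T_\#\mu_0=\mu_1$ and $\int\lVert T(x)-x\rVert^p\,\mu_0(\mathrm dx)=W_p^p(\mu_0,\mu_1):=\inf_{\pi\in\Pi(\mu_0,\mu_1)}\int\lVert x-y\rVert^p\,\pi(\mathrm dx,\mathrm dy)$, where $\Pi(\mu_0,\mu_1)$ is the set of couplings of $\mu_0$ and $\mu_1$. *)

theory Defs
  imports "HOL-Probability.Probability"
begin

section \<open>Measures and transport\<close>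

definition borel_prob :: "'a::euclidean_space measure \<Rightarrow> bool" where
  "borel_prob \<mu> \<longleftrightarrow> prob_space \<mu> \<and> sets \<mu> = sets borel"

definition prob_finite_moment :: "real \<Rightarrow> 'a::euclidean_space measure set" where
  "prob_finite_moment p = {\<mu>. borel_prob \<mu> \<and> (\<integral>\<^sup>+x. ennreal (norm x powr p) \<partial>\<mu>) < \<infinity>}"

definition measure_support :: "'a::euclidean_space measure \<Rightarrow> 'a set" where
  "measure_support \<mu> = {x. \<forall>U. open U \<longrightarrow> x \<in> U \<longrightarrow> emeasure \<mu> U > 0}"

definition couplings ::
  "'a::euclidean_space measure \<Rightarrow> 'a measure \<Rightarrow> ('a \<times> 'a) measure set" where
  "couplings \<mu> \<nu> = {\<pi>. borel_prob \<pi> \<and> distr \<pi> borel fst = \<mu> \<and> distr \<pi> borel snd = \<nu>}"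

text \<open>The \<open>p\<close>-th power of the Wasserstein distance.\<close>

definition transport_cost :: "real \<Rightarrow> 'a::euclidean_space measure \<Rightarrow> 'a measure \<Rightarrow> ennreal" where
  "transport_cost p \<mu> \<nu> =
     (INF \<pi>\<in>couplings \<mu> \<nu>. \<integral>\<^sup>+z. ennreal (norm (fst z - snd z) powr p) \<partial>\<pi>)"

definition optimal_monge_map ::
  "real \<Rightarrow> 'a::euclidean_space measure \<Rightarrow> 'a measure \<Rightarrow> ('a \<Rightarrow> 'a) \<Rightarrow> bool" where
  "optimal_monge_map p \<mu> \<nu> T \<longleftrightarrow>
     T \<in> borel_measurable borel \<and> distr \<mu> borel T = \<nu> \<and>
     (\<integral>\<^sup>+x. ennreal (norm (T x - x) powr p) \<partial>\<mu>) = transport_cost p \<mu> \<nu>"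

section \<open>Regularity of functions and curves\<close>

text \<open>Functions of class \<open>C\<^sup>k\<close> on an open set \<open>S\<close>.\<close>

primrec Ck_on :: "nat \<Rightarrow> 'b::euclidean_space set \<Rightarrow> ('b \<Rightarrow> real) \<Rightarrow> bool" where
  "Ck_on 0 S f \<longleftrightarrow> continuous_on S f"
| "Ck_on (Suc k) S f \<longleftrightarrow>
     (\<forall>y\<in>S. f differentiable (at y)) \<and>
     (\<forall>b\<in>Basis. Ck_on k S (\<lambda>y. frechet_derivative f (at y) b))"

text \<open>The gradient is a fixed unspecified vector at points where \<open>f\<close> is not differentiable; the
  definitions below that use it ask for differentiability where it is evaluated.\<close>

definition gradient :: "('a::euclidean_space \<Rightarrow> real) \<Rightarrow> 'a \<Rightarrow> 'a" where
  "gradient f x = (THE g. GDERIV f x :> g)"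

definition abs_cont_curve :: "(real \<Rightarrow> 'a::euclidean_space) \<Rightarrow> bool" where
  "abs_cont_curve z \<longleftrightarrow>
     (\<forall>\<epsilon>>0. \<exists>\<delta>>0. \<forall>(n::nat) a b.
        (\<forall>i<n. 0 \<le> a i \<and> a i \<le> b i \<and> b i \<le> 1) \<longrightarrow>
        disjoint_family_on (\<lambda>i. {a i<..<b i}) {..<n} \<longrightarrow>
        (\<Sum>i<n. b i - a i) < \<delta> \<longrightarrow>
        (\<Sum>i<n. norm (z (b i) - z (a i))) < \<epsilon>)"

text \<open>\<open>\<parallel>w\<parallel>\<^sup>r\<^sup>-\<^sup>2 w\<close>, which is \<open>0\<close> at \<open>w = 0\<close>.\<close>

definition pow_dir :: "real \<Rightarrow> 'a::euclidean_space \<Rightarrow> 'a" where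
  "pow_dir r w = (norm w powr (r - 2)) *\<^sub>R w"

section \<open>Velocity and flow induced by a potential\<close>

text \<open>Potentials \<open>\<Phi>\<close> have type \<open>real \<Rightarrow> 'a \<Rightarrow> real\<close>; only times in the unit interval matter.\<close>

abbreviation unit_time :: "real measure" where
  "unit_time \<equiv> restrict_space lborel {0<..<1}"

definition induced_velocity ::
  "real \<Rightarrow> (real \<Rightarrow> 'a::euclidean_space \<Rightarrow> real) \<Rightarrow> real \<Rightarrow> 'a \<Rightarrow> 'a" where
  "induced_velocity q \<Phi> t x = - pow_dir q (gradient (\<Phi> t) x)"

text \<open>Solutions are curves on the closed unit interval; \<open>extensional\<close> fixes their values
  elsewhere, so that uniqueness can be stated as \<open>\<exists>!\<close>.\<close>

definition solves_ivp ::
  "real \<Rightarrow> (real \<Rightarrow> 'a::euclidean_space \<Rightarrow> real) \<Rightarrow> 'a \<Rightarrow> (real \<Rightarrow> 'a) \<Rightarrow> bool" where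
  "solves_ivp q \<Phi> x z \<longleftrightarrow>
     z \<in> extensional {0..1} \<and> abs_cont_curve z \<and> z 0 = x \<and>
     (AE t in unit_time. \<Phi> t differentiable (at (z t)) \<and>
        (z has_vector_derivative induced_velocity q \<Phi> t (z t)) (at t))"

definition flow ::
  "real \<Rightarrow> (real \<Rightarrow> 'a::euclidean_space \<Rightarrow> real) \<Rightarrow> real \<Rightarrow> 'a \<Rightarrow> 'a" where
  "flow q \<Phi> t x = (THE z. solves_ivp q \<Phi> x z) t"

definition flow_regular :: "real \<Rightarrow> (real \<Rightarrow> 'a::euclidean_space \<Rightarrow> real) \<Rightarrow> bool" where
  "flow_regular q \<Phi> \<longleftrightarrow>
     (\<forall>x. \<exists>!z. solves_ivp q \<Phi> x z) \<and>
     (\<lambda>(t, x). flow q \<Phi> t x) \<in> borel_measurable (restrict_space borel ({0..1} \<times> UNIV))"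

definition terminal_map ::
  "real \<Rightarrow> (real \<Rightarrow> 'a::euclidean_space \<Rightarrow> real) \<Rightarrow> 'a \<Rightarrow> 'a" where
  "terminal_map q \<Phi> x = flow q \<Phi> 1 x"

definition induced_law ::
  "real \<Rightarrow> 'a::euclidean_space measure \<Rightarrow> (real \<Rightarrow> 'a \<Rightarrow> real) \<Rightarrow> real \<Rightarrow> 'a measure" where
  "induced_law q \<mu>\<^sub>0 \<Phi> t = distr \<mu>\<^sub>0 borel (flow q \<Phi> t)"

section \<open>The PMOT objective\<close>

definition terminal_segment ::
  "real \<Rightarrow> (real \<Rightarrow> 'a::euclidean_space \<Rightarrow> real) \<Rightarrow> real \<Rightarrow> 'a \<Rightarrow> 'a" where
  "terminal_segment q \<Phi> t x = (1 - t) *\<^sub>R x + t *\<^sub>R terminal_map q \<Phi> x"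

definition pm_residual ::
  "real \<Rightarrow> real \<Rightarrow> (real \<Rightarrow> 'a::euclidean_space \<Rightarrow> real) \<Rightarrow> real \<Rightarrow> 'a \<Rightarrow> 'a" where
  "pm_residual p q \<Phi> t x =
     gradient (\<Phi> t) (terminal_segment q \<Phi> t x) + pow_dir p (terminal_map q \<Phi> x - x)"

definition pm_loss ::
  "real \<Rightarrow> real \<Rightarrow> 'a::euclidean_space measure \<Rightarrow> (real \<Rightarrow> 'a \<Rightarrow> real) \<Rightarrow> ennreal" where
  "pm_loss p q \<mu>\<^sub>0 \<Phi> =
     (\<integral>\<^sup>+x. \<integral>\<^sup>+t. ennreal ((norm (pm_residual p q \<Phi> t x))\<^sup>2) \<partial>unit_time \<partial>\<mu>\<^sub>0)"

text \<open>The integrand of \<open>pm_loss\<close> is nonnegative, so the integral makes sense, possibly with value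
  \<open>\<infinity>\<close>, once the integrand is defined almost everywhere and measurable.\<close>

definition pm_loss_well_defined ::
  "real \<Rightarrow> real \<Rightarrow> 'a::euclidean_space measure \<Rightarrow> (real \<Rightarrow> 'a \<Rightarrow> real) \<Rightarrow> bool" where
  "pm_loss_well_defined p q \<mu>\<^sub>0 \<Phi> \<longleftrightarrow>
     (AE (x, t) in \<mu>\<^sub>0 \<Otimes>\<^sub>M unit_time. \<Phi> t differentiable (at (terminal_segment q \<Phi> t x))) \<and>
     (\<lambda>(x, t). (norm (pm_residual p q \<Phi> t x))\<^sup>2)
        \<in> borel_measurable (completion (\<mu>\<^sub>0 \<Otimes>\<^sub>M unit_time))"

definition term_loss ::
  "('a measure \<Rightarrow> 'a measure \<Rightarrow> ennreal) \<Rightarrow> real \<Rightarrow> 'a::euclidean_space measure \<Rightarrow> 'a measure \<Rightarrow>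
    (real \<Rightarrow> 'a \<Rightarrow> real) \<Rightarrow> ennreal" where
  "term_loss D q \<mu>\<^sub>0 \<mu>\<^sub>1 \<Phi> = D (induced_law q \<mu>\<^sub>0 \<Phi> 1) \<mu>\<^sub>1"

definition pmot_loss ::
  "real \<Rightarrow> real \<Rightarrow> ('a measure \<Rightarrow> 'a measure \<Rightarrow> ennreal) \<Rightarrow> real \<Rightarrow> real \<Rightarrow>
    'a::euclidean_space measure \<Rightarrow> 'a measure \<Rightarrow> (real \<Rightarrow> 'a \<Rightarrow> real) \<Rightarrow> ennreal" where
  "pmot_loss lam_pm lam_term D p q \<mu>\<^sub>0 \<mu>\<^sub>1 \<Phi> =
     ennreal lam_pm * pm_loss p q \<mu>\<^sub>0 \<Phi> + ennreal lam_term * term_loss D q \<mu>\<^sub>0 \<mu>\<^sub>1 \<Phi>"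

text \<open>Discrepancies are defined on all pairs of probability measures, with values in \<open>[0, \<infinity>]\<close>, so
  the terminal loss is well defined as soon as the flow is measurable.\<close>

definition pmot_domain ::
  "real \<Rightarrow> real \<Rightarrow> 'a::euclidean_space measure \<Rightarrow> (real \<Rightarrow> 'a \<Rightarrow> real) set" where
  "pmot_domain p q \<mu>\<^sub>0 = {\<Phi>. flow_regular q \<Phi> \<and> pm_loss_well_defined p q \<mu>\<^sub>0 \<Phi>}"

section \<open>The Benamou--Brenier problem\<close>

definition narrowly_continuous :: "(real \<Rightarrow> 'a::euclidean_space measure) \<Rightarrow> bool" where
  "narrowly_continuous \<rho> \<longleftrightarrow>
     (\<forall>f :: 'a \<Rightarrow> real. continuous_on UNIV f \<longrightarrow> bounded (range f) \<longrightarrow>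
        continuous_on {0..1} (\<lambda>t. \<integral>x. f x \<partial>\<rho> t))"

text \<open>\<open>C\<^sub>c\<^sup>\<infinity>((0,1) \<times> \<real>\<^sup>d)\<close>, each function extended by zero.\<close>

definition test_functions :: "(real \<times> 'a::euclidean_space \<Rightarrow> real) set" where
  "test_functions = {\<phi>. (\<forall>k. Ck_on k UNIV \<phi>) \<and> compact (closure {y. \<phi> y \<noteq> 0}) \<and>
     closure {y. \<phi> y \<noteq> 0} \<subseteq> {0<..<1} \<times> UNIV}"

text \<open>Local integrability makes \<open>\<rho> v\<close> a distribution; without it the Bochner integrals
  below could vanish by convention.\<close>

definition continuity_equation ::
  "(real \<Rightarrow> 'a::euclidean_space measure) \<Rightarrow> (real \<Rightarrow> 'a \<Rightarrow> 'a) \<Rightarrow> bool" where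
  "continuity_equation \<rho> v \<longleftrightarrow>
     (\<forall>K. compact K \<longrightarrow> K \<subseteq> {0<..<1} \<times> UNIV \<longrightarrow>
        (\<integral>\<^sup>+t. \<integral>\<^sup>+x. ennreal (norm (v t x)) * indicator K (t, x) \<partial>\<rho> t \<partial>unit_time) < \<infinity>) \<and>
     (\<forall>\<phi>\<in>test_functions.
        (\<integral>t. (\<integral>x. deriv (\<lambda>s. \<phi> (s, x)) t + gradient (\<lambda>y. \<phi> (t, y)) x \<bullet> v t x \<partial>\<rho> t)
           \<partial>unit_time) = 0)"

text \<open>A curve of probability measures is understood to be narrowly continuous on the closed
  interval; otherwise the endpoint constraints would be independent of the continuity equation.\<close>

definition bb_admissible ::
  "'a::euclidean_space measure \<Rightarrow> 'a measure \<Rightarrow>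
    (real \<Rightarrow> 'a measure) \<times> (real \<Rightarrow> 'a \<Rightarrow> 'a) \<Rightarrow> bool" where
  "bb_admissible \<mu>\<^sub>0 \<mu>\<^sub>1 = (\<lambda>(\<rho>, v).
     (\<forall>t\<in>{0..1}. borel_prob (\<rho> t)) \<and> narrowly_continuous \<rho> \<and>
     (\<lambda>(t, x). v t x) \<in> borel_measurable (restrict_space borel ({0<..<1} \<times> UNIV)) \<and>
     \<rho> 0 = \<mu>\<^sub>0 \<and> \<rho> 1 = \<mu>\<^sub>1 \<and> continuity_equation \<rho> v)"

definition bb_cost ::
  "real \<Rightarrow> (real \<Rightarrow> 'a::euclidean_space measure) \<times> (real \<Rightarrow> 'a \<Rightarrow> 'a) \<Rightarrow> ennreal" where
  "bb_cost p = (\<lambda>(\<rho>, v).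
     ennreal (1 / p) * (\<integral>\<^sup>+t. \<integral>\<^sup>+x. ennreal (norm (v t x) powr p) \<partial>\<rho> t \<partial>unit_time))"

end

theory Submission
  imports Defs
begin

text \<open>Let \<open>F\<close> be a terminal map with displacement \<open>F x - x\<close>. Moving \<open>\<mu>\<^sub>0\<close> along the segments from
  \<open>x\<close> to \<open>F x\<close>, with the conditional expectation of the displacement as velocity, is admissible in
  the Benamou--Brenier problem and costs at most \<open>1/p\<close> times the integral of \<open>\<parallel>F x - x\<parallel>\<^sup>p\<close>. For the
  terminal map of a minimizing flow this bounds the energy of the trajectories by that of their
  chords, so the trajectories are traversed with constant velocity, which says that the potential
  matching loss vanishes.

  Conversely, let the loss of a \<open>C\<^sup>2\<close> potential \<open>\<Phi>\<close> vanish. By uniqueness of the flow almost all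
  trajectories are straight, and \<open>\<nabla>\<Phi>\<close> is constant along them. Differentiating in time shows that
  \<open>\<partial>\<^sub>t\<Phi> - \<parallel>\<nabla>\<Phi>\<parallel>\<^sup>q / q\<close> has zero spatial gradient on the trajectories, hence everywhere because the
  laws have full support; after subtracting a function of time, \<open>\<Phi>\<close> solves the Hamilton--Jacobi
  equation on the open time interval. Therefore \<open>\<Phi>\<close> plus the action increases along every affine
  path and is constant exactly on characteristics. The limits at the two ends of the time interval
  give Kantorovich potentials, so \<open>F\<close> is optimal. The segments of any other optimal map are
  characteristics too, hence solutions of the same initial-value problem, and the map is \<open>F\<close>.\<close>

section \<open>The conjugate power maps\<close>

text \<open>\<open>pow_dir p\<close> and \<open>pow_dir q\<close> are mutually inverse, so a
  vanishing residual says precisely that the segment from \<open>x\<close> to \<open>F x\<close>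
  solves the initial-value problem. The equality case of Young's inequality is used twice: it makes
  curves of minimal energy affine, and it picks out the characteristics among all affine paths. The
  obstacle in the converse is that \<open>\<Phi>\<close> is regular only at times inside the open
  unit interval, so boundary values at times 0 and 1 cannot simply be evaluated. The dual potentials
  are therefore an infimum and a supremum of the action over interior points of segments, with
  extended real values; the dual inequality holds for them everywhere, and finiteness is obtained on
  characteristics. The identity of the two velocity fields rests on uniqueness of the optimal map:
  the competitor built from \<open>F\<close> bounds the cost of the minimizer, so the terminal map
  of \<open>\<Phi>s\<close> is optimal as well and equals \<open>F\<close> almost everywhere. Both
  fields then have the value \<open>F x - x\<close> along the common segments.\<close>

lemma conjugate_exponent:
  fixes p q :: real
  assumes "1 < p" "q = p / (p - 1)"
  shows "1 < q" "p = q / (q - 1)" "1 / p + 1 / q = 1" "(p - 1) * (q - 1) = 1" "(p - 1) * q = p"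
    "(q - 1) * p = q"
proof -
  have q: "q - 1 = 1 / (p - 1)" "0 < p - 1"
    using assms by (simp_all add: field_simps)
  then show "1 < q"
    by (metis diff_gt_0_iff_gt zero_less_divide_1_iff)
  show "p = q / (q - 1)"
    unfolding q using assms by simp
  show "1 / p + 1 / q = 1"
    using assms by (simp add: diff_divide_distrib)
  show "(p - 1) * (q - 1) = 1" "(q - 1) * p = q"
    unfolding q using assms by simp_all
  show "(p - 1) * q = p"
    using assms by simp
qed

lemma norm_pow_dir: "norm (pow_dir r w) = norm w powr (r - 1)"
proof (cases "w = 0")
  case False
  have "norm w powr (r - 2) * norm w powr 1 = norm w powr (r - 2 + 1)"
    by (rule powr_add[symmetric])
  then show ?thesis using False by (simp add: pow_dir_def)
qed (simp add: pow_dir_def)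

lemma pow_dir_zero [simp]: "pow_dir r 0 = 0"
  by (simp add: pow_dir_def)

lemma pow_dir_minus [simp]: "pow_dir r (- w) = - pow_dir r w"
  by (simp add: pow_dir_def)

text \<open>The composition multiplies \<open>w\<close> by a power of its norm whose exponent is
  (p-1)(q-2)+(p-2) = (p-1)(q-1)-1 = 0.\<close>

lemma pow_dir_inverse:
  assumes "1 < p" "q = p / (p - 1)"
  shows "pow_dir q (pow_dir p w) = w"
proof (cases "w = 0")
  case False
  have e: "(p - 1) * (q - 2) + (p - 2) = 0"
    using conjugate_exponent(4)[OF assms] by (simp add: algebra_simps)
  have "pow_dir q (pow_dir p w)
      = ((norm w powr (p - 1)) powr (q - 2) * norm w powr (p - 2)) *\<^sub>R w"
    unfolding pow_dir_def[of q] norm_pow_dir by (simp add: pow_dir_def)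
  also have "(norm w powr (p - 1)) powr (q - 2) * norm w powr (p - 2)
      = norm w powr ((p - 1) * (q - 2) + (p - 2))"
    by (simp add: powr_powr powr_add)
  finally show ?thesis using False by (simp add: e)
qed simp

lemma inner_pow_dir: "w \<bullet> pow_dir r w = norm w powr r"
proof (cases "w = 0")
  case False
  have "norm w powr (r - 2) * norm w powr 2 = norm w powr (r - 2 + 2)"
    by (rule powr_add[symmetric])
  moreover have "w \<bullet> pow_dir r w = norm w powr (r - 2) * (norm w)\<^sup>2"
    by (simp add: pow_dir_def power2_norm_eq_inner)
  ultimately show ?thesis using False by simp
qed simp

lemma norm_pow_dir_powr:
  assumes "1 < p" "q = p / (p - 1)"
  shows "norm (pow_dir q w) powr p = norm w powr q"
  using conjugate_exponent(6)[OF assms] by (simp add: norm_pow_dir powr_powr)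

text \<open>For r < 2 the scalar factor blows up near the origin, so continuity there is read off
  from the norm of the value, \<open>norm w powr (r - 1)\<close>.\<close>

lemma continuous_pow_dir:
  fixes w :: "'a::euclidean_space"
  assumes "1 < r"
  shows "isCont (pow_dir r) w"
proof (cases "w = 0")
  case False
  then show ?thesis unfolding pow_dir_def
    by (intro continuous_intros) auto
next
  case True
  have "((\<lambda>x::'a. norm x powr (r - 1)) \<longlongrightarrow> norm (0::'a) powr (r - 1)) (at 0)"
    using assms
    by (intro tendsto_powr' tendsto_intros) (auto simp: always_eventually)
  then have "((\<lambda>x. norm (pow_dir r (x::'a))) \<longlongrightarrow> 0) (at 0)"
    by (simp add: norm_pow_dir)
  then show ?thesis using True
    by (simp add: isCont_def tendsto_norm_zero_iff)
qed

text \<open>The chain rule fails at the origin, where the norm is not differentiable; there the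
  difference quotient is \<open>norm x powr (r - 1) / r\<close>, which tends to 0 because r >
  1.\<close>

lemma has_derivative_norm_powr:
  fixes w :: "'a::euclidean_space"
  assumes r: "1 < r"
  shows "((\<lambda>x. norm x powr r / r) has_derivative (\<lambda>h. pow_dir r w \<bullet> h)) (at w)"
proof (cases "w = 0")
  case False
  have "((\<lambda>x. norm x powr r) has_derivative
      (\<lambda>h. (norm w powr r) * (0 * ln (norm w) + (h \<bullet> sgn w) * r / norm w))) (at w)"
    using False by (intro has_derivative_powr has_derivative_norm has_derivative_const) auto
  then have "((\<lambda>x. norm x powr r * (1 / r)) has_derivative
      (\<lambda>h. (norm w powr r) * (0 * ln (norm w) + (h \<bullet> sgn w) * r / norm w) * (1 / r))) (at w)"
    by (rule has_derivative_mult_left)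
  moreover have "norm w powr r = norm w powr (r - 2) * norm w ^ 2"
    using False powr_add[of "norm w" "r - 2" 2] by simp
  ultimately show ?thesis using False r
    by (simp add: pow_dir_def sgn_div_norm field_simps power2_eq_square inner_commute)
next
  case True
  have "((\<lambda>x::'a. norm x powr (r - 1) / r) \<longlongrightarrow> norm (0::'a) powr (r - 1) / r) (at 0)"
    using assms
    by (intro tendsto_divide tendsto_powr' tendsto_intros) (auto simp: always_eventually)
  moreover have "norm x powr (r - 1) / r = norm (norm x powr r / r) / norm x" if "x \<noteq> 0" for x::'a
    using that r powr_add[of "norm x" "r - 1" 1] by (simp add: field_simps)
  ultimately have "((\<lambda>x::'a. norm (norm x powr r / r) / norm x) \<longlongrightarrow> 0) (at 0)"
    using tendsto_cong[of "\<lambda>x::'a. norm x powr (r - 1) / r"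
        "\<lambda>x. norm (norm x powr r / r) / norm x" "at 0" 0] by (simp add: eventually_at_filter)
  then show ?thesis using True r
    by (simp add: has_derivative_at)
qed

lemma Young_inner:
  fixes \<xi> g :: "'a::euclidean_space"
  assumes "1 < p" "q = p / (p - 1)"
  shows "\<xi> \<bullet> g \<le> norm g powr p / p + norm \<xi> powr q / q"
proof -
  note c = conjugate_exponent[OF assms]
  have "\<xi> \<bullet> g \<le> norm g * norm \<xi>"
    using norm_cauchy_schwarz[of \<xi> g] by (simp add: mult.commute)
  also have "\<dots> \<le> norm g powr p / p + norm \<xi> powr q / q"
    using assms(1) c by (intro Youngs_inequality) auto
  finally show ?thesis .
qed

text \<open>An equality case is a minimum of \<open>\<lambda>h. \<parallel>h\<parallel>\<^sup>p / p - \<xi> \<bullet> h\<close>.\<close>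

lemma Young_inner_eq:
  fixes \<xi> g :: "'a::euclidean_space"
  assumes "1 < p" "q = p / (p - 1)" and eq: "\<xi> \<bullet> g = norm g powr p / p + norm \<xi> powr q / q"
  shows "g = pow_dir q \<xi>"
proof -
  let ?f = "\<lambda>h. norm h powr p / p - \<xi> \<bullet> h"
  have d: "(?f has_derivative (\<lambda>h. pow_dir p g \<bullet> h - \<xi> \<bullet> h)) (at g)"
    using assms(1) by (intro has_derivative_norm_powr derivative_intros)
  have "?f g \<le> ?f h" for h
    using Young_inner[OF assms(1,2), of \<xi> h] eq by simp
  then have "(\<lambda>h. pow_dir p g \<bullet> h - \<xi> \<bullet> h) = (\<lambda>h. 0)"
    by (intro differential_zero_maxmin[OF _ open_UNIV d]) auto
  then have "pow_dir p g \<bullet> h - \<xi> \<bullet> h = 0" for h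
    by meson
  then have "\<xi> = pow_dir p g"
    by (metis inner_diff_left inner_eq_zero_iff right_minus_eq)
  then show ?thesis
    using pow_dir_inverse[OF assms(1,2), of g] by simp
qed

section \<open>Absolutely continuous curves\<close>

text \<open>Tags in the exceptional null set are confined to an open set of small measure, where absolute
  continuity controls the increments of the curve.\<close>

lemma abs_cont_curve_has_integral:
  fixes z :: "real \<Rightarrow> 'a::euclidean_space"
  assumes z: "abs_cont_curve z" and ab: "0 \<le> a" "a \<le> b" "b \<le> 1"
    and deriv: "AE t in unit_time. (z has_vector_derivative g t) (at t)"
  shows "(g has_integral (z b - z a)) {a..b}"
proof -
  have "AE t in lborel. t \<in> {0<..<1} \<longrightarrow> (z has_vector_derivative g t) (at t)"
    using deriv by (simp add: AE_restrict_space_iff)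
  moreover have "AE t in lborel. t \<noteq> 0 \<and> t \<noteq> (1::real)"
    by (intro AE_conjI AE_lborel_singleton)
  ultimately have "AE t in lborel. t \<in> {0..1} \<longrightarrow> (z has_vector_derivative g t) (at t)"
    by eventually_elim auto
  then obtain N where N': "\<And>t. t \<in> space lborel - N \<Longrightarrow>
        t \<in> {0..1} \<longrightarrow> (z has_vector_derivative g t) (at t)" and N: "N \<in> null_sets lborel"
    by (rule AE_E3) blast
  \<comment> \<open>With value 0 on \<open>N\<close>, tags in \<open>N\<close> contribute nothing to
    Riemann sums, and only the increments of \<open>z\<close> over their intervals remain to be
    estimated.\<close>
  define f' where "f' t = (if t \<in> N then 0 else g t)" for t
  have "(f' has_integral (z b - z a)) {a..b}"
    unfolding has_integral_real
  proof (intro allI impI)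
    fix e :: real
    assume e: "0 < e"
    \<comment> \<open>The 1 in the denominator keeps the quotient meaningful when a = b and makes
      the bound by \<open>e / 2\<close> strict.\<close>
    define e1 where "e1 = e / (2 * (b - a + 1))"
    have e1: "0 < e1" "e1 * (b - a) < e / 2"
      using e ab by (auto simp: e1_def field_simps)
    have "\<exists>\<delta>>0. \<forall>(n::nat) a b. (\<forall>i<n. 0 \<le> a i \<and> a i \<le> b i \<and> b i \<le> 1) \<longrightarrow>
        disjoint_family_on (\<lambda>i. {a i<..<b i}) {..<n} \<longrightarrow>
        (\<Sum>i<n. b i - a i) < \<delta> \<longrightarrow> (\<Sum>i<n. norm (z (b i) - z (a i))) < e / 2"
      using z e unfolding abs_cont_curve_def by (elim allE[of _ "e / 2"]) simp
    then obtain \<delta> where \<delta>: "0 < \<delta>" and ac: "\<forall>(n::nat) a b. (\<forall>i<n. 0 \<le> a i \<and> a i \<le> b i \<and> b i \<le> 1) \<longrightarrow>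
        disjoint_family_on (\<lambda>i. {a i<..<b i}) {..<n} \<longrightarrow>
        (\<Sum>i<n. b i - a i) < \<delta> \<longrightarrow> (\<Sum>i<n. norm (z (b i) - z (a i))) < e / 2"
      by (elim exE conjE)
    obtain U where U: "open U" "N \<subseteq> U" "emeasure lborel (U - N) < \<delta>"
      using outer_regular_lborel[of N \<delta>] N \<delta> by (metis null_setsD2 sets_lborel)
    have emU: "emeasure lborel U < \<delta>"
      using U emeasure_Diff_null_set[OF N, of U] by simp
    have "\<forall>x. \<exists>d>0. x \<in> {a..b} - N \<longrightarrow>
         (\<forall>y\<in>{a..b}. norm (y-x) < d \<longrightarrow> norm (z y - z x - (y-x) *\<^sub>R f' x) \<le> e1 * norm (y-x))"
    proof
      fix x
      show "\<exists>d>0. x \<in> {a..b} - N \<longrightarrow>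
         (\<forall>y\<in>{a..b}. norm (y-x) < d \<longrightarrow> norm (z y - z x - (y-x) *\<^sub>R f' x) \<le> e1 * norm (y-x))"
      proof (cases "x \<in> {a..b} - N")
        case True
        then have "(z has_vector_derivative f' x) (at x)"
          using N'[of x] ab by (auto simp: f'_def)
        then show ?thesis
          using e1(1) unfolding has_vector_derivative_def has_derivative_at_alt by blast
      next
        case False
        then show ?thesis by (auto intro!: exI[of _ 1])
      qed
    qed
    then obtain d where d: "\<And>x. 0 < d x"
        "\<And>x y. x \<in> {a..b} - N \<Longrightarrow> y \<in> {a..b} \<Longrightarrow> norm (y-x) < d x
           \<Longrightarrow> norm (z y - z x - (y-x) *\<^sub>R f' x) \<le> e1 * norm (y-x)"
      by metis
    define \<gamma> where "\<gamma> x = (if x \<in> N then U else ball x (d x))" for x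
    have "norm ((\<Sum>(x, K)\<in>p. Henstock_Kurzweil_Integration.content K *\<^sub>R f' x) - (z b - z a)) < e"
      if p: "p tagged_division_of {a..b}" and fine: "\<gamma> fine p" for p
    proof -
      have fp: "finite p"
        using p by blast
      have K: "\<exists>u v. K = {u..v} \<and> u \<le> v \<and> x \<in> K \<and> a \<le> u \<and> v \<le> b \<and> Sup K = v \<and> Inf K = u
          \<and> Henstock_Kurzweil_Integration.content K = v - u \<and> K \<subseteq> \<gamma> x" if xK: "(x, K) \<in> p" for x K
      proof -
        obtain u v where uv: "K = {u..v}"
          using tagged_division_ofD(4)[OF p xK] by auto
        moreover have "x \<in> K" "K \<subseteq> {a..b}" "K \<subseteq> \<gamma> x"
          using tagged_division_ofD(2,3)[OF p xK] fine xK by (auto simp: fine_def)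
        ultimately show ?thesis by (intro exI[of _ u] exI[of _ v]) auto
      qed
      define \<Delta> where "\<Delta> = (\<lambda>(x::real, K). z (Sup K) - z (Inf K))"
      define w where "w = (\<lambda>(x, K :: real set). Henstock_Kurzweil_Integration.content K *\<^sub>R f' x)"
      define pb where "pb = {y \<in> p. fst y \<in> N}"
      define pg where "pg = {y \<in> p. fst y \<notin> N}"
      have p_split: "p = pb \<union> pg" "pb \<inter> pg = {}" "finite pb" "finite pg"
        using fp by (auto simp: pb_def pg_def)
      have tot: "(\<Sum>y\<in>p. \<Delta> y) = z b - z a" "(\<Sum>y\<in>p. case y of (x, K) \<Rightarrow> Sup K - Inf K) = b - a"
        using additive_tagged_division_1[OF ab(2) p, of z]
          additive_tagged_division_1[OF ab(2) p, of "\<lambda>x. x"] by (auto simp: \<Delta>_def)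
      \<comment> \<open>First-order expansion of \<open>z\<close> at the tag \<open>x\<close>
        towards both ends of its interval; since \<open>x\<close> lies between \<open>u\<close> and
        \<open>v\<close>, the two errors add up to \<open>e1 * (v - u)\<close>.\<close>
      have good: "norm (\<Sum>y\<in>pg. w y - \<Delta> y) \<le> (\<Sum>y\<in>pg. e1 * (case y of (x, K) \<Rightarrow> Sup K - Inf K))"
      proof (rule sum_norm_le)
        fix y assume y: "y \<in> pg"
        obtain x K where xK: "y = (x, K)" by (cases y)
        obtain u v where uv: "K = {u..v}" "u \<le> v" "x \<in> K" "a \<le> u" "v \<le> b" "Sup K = v" "Inf K = u"
            "Henstock_Kurzweil_Integration.content K = v - u" "K \<subseteq> \<gamma> x"
          using K[of x K] y by (simp only: pg_def xK mem_Collect_eq fst_conv) blast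
        have x: "x \<in> {a..b} - N" "\<gamma> x = ball x (d x)"
          using uv y by (auto simp: pg_def xK \<gamma>_def)
        have "u \<in> ball x (d x)" "v \<in> ball x (d x)"
          using uv(2,3,9) x(2) by (auto simp: uv(1) subset_iff)
        then have near: "norm (u - x) < d x" "norm (v - x) < d x"
          by (simp_all add: dist_real_def abs_minus_commute)
        have b: "norm (z u - z x - (u-x) *\<^sub>R f' x) \<le> e1 * norm (u-x)"
          using uv(2,4,5) by (intro d(2)[OF x(1) _ near(1)]) simp
        have b': "norm (z v - z x - (v-x) *\<^sub>R f' x) \<le> e1 * norm (v-x)"
          using uv(2,4,5) by (intro d(2)[OF x(1) _ near(2)]) simp
        have "norm (w y - \<Delta> y) = norm ((z u - z x - (u-x) *\<^sub>R f' x) - (z v - z x - (v-x) *\<^sub>R f' x))"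
          using uv by (auto simp: w_def \<Delta>_def xK algebra_simps)
        also have "\<dots> \<le> e1 * norm (u-x) + e1 * norm (v-x)"
          using b b' norm_triangle_ineq4 by (meson add_mono order_trans)
        also have "\<dots> = e1 * (v - u)"
          using uv by (auto simp: algebra_simps)
        finally show "norm (w y - \<Delta> y) \<le> e1 * (case y of (x, K) \<Rightarrow> Sup K - Inf K)"
          using uv by (simp add: xK)
      qed
      also have "\<dots> \<le> (\<Sum>y\<in>p. e1 * (case y of (x, K) \<Rightarrow> Sup K - Inf K))"
      proof (rule sum_mono2[OF fp])
        fix y assume "y \<in> p - pg"
        then obtain x C where "y = (x, C)" "(x, C) \<in> p" by (cases y) auto
        then show "0 \<le> e1 * (case y of (x, K) \<Rightarrow> Sup K - Inf K)"
          using K[of x C] e1(1) by auto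
      qed (simp add: pg_def)
      also have "\<dots> = e1 * (b - a)"
        by (simp add: sum_distrib_left[symmetric] tot)
      also have "\<dots> < e / 2"
        by (rule e1)
      finally have 1: "norm (\<Sum>y\<in>pg. w y - \<Delta> y) < e / 2" .
      \<comment> \<open>\<open>abs_cont_curve\<close> speaks of families indexed by an initial
        segment of the naturals, so the intervals with tags in \<open>N\<close> are
        enumerated.\<close>
      obtain h where h: "bij_betw h {..<card pb} pb"
        using ex_bij_betw_nat_finite[OF p_split(3)] by (auto simp: atLeast0LessThan)
      define lo up where "lo i = Inf (snd (h i))" and "up i = Sup (snd (h i))" for i
      have hi: "\<exists>x u v. h i = (x, {u..v}) \<and> u \<le> v \<and> a \<le> u \<and> v \<le> b \<and> lo i = u \<and> up i = v
          \<and> {u..v} \<subseteq> U \<and> (x, {u..v}) \<in> p" if "i < card pb" for i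
      proof -
        have "h i \<in> pb"
          using h that by (auto simp: bij_betw_def)
        then obtain x C where xC: "h i = (x, C)" "(x, C) \<in> p" "x \<in> N"
          by (cases "h i") (auto simp: pb_def)
        then show ?thesis
          using K[of x C] by (auto simp: lo_def up_def \<gamma>_def)
      qed
      have disj: "disjoint_family_on (\<lambda>i. {lo i<..<up i}) {..<card pb}"
        unfolding disjoint_family_on_def
      proof (intro ballI impI)
        fix i j assume ij: "i \<in> {..<card pb}" "j \<in> {..<card pb}" "i \<noteq> j"
        then have "h i \<noteq> h j"
          using h by (auto simp: bij_betw_def inj_on_def)
        moreover obtain x u v where i: "h i = (x, {u..v})" "lo i = u" "up i = v" "(x, {u..v}) \<in> p"
          using hi[of i] ij by auto
        moreover obtain x' u' v' where j: "h j = (x', {u'..v'})" "lo j = u'" "up j = v'"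
            "(x', {u'..v'}) \<in> p"
          using hi[of j] ij by auto
        ultimately have "interior {u..v} \<inter> interior {u'..v'} = {}"
          using tagged_division_ofD(5)[OF p] by metis
        then show "{lo i<..<up i} \<inter> {lo j<..<up j} = {}"
          by (simp add: i j)
      qed
      have "ennreal (\<Sum>i<card pb. up i - lo i) = (\<Sum>i<card pb. emeasure lborel {lo i<..<up i})"
      proof -
        have "lo i \<le> up i" if "i < card pb" for i
          using hi[OF that] by auto
        then show ?thesis by (subst sum_ennreal[symmetric]) auto
      qed
      also have "\<dots> = emeasure lborel (\<Union>i<card pb. {lo i<..<up i})"
        by (rule sum_emeasure) (auto simp: disj)
      also have "\<dots> \<le> emeasure lborel U"
      proof (rule emeasure_mono)
        have "{lo i<..<up i} \<subseteq> U" if "i < card pb" for i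
          using hi[OF that] by (auto simp: subset_iff)
        then show "(\<Union>i<card pb. {lo i<..<up i}) \<subseteq> U"
          by blast
      qed (simp add: U)
      also have "\<dots> < \<delta>"
        by (rule emU)
      finally have "(\<Sum>i<card pb. up i - lo i) < \<delta>"
        by (meson ennreal_leI not_le)
      moreover have "\<forall>i<card pb. 0 \<le> lo i \<and> lo i \<le> up i \<and> up i \<le> 1"
      proof (intro allI impI)
        fix i assume "i < card pb"
        from hi[OF this] show "0 \<le> lo i \<and> lo i \<le> up i \<and> up i \<le> 1"
          using ab by auto
      qed
      ultimately have "(\<Sum>i<card pb. norm (z (up i) - z (lo i))) < e / 2"
        by (intro ac[THEN spec, THEN spec, THEN spec, THEN mp, THEN mp, THEN mp] disj)
      also have "(\<Sum>i<card pb. norm (z (up i) - z (lo i))) = (\<Sum>i<card pb. norm (\<Delta> (h i)))"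
        by (simp add: \<Delta>_def up_def lo_def split_beta)
      also have "\<dots> = (\<Sum>y\<in>pb. norm (\<Delta> y))"
        by (rule sum.reindex_bij_betw[OF h])
      finally have "(\<Sum>y\<in>pb. norm (\<Delta> y)) < e / 2" .
      moreover have "norm (\<Sum>y\<in>pb. w y - \<Delta> y) \<le> (\<Sum>y\<in>pb. norm (\<Delta> y))"
        by (rule sum_norm_le) (auto simp: w_def pb_def f'_def)
      ultimately have 2: "norm (\<Sum>y\<in>pb. w y - \<Delta> y) < e / 2"
        by linarith
      have "(\<Sum>(x, K)\<in>p. Henstock_Kurzweil_Integration.content K *\<^sub>R f' x) - (z b - z a) = (\<Sum>y\<in>p. w y - \<Delta> y)"
        by (simp add: sum_subtractf tot w_def)
      also have "\<dots> = (\<Sum>y\<in>pb. w y - \<Delta> y) + (\<Sum>y\<in>pg. w y - \<Delta> y)"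
        by (subst p_split(1)) (rule sum.union_disjoint[OF p_split(3,4,2)])
      finally show ?thesis
        using 1 2 norm_triangle_ineq[of "\<Sum>y\<in>pb. w y - \<Delta> y" "\<Sum>y\<in>pg. w y - \<Delta> y"] by simp
    qed
    moreover have "gauge \<gamma>"
      using U d(1) by (auto simp: gauge_def \<gamma>_def)
    ultimately show "\<exists>\<gamma>. gauge \<gamma> \<and> (\<forall>\<D>. \<D> tagged_division_of {a..b} \<and> \<gamma> fine \<D> \<longrightarrow>
        norm ((\<Sum>(x, k)\<in>\<D>. Henstock_Kurzweil_Integration.content k *\<^sub>R f' x) - (z b - z a)) < e)"
      by blast
  qed
  moreover have "negligible N"
    using N by (simp add: negligible_iff_null_sets null_sets_completionI)
  ultimately show ?thesis
    by (rule has_integral_spike[rotated 2]) (auto simp: f'_def)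
qed

section \<open>Symmetry of mixed partials\<close>

text \<open>The mean value theorem applies to the difference \<open>g s\<close> of \<open>f\<close>
  along two parallel lines in direction \<open>u\<close>. The intermediate point
  \<open>\<theta>\<close> is unknown, but it cancels once the partial is linearized at
  \<open>y\<close>, because \<open>A (\<theta> *\<^sub>R u + h *\<^sub>R v) - A (\<theta> *\<^sub>R
  u) = h * A v\<close>. Second differentiability enters only at \<open>y\<close> itself.\<close>

lemma second_difference_quotient:
  fixes f :: "'b::real_normed_vector \<Rightarrow> real"
  assumes S: "open S" "y \<in> S" and f: "\<And>x. x \<in> S \<Longrightarrow> (f has_derivative f' x) (at x)"
    and A: "((\<lambda>x. f' x u) has_derivative A) (at y)" and "0 < \<epsilon>"
  shows "\<exists>d>0. \<forall>h. 0 < h \<and> h < d \<longrightarrow>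
    \<bar>f (y + h *\<^sub>R u + h *\<^sub>R v) - f (y + h *\<^sub>R u) - f (y + h *\<^sub>R v) + f y - h\<^sup>2 * A v\<bar> \<le> \<epsilon> * h\<^sup>2"
proof -
  \<comment> \<open>For s and t in [0,h] the displacement
    \<open>s *\<^sub>R u + t *\<^sub>R v\<close> has norm at most \<open>h * M\<close>; the summand
    1 keeps \<open>M\<close> positive when both directions vanish.\<close>
  define M where "M = norm u + norm v + 1"
  have M: "0 < M" "norm u \<le> M" "norm u + norm v \<le> M"
    by (auto simp: M_def add_nonneg_pos)
  obtain r where r: "0 < r" "ball y r \<subseteq> S"
    using S by (meson openE)
  have "0 < \<epsilon> / (2 * M)"
    using \<open>0 < \<epsilon>\<close> M by simp
  then obtain d0 where d0: "0 < d0"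
      "\<And>x. norm (x - y) < d0 \<Longrightarrow> norm (f' x u - f' y u - A (x - y)) \<le> \<epsilon> / (2 * M) * norm (x - y)"
    using A unfolding has_derivative_at_alt by meson
  have linA: "linear A"
    using A by (rule has_derivative_linear)
  show ?thesis
  proof (intro exI[of _ "min d0 r / M"] conjI allI impI)
    fix h assume h: "0 < h \<and> h < min d0 r / M"
    then have hM: "h * M < d0" "h * M < r"
      using M by (auto simp: field_simps)
    have near: "norm (s *\<^sub>R u + t *\<^sub>R v) \<le> h * M" if "0 \<le> s" "s \<le> h" "0 \<le> t" "t \<le> h" for s t
    proof -
      have "norm (s *\<^sub>R u + t *\<^sub>R v) \<le> s * norm u + t * norm v"
        using norm_triangle_ineq[of "s *\<^sub>R u" "t *\<^sub>R v"] that by simp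
      also have "\<dots> \<le> h * norm u + h * norm v"
        using that by (intro add_mono mult_right_mono) auto
      also have "\<dots> \<le> h * M"
        using M h by (simp add: distrib_left[symmetric])
      finally show ?thesis .
    qed
    have inS: "y + s *\<^sub>R u + t *\<^sub>R v \<in> S" if "0 \<le> s" "s \<le> h" "0 \<le> t" "t \<le> h" for s t
    proof (rule subsetD[OF r(2)])
      have "dist (y + (s *\<^sub>R u + t *\<^sub>R v)) y < r"
        using near[OF that] hM by (simp only: dist_norm add_diff_cancel_left')
      then show "y + s *\<^sub>R u + t *\<^sub>R v \<in> ball y r"
        by (simp add: dist_commute add.assoc)
    qed
    have est: "\<bar>f' (y + s *\<^sub>R u + t *\<^sub>R v) u - f' y u - A (s *\<^sub>R u + t *\<^sub>R v)\<bar> \<le> \<epsilon> * h / 2"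
      if "0 \<le> s" "s \<le> h" "0 \<le> t" "t \<le> h" for s t
    proof -
      have "\<bar>f' (y + s *\<^sub>R u + t *\<^sub>R v) u - f' y u - A (s *\<^sub>R u + t *\<^sub>R v)\<bar>
          \<le> \<epsilon> / (2 * M) * norm (s *\<^sub>R u + t *\<^sub>R v)"
        using d0(2)[of "y + s *\<^sub>R u + t *\<^sub>R v"] near[OF that] hM by (simp add: add.assoc)
      also have "\<dots> \<le> \<epsilon> / (2 * M) * (h * M)"
        using near[OF that] \<open>0 < \<epsilon>\<close> M by (intro mult_left_mono) auto
      also have "\<dots> = \<epsilon> * h / 2"
        using M by simp
      finally show ?thesis .
    qed
    define g where "g s = f (y + s *\<^sub>R u + h *\<^sub>R v) - f (y + s *\<^sub>R u)" for s
    have dg: "(g has_real_derivative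
        (f' (y + s *\<^sub>R u + h *\<^sub>R v) u - f' (y + s *\<^sub>R u) u)) (at s)"
      if "0 \<le> s" "s \<le> h" for s
    proof -
      have 1: "((\<lambda>s. f (y + s *\<^sub>R u + t *\<^sub>R v)) has_derivative
          (\<lambda>k. f' (y + s *\<^sub>R u + t *\<^sub>R v) (k *\<^sub>R u))) (at s)" if "0 \<le> t" "t \<le> h" for t
        by (rule has_derivative_compose[of "\<lambda>s. y + s *\<^sub>R u + t *\<^sub>R v" "\<lambda>k. k *\<^sub>R u"])
           (auto intro!: derivative_eq_intros f inS that \<open>0 \<le> s\<close> \<open>s \<le> h\<close>)
      have 2: "f' (y + s *\<^sub>R u + t *\<^sub>R v) (k *\<^sub>R u) = k * f' (y + s *\<^sub>R u + t *\<^sub>R v) u"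
        if "0 \<le> t" "t \<le> h" for t k
        using has_derivative_linear[OF f[OF inS[OF \<open>0 \<le> s\<close> \<open>s \<le> h\<close> that]]] by (simp add: linear_cmul)
      have "(g has_derivative (\<lambda>k. f' (y + s *\<^sub>R u + h *\<^sub>R v) (k *\<^sub>R u)
          - f' (y + s *\<^sub>R u + 0 *\<^sub>R v) (k *\<^sub>R u))) (at s)"
        unfolding g_def using has_derivative_diff[OF 1[of h] 1[of 0]] h by simp
      then show ?thesis
        unfolding has_field_derivative_def
        by (rule has_derivative_eq_rhs) (use h 2[of h] 2[of 0] in \<open>auto simp: fun_eq_iff algebra_simps\<close>)
    qed
    obtain \<theta> where \<theta>: "0 < \<theta>" "\<theta> < h"
        "g h - g 0 = (h - 0) * (f' (y + \<theta> *\<^sub>R u + h *\<^sub>R v) u - f' (y + \<theta> *\<^sub>R u) u)"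
      using MVT2[of 0 h g "\<lambda>s. f' (y + s *\<^sub>R u + h *\<^sub>R v) u - f' (y + s *\<^sub>R u) u"] dg h by auto
    have "A (\<theta> *\<^sub>R u + h *\<^sub>R v) - A (\<theta> *\<^sub>R u) = h * A v"
      using linA by (simp add: linear_add linear_cmul)
    then have "\<bar>(f' (y + \<theta> *\<^sub>R u + h *\<^sub>R v) u - f' (y + \<theta> *\<^sub>R u) u) - h * A v\<bar> \<le> \<epsilon> * h"
      using est[of \<theta> h] est[of \<theta> 0] \<theta>(1,2) h by (simp add: abs_if split: if_splits; linarith)
    then have "h * \<bar>(f' (y + \<theta> *\<^sub>R u + h *\<^sub>R v) u - f' (y + \<theta> *\<^sub>R u) u) - h * A v\<bar> \<le> h * (\<epsilon> * h)"
      using h by (intro mult_left_mono) auto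
    then have "\<bar>h * ((f' (y + \<theta> *\<^sub>R u + h *\<^sub>R v) u - f' (y + \<theta> *\<^sub>R u) u) - h * A v)\<bar> \<le> h * (\<epsilon> * h)"
      using h by (simp add: abs_mult)
    then have "\<bar>g h - g 0 - h\<^sup>2 * A v\<bar> \<le> \<epsilon> * h\<^sup>2"
      using \<theta> by (simp add: power2_eq_square algebra_simps)
    then show "\<bar>f (y + h *\<^sub>R u + h *\<^sub>R v) - f (y + h *\<^sub>R u) - f (y + h *\<^sub>R v) + f y - h\<^sup>2 * A v\<bar>
        \<le> \<epsilon> * h\<^sup>2"
      by (simp add: g_def algebra_simps)
  qed (use d0 r M in auto)
qed

text \<open>The second difference is symmetric in \<open>u\<close> and \<open>v\<close>, while its
  quotient by h^2 tends to \<open>A v\<close> in one order of the directions and to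
  \<open>B u\<close> in the other.\<close>

lemma mixed_partials_symmetric:
  fixes f :: "'b::real_normed_vector \<Rightarrow> real"
  assumes S: "open S" "y \<in> S" and f: "\<And>x. x \<in> S \<Longrightarrow> (f has_derivative f' x) (at x)"
    and A: "((\<lambda>x. f' x u) has_derivative A) (at y)" and B: "((\<lambda>x. f' x v) has_derivative B) (at y)"
  shows "A v = B u"
proof (rule ccontr)
  assume "A v \<noteq> B u"
  \<comment> \<open>The two approximations leave a gap of at most twice \<open>\<epsilon>\<close>,
    which a third of the supposed gap contradicts.\<close>
  define \<epsilon> where "\<epsilon> = \<bar>A v - B u\<bar> / 3"
  have "0 < \<epsilon>"
    using \<open>A v \<noteq> B u\<close> by (simp add: \<epsilon>_def)
  obtain d1 where d1: "0 < d1" "\<And>h. 0 < h \<Longrightarrow> h < d1 \<Longrightarrow>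
      \<bar>f (y + h *\<^sub>R u + h *\<^sub>R v) - f (y + h *\<^sub>R u) - f (y + h *\<^sub>R v) + f y - h\<^sup>2 * A v\<bar> \<le> \<epsilon> * h\<^sup>2"
    using second_difference_quotient[OF S f A \<open>0 < \<epsilon>\<close>] by metis
  obtain d2 where d2: "0 < d2" "\<And>h. 0 < h \<Longrightarrow> h < d2 \<Longrightarrow>
      \<bar>f (y + h *\<^sub>R v + h *\<^sub>R u) - f (y + h *\<^sub>R v) - f (y + h *\<^sub>R u) + f y - h\<^sup>2 * B u\<bar> \<le> \<epsilon> * h\<^sup>2"
    using second_difference_quotient[OF S f B \<open>0 < \<epsilon>\<close>] by metis
  define h where "h = min d1 d2 / 2"
  have h: "0 < h" "h < d1" "h < d2"
    using d1(1) d2(1) by (auto simp: h_def min_def)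
  have eq: "y + h *\<^sub>R v + h *\<^sub>R u = y + h *\<^sub>R u + h *\<^sub>R v"
    by simp
  have "\<bar>h\<^sup>2 * A v - h\<^sup>2 * B u\<bar> \<le> 2 * (\<epsilon> * h\<^sup>2)"
    using d1(2)[OF h(1,2)] d2(2)[OF h(1,3)] unfolding eq by (simp add: abs_le_iff)
  moreover have "\<bar>h\<^sup>2 * A v - h\<^sup>2 * B u\<bar> = h\<^sup>2 * \<bar>A v - B u\<bar>"
    by (simp add: abs_mult flip: right_diff_distrib)
  ultimately have "h\<^sup>2 * \<bar>A v - B u\<bar> \<le> h\<^sup>2 * (2 * \<epsilon>)"
    by (simp only: mult_ac)
  then have "\<bar>A v - B u\<bar> \<le> 2 * \<epsilon>"
    using h by (simp only: mult_le_cancel_left_pos zero_less_power)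
  then show False
    using \<open>0 < \<epsilon>\<close> by (simp add: \<epsilon>_def)
qed

section \<open>Gradients and test functions\<close>

lemma gradient_eqI:
  assumes "GDERIV f x :> g" shows "gradient f x = g"
  unfolding gradient_def
proof (rule the_equality, rule assms)
  fix h assume "GDERIV f x :> h"
  then have "(\<lambda>k. k \<bullet> h) = (\<lambda>k. k \<bullet> g)"
    using assms has_derivative_unique unfolding gderiv_def by blast
  then have "(h - g) \<bullet> h = (h - g) \<bullet> g"
    by meson
  then have "(h - g) \<bullet> (h - g) = 0"
    by (simp add: inner_diff_right)
  then show "h = g"
    by simp
qed

lemma has_derivative_imp_gderiv:
  fixes f :: "'a::euclidean_space \<Rightarrow> real"
  assumes "(f has_derivative D) (at x)"
  shows "GDERIV f x :> (\<Sum>b\<in>Basis. D b *\<^sub>R b)"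
proof -
  have "D h = h \<bullet> (\<Sum>b\<in>Basis. D b *\<^sub>R b)" for h
  proof -
    have "D h = D (\<Sum>b\<in>Basis. (h \<bullet> b) *\<^sub>R b)"
      by (simp add: euclidean_representation)
    also have "\<dots> = (\<Sum>b\<in>Basis. (h \<bullet> b) * D b)"
      using has_derivative_linear[OF assms] by (simp add: linear_sum linear_cmul)
    finally show ?thesis
      by (simp add: inner_sum_right mult.commute)
  qed
  then have "D = (\<lambda>h. h \<bullet> (\<Sum>b\<in>Basis. D b *\<^sub>R b))"
    by (rule ext)
  with assms show ?thesis
    unfolding gderiv_def by (rule has_derivative_eq_rhs)
qed

context
  fixes \<Psi> :: "real \<times> 'a::euclidean_space \<Rightarrow> real" and D and t x
  assumes D: "(\<Psi> has_derivative D) (at (t, x))"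
begin

lemma has_derivative_space_slice: "((\<lambda>y. \<Psi> (t, y)) has_derivative (\<lambda>h. D (0, h))) (at x)"
  by (rule has_derivative_compose[of "\<lambda>y. (t, y)", OF _ D]) (auto intro!: derivative_eq_intros)

lemma gradient_space_slice: "gradient (\<lambda>y. \<Psi> (t, y)) x = (\<Sum>b\<in>Basis. D (0, b) *\<^sub>R b)"
  by (rule gradient_eqI[OF has_derivative_imp_gderiv[OF has_derivative_space_slice]])

lemma derivative_eq_time_gradient:
  "D (s, w) = s * D (1, 0) + gradient (\<lambda>y. \<Psi> (t, y)) x \<bullet> w"
proof -
  have "(\<lambda>h. D (0, h)) = (\<lambda>h. h \<bullet> gradient (\<lambda>y. \<Psi> (t, y)) x)"
    using has_derivative_imp_gderiv[OF has_derivative_space_slice] has_derivative_space_slice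
    unfolding gderiv_def gradient_space_slice by (rule has_derivative_unique[rotated])
  then have "D (0, w) = w \<bullet> gradient (\<lambda>y. \<Psi> (t, y)) x"
    by meson
  moreover have "D (s, w) = D (s *\<^sub>R (1, 0) + (0, w))"
    by simp
  then have "D (s, w) = s * D (1, 0) + D (0, w)"
    using has_derivative_linear[OF D] by (simp add: linear_add linear_cmul del: scaleR_Pair add_Pair)
  ultimately show ?thesis
    by (simp add: inner_commute)
qed

lemma deriv_time_slice: "deriv (\<lambda>s. \<Psi> (s, x)) t = D (1, 0)"
proof (rule DERIV_imp_deriv)
  have "((\<lambda>s. \<Psi> (s, x)) has_derivative (\<lambda>h. D (h, 0))) (at t)"
    by (rule has_derivative_compose[of "\<lambda>s. (s, x)", OF _ D]) (auto intro!: derivative_eq_intros)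
  moreover have "D (h, 0) = D (1, 0) * h" for h
    using derivative_eq_time_gradient[of h 0] by simp
  then have "(\<lambda>h. D (h, 0)) = (*) (D (1, 0))"
    by (rule ext)
  ultimately show "((\<lambda>s. \<Psi> (s, x)) has_field_derivative D (1, 0)) (at t)"
    unfolding has_field_derivative_def by (rule has_derivative_eq_rhs)
qed

end

section \<open>Partials of test functions\<close>

context
  fixes \<phi> :: "real \<times> 'a::euclidean_space \<Rightarrow> real"
  assumes \<phi>: "\<phi> \<in> test_functions"
begin

lemma test_function_has_derivative:
  "(\<phi> has_derivative frechet_derivative \<phi> (at y)) (at y)"
proof -
  have "Ck_on (Suc 0) UNIV \<phi>"
    using \<phi> unfolding test_functions_def by blast
  then show ?thesis
    unfolding Ck_on.simps frechet_derivative_works[symmetric] by blast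
qed

lemma test_function_partial_continuous:
  assumes "b \<in> Basis"
  shows "continuous_on UNIV (\<lambda>y. frechet_derivative \<phi> (at y) b)"
proof -
  have "Ck_on (Suc 0) UNIV \<phi>"
    using \<phi> unfolding test_functions_def by blast
  then show ?thesis
    using assms by simp
qed

text \<open>Off its support \<open>\<phi>\<close> is locally zero, hence so is the derivative; on
  the compact support the continuous partial is bounded.\<close>

lemma test_function_partial_bounded:
  assumes "b \<in> Basis"
  shows "\<exists>C. \<forall>y. \<bar>frechet_derivative \<phi> (at y) b\<bar> \<le> C"
proof -
  let ?K = "closure {y. \<phi> y \<noteq> 0}" and ?g = "\<lambda>y. frechet_derivative \<phi> (at y) b"
  have K: "compact ?K"
    using \<phi> by (simp add: test_functions_def)
  have "compact (?g ` ?K)"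
    by (intro compact_continuous_image continuous_on_subset[OF test_function_partial_continuous] K assms) auto
  then obtain C where C: "\<forall>x\<in>?g ` ?K. norm x \<le> C"
    using compact_imp_bounded bounded_iff by metis
  have "?g y = 0" if "y \<notin> ?K" for y
  proof -
    have "((\<lambda>y. 0) has_derivative (\<lambda>h. 0)) (at y)"
      by simp
    then have "(\<phi> has_derivative (\<lambda>h. 0)) (at y)"
      by (rule has_derivative_transform_within_open[of _ _ _ UNIV "- ?K"])
         (use that closure_subset[of "{y. \<phi> y \<noteq> 0}"] in auto)
    then show ?thesis
      using frechet_derivative_at by metis
  qed
  then have "\<bar>?g y\<bar> \<le> max C 0" for y
    using C by (cases "y \<in> ?K") (auto simp: max_def)
  then show ?thesis
    by blast
qed

lemma test_function_time_bounds: "\<phi> (0, x) = 0" "\<phi> (1, x) = 0"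
proof -
  have "closure {y. \<phi> y \<noteq> 0} \<subseteq> {0<..<1} \<times> UNIV"
    using \<phi> by (simp add: test_functions_def)
  then have "{y. \<phi> y \<noteq> 0} \<subseteq> {0<..<1} \<times> UNIV"
    by (rule subset_trans[OF closure_subset])
  then have "(0, x) \<notin> {y. \<phi> y \<noteq> 0}" "(1, x) \<notin> {y. \<phi> y \<noteq> 0}"
    by auto
  then show "\<phi> (0, x) = 0" "\<phi> (1, x) = 0"
    by simp_all
qed

text \<open>Replaces the slice derivatives in \<open>continuity_equation\<close> by jointly
  continuous functions with a common bound, so that measurability and integrability on the product
  of time and space are immediate.\<close>

lemma test_function_partials:
  obtains A B C where "continuous_on UNIV A" "continuous_on UNIV B"
    "\<And>y. \<bar>A y\<bar> \<le> C" "\<And>y. norm (B y) \<le> C"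
    "\<And>t x. deriv (\<lambda>s. \<phi> (s, x)) t = A (t, x)" "\<And>t x. gradient (\<lambda>y. \<phi> (t, y)) x = B (t, x)"
    "\<And>y. (\<phi> has_derivative (\<lambda>h. fst h * A y + B y \<bullet> snd h)) (at y)"
proof -
  let ?D = "\<lambda>y. frechet_derivative \<phi> (at y)"
  define A where "A y = ?D y (1, 0)" for y
  define B where "B y = (\<Sum>b\<in>Basis. ?D y (0, b) *\<^sub>R b)" for y
  have bas: "(1, 0) \<in> (Basis :: (real \<times> 'a) set)" "b \<in> Basis \<Longrightarrow> (0, b) \<in> (Basis :: (real \<times> 'a) set)"
    for b :: 'a
    by (auto simp: Basis_prod_def)
  obtain C1 where C1: "\<And>y. \<bar>A y\<bar> \<le> C1"
    using test_function_partial_bounded[OF bas(1)] unfolding A_def by blast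
  have "\<forall>b. \<exists>C. b \<in> Basis \<longrightarrow> (\<forall>y. \<bar>?D y (0, b)\<bar> \<le> C)"
    using test_function_partial_bounded[OF bas(2)] by blast
  then obtain C where C: "\<And>b y. b \<in> Basis \<Longrightarrow> \<bar>?D y (0, b)\<bar> \<le> C b"
    by metis
  have "norm (B y) \<le> (\<Sum>b\<in>Basis. C b)" for y
    unfolding B_def by (rule sum_norm_le) (simp add: C)
  moreover have "continuous_on UNIV A" "continuous_on UNIV B"
    unfolding A_def B_def by (intro continuous_intros test_function_partial_continuous bas; assumption)+
  moreover have "gradient (\<lambda>y. \<phi> (t, y)) x = B (t, x)" for t x
    unfolding B_def by (rule gradient_space_slice[OF test_function_has_derivative])
  moreover have "deriv (\<lambda>s. \<phi> (s, x)) t = A (t, x)" for t x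
    unfolding A_def by (rule deriv_time_slice[OF test_function_has_derivative])
  moreover have "(\<phi> has_derivative (\<lambda>h. fst h * A y + B y \<bullet> snd h)) (at y)" for y
  proof -
    have "?D y h = fst h * A y + B y \<bullet> snd h" for h
      using derivative_eq_time_gradient[OF test_function_has_derivative, of "fst y" "snd y" "fst h" "snd h"]
        \<open>gradient (\<lambda>z. \<phi> (fst y, z)) (snd y) = B (fst y, snd y)\<close> by (simp add: A_def)
    then have "?D y = (\<lambda>h. fst h * A y + B y \<bullet> snd h)"
      by (rule ext)
    with test_function_has_derivative show ?thesis
      by (rule has_derivative_eq_rhs)
  qed
  ultimately show thesis
    using C1 by (intro that[of A B "max C1 (\<Sum>b\<in>Basis. C b)"]) (auto simp: le_max_iff_disj)
qed

end

section \<open>Conditional velocities\<close>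

text \<open>\<open>h\<close> is the conditional expectation of \<open>f\<close> given
  \<open>S\<close>, written as a function on the target of \<open>S\<close>. It is the Radon-Nikodym
  derivative of the image under \<open>S\<close> of the measure with density \<open>f\<close> by the
  image of \<open>M\<close> itself.\<close>

lemma factor_density_nonneg:
  fixes f :: "'m \<Rightarrow> real"
  assumes M: "finite_measure M" and S [measurable]: "S \<in> M \<rightarrow>\<^sub>M N"
    and f: "integrable M f" "\<And>x. 0 \<le> f x"
  shows "\<exists>h\<in>borel_measurable N. \<forall>g\<in>borel_measurable N.
    (integrable M (\<lambda>x. h (S x) * g (S x)) \<longleftrightarrow> integrable M (\<lambda>x. f x * g (S x))) \<and>
    (\<integral>x. h (S x) * g (S x) \<partial>M) = (\<integral>x. f x * g (S x :: 'n) \<partial>M :: real)"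
proof -
  interpret finite_measure M by fact
  have [measurable]: "f \<in> borel_measurable M"
    using f by auto
  define \<mu> \<nu> where "\<mu> = distr M N S" and "\<nu> = distr (density M f) N S"
  interpret \<mu>: finite_measure \<mu>
    unfolding \<mu>_def by (rule finite_measure_distr) simp
  have sets: "sets \<nu> = sets \<mu>" "sets \<mu> = sets N"
    by (simp_all add: \<mu>_def \<nu>_def)
  have ac: "absolutely_continuous \<mu> \<nu>"
    unfolding absolutely_continuous_def
  proof
    fix A assume "A \<in> null_sets \<mu>"
    then have A [measurable]: "A \<in> sets N" and "S -` A \<inter> space M \<in> null_sets M"
      by (auto simp: \<mu>_def null_sets_distr_iff)
    then have "S -` A \<inter> space M \<in> null_sets (density M f)"
      using absolutely_continuousI_density[of f M] by (auto simp: absolutely_continuous_def)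
    then show "A \<in> null_sets \<nu>"
      by (auto simp: \<nu>_def null_sets_distr_iff)
  qed
  have "emeasure \<nu> (space \<nu>) = (\<integral>\<^sup>+x. ennreal (f x) \<partial>M)"
    by (simp add: \<nu>_def emeasure_distr emeasure_density)
       (auto intro!: nn_integral_cong simp: indicator_def measurable_space[OF S])
  also have "\<dots> < \<infinity>"
    using f by (auto simp: integrable_iff_bounded)
  finally have "finite_measure \<nu>"
    by (intro finite_measureI) simp
  then have fin: "AE y in \<mu>. RN_deriv \<mu> \<nu> y \<noteq> \<infinity>"
    using \<mu>.RN_deriv_finite[OF _ ac sets(1)] finite_measure.axioms(1) by blast
  \<comment> \<open>Up to a null set \<open>enn2real\<close> loses nothing: \<open>\<nu>\<close> is
    finite, hence its density is finite almost everywhere.\<close>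
  define h where "h y = enn2real (RN_deriv \<mu> \<nu> y)" for y
  have h [measurable]: "h \<in> borel_measurable N"
    unfolding h_def \<mu>_def by simp
  have "density \<mu> h = density \<mu> (RN_deriv \<mu> \<nu>)"
    by (rule density_cong) (use fin in \<open>auto simp: h_def \<mu>_def less_top elim!: eventually_mono\<close>)
  also have "\<dots> = \<nu>"
    by (rule \<mu>.density_RN_deriv[OF ac sets(1)])
  finally have \<nu>: "\<nu> = density \<mu> h" by simp
  have "(integrable M (\<lambda>x. h (S x) * g (S x)) \<longleftrightarrow> integrable M (\<lambda>x. f x * g (S x))) \<and>
      (\<integral>x. h (S x) * g (S x) \<partial>M) = (\<integral>x. f x * g (S x) \<partial>M)"
    if [measurable]: "g \<in> borel_measurable N" for g :: "'n \<Rightarrow> real"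
  proof -
    have h0: "0 \<le> h y" for y
      by (simp add: h_def)
    have "integrable \<nu> g \<longleftrightarrow> integrable M (\<lambda>x. f x * g (S x))"
      unfolding \<nu>_def using f(2) by (simp add: integrable_distr_eq integrable_density)
    moreover have "integrable \<nu> g \<longleftrightarrow> integrable M (\<lambda>x. h (S x) * g (S x))"
      unfolding \<nu> \<mu>_def using h0 by (simp add: integrable_distr_eq integrable_density)
    moreover have "integral\<^sup>L \<nu> g = (\<integral>x. f x * g (S x) \<partial>M)"
      unfolding \<nu>_def using f(2) by (simp add: integral_distr integral_density)
    moreover have "integral\<^sup>L \<nu> g = (\<integral>x. h (S x) * g (S x) \<partial>M)"
      unfolding \<nu> \<mu>_def using h0 by (simp add: integral_distr integral_density)
    ultimately show ?thesis by simp
  qed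
  then show ?thesis
    using h by blast
qed

text \<open>Conditional expectation of a vector field, one coordinate at a time, each coordinate
  being split into its positive and negative part.\<close>

lemma factor_density:
  fixes f :: "'m \<Rightarrow> 'a::euclidean_space"
  assumes M: "finite_measure M" and S [measurable]: "S \<in> M \<rightarrow>\<^sub>M (N :: 'n measure)"
    and f: "integrable M f"
  obtains h where "h \<in> borel_measurable N" "integrable M (\<lambda>x. h (S x))"
    "\<And>g C. g \<in> borel_measurable N \<Longrightarrow> (\<And>y. norm (g y) \<le> C) \<Longrightarrow>
      (\<integral>x. g (S x) \<bullet> h (S x) \<partial>M) = (\<integral>x. g (S x) \<bullet> f x \<partial>M)"
proof -
  have ex: "\<exists>h\<in>borel_measurable N. integrable M (\<lambda>x. h (S x)) \<and>
     (\<forall>g\<in>borel_measurable N. (\<exists>C. \<forall>y. \<bar>g y\<bar> \<le> C) \<longrightarrow>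
        integrable M (\<lambda>x. h (S x) * g (S x)) \<and>
        (\<integral>x. h (S x) * g (S x) \<partial>M) = (\<integral>x. f x \<bullet> b * g (S x) \<partial>M))" for b
  proof -
    have fb: "integrable M (\<lambda>x. f x \<bullet> b)"
      using f by (rule integrable_inner_left)
    have p: "integrable M (\<lambda>x. max 0 (f x \<bullet> b))" "integrable M (\<lambda>x. max 0 (- (f x \<bullet> b)))"
      using fb by (auto intro!: Bochner_Integration.integrable_max)
    obtain h1 where h1 [measurable]: "h1 \<in> borel_measurable N" and h1':
      "\<And>g. g\<in>borel_measurable N \<Longrightarrow>
        (integrable M (\<lambda>x. h1 (S x) * g (S x)) \<longleftrightarrow> integrable M (\<lambda>x. max 0 (f x \<bullet> b) * g (S x))) \<and>
        (\<integral>x. h1 (S x) * g (S x) \<partial>M) = (\<integral>x. max 0 (f x \<bullet> b) * g (S x) \<partial>M)"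
      using factor_density_nonneg[OF M S p(1)] by auto
    obtain h2 where h2 [measurable]: "h2 \<in> borel_measurable N" and h2':
      "\<And>g. g\<in>borel_measurable N \<Longrightarrow>
        (integrable M (\<lambda>x. h2 (S x) * g (S x)) \<longleftrightarrow> integrable M (\<lambda>x. max 0 (-(f x \<bullet> b)) * g (S x))) \<and>
        (\<integral>x. h2 (S x) * g (S x) \<partial>M) = (\<integral>x. max 0 (-(f x \<bullet> b)) * g (S x) \<partial>M)"
      using factor_density_nonneg[OF M S p(2)] by auto
    have main: "integrable M (\<lambda>x. (h1 (S x) - h2 (S x)) * g (S x)) \<and>
        (\<integral>x. (h1 (S x) - h2 (S x)) * g (S x) \<partial>M) = (\<integral>x. f x \<bullet> b * g (S x) \<partial>M)"
      if g [measurable]: "g \<in> borel_measurable N" and C: "\<And>y. \<bar>g y\<bar> \<le> C" for g C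
    proof -
      have "integrable M (\<lambda>x. k x * g (S x))" if k: "integrable M k" for k :: "'m \<Rightarrow> real"
      proof (rule Bochner_Integration.integrable_bound[of M "\<lambda>x. C * norm (k x)"])
        have "\<bar>k x\<bar> * \<bar>g (S x)\<bar> \<le> \<bar>k x\<bar> * \<bar>C\<bar>" for x
          using C[of "S x"] by (intro mult_left_mono) auto
        then show "AE x in M. norm (k x * g (S x)) \<le> norm (C * norm (k x))"
          by (auto simp: abs_mult mult.commute[of "\<bar>C\<bar>"])
      qed (use k in auto)
      note i = this[OF p(1)] this[OF p(2)]
      have "(\<integral>x. (h1 (S x) - h2 (S x)) * g (S x) \<partial>M)
          = (\<integral>x. h1 (S x) * g (S x) \<partial>M) - (\<integral>x. h2 (S x) * g (S x) \<partial>M)"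
        using i h1'[OF g] h2'[OF g] by (simp add: left_diff_distrib)
      also have "\<dots> = (\<integral>x. max 0 (f x \<bullet> b) * g (S x) - max 0 (-(f x \<bullet> b)) * g (S x) \<partial>M)"
        using i h1'[OF g] h2'[OF g] by simp
      also have "\<dots> = (\<integral>x. f x \<bullet> b * g (S x) \<partial>M)"
        by (rule Bochner_Integration.integral_cong) (auto simp: max_def)
      finally show ?thesis
        using i h1'[OF g] h2'[OF g] by (simp add: left_diff_distrib)
    qed
    show ?thesis
    proof (intro bexI[of _ "\<lambda>y. h1 y - h2 y"] conjI ballI impI)
      show "integrable M (\<lambda>x. h1 (S x) - h2 (S x))"
        using main[of "\<lambda>_. 1" 1] by simp
      fix g :: "'n \<Rightarrow> real" assume "g \<in> borel_measurable N" "\<exists>C. \<forall>y. \<bar>g y\<bar> \<le> C"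
      then show "integrable M (\<lambda>x. (h1 (S x) - h2 (S x)) * g (S x))"
          "(\<integral>x. (h1 (S x) - h2 (S x)) * g (S x) \<partial>M) = (\<integral>x. f x \<bullet> b * g (S x) \<partial>M)"
        using main by blast+
    qed simp
  qed
  have "\<exists>h. \<forall>b. h b \<in> borel_measurable N \<and> integrable M (\<lambda>x. h b (S x)) \<and>
     (\<forall>g\<in>borel_measurable N. (\<exists>C. \<forall>y. \<bar>g y\<bar> \<le> C) \<longrightarrow>
        integrable M (\<lambda>x. h b (S x) * g (S x)) \<and>
        (\<integral>x. h b (S x) * g (S x) \<partial>M) = (\<integral>x. f x \<bullet> b * g (S x) \<partial>M))"
    by (intro choice allI ex[unfolded Bex_def])
  then obtain h where H: "\<forall>b. h b \<in> borel_measurable N \<and> integrable M (\<lambda>x. h b (S x)) \<and>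
     (\<forall>g\<in>borel_measurable N. (\<exists>C. \<forall>y. \<bar>g y\<bar> \<le> C) \<longrightarrow>
        integrable M (\<lambda>x. h b (S x) * g (S x)) \<and>
        (\<integral>x. h b (S x) * g (S x) \<partial>M) = (\<integral>x. f x \<bullet> b * g (S x) \<partial>M))"
    by (elim exE)
  have h [measurable]: "h b \<in> borel_measurable N" for b
    using H by (elim allE[of _ b] conjE)
  have hi: "integrable M (\<lambda>x. h b (S x))" for b
    using H by (elim allE[of _ b] conjE)
  note h' = H[THEN spec, THEN conjunct2, THEN conjunct2]
  show thesis
  proof (rule that[of "\<lambda>y. \<Sum>b\<in>Basis. h b y *\<^sub>R b"])
    fix g :: "_ \<Rightarrow> 'a" and C assume g [measurable]: "g \<in> borel_measurable N" and C: "\<And>y. norm (g y) \<le> C"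
    have b: "integrable M (\<lambda>x. h b (S x) * (g (S x) \<bullet> b)) \<and>
        (\<integral>x. h b (S x) * (g (S x) \<bullet> b) \<partial>M) = (\<integral>x. f x \<bullet> b * (g (S x) \<bullet> b) \<partial>M)" if "b \<in> Basis" for b
    proof -
      have "\<bar>g y \<bullet> b\<bar> \<le> C" for y
        using Basis_le_norm[OF that, of "g y"] C[of y] by linarith
      then show ?thesis
        by (intro h'[of b, THEN bspec[of _ _ "\<lambda>y. g y \<bullet> b"], THEN mp]) auto
    qed
    have fi: "integrable M (\<lambda>x. f x \<bullet> b * (g (S x) \<bullet> b))" if "b \<in> Basis" for b
    proof (rule Bochner_Integration.integrable_bound[of M "\<lambda>x. C * norm (f x)"])
      have "\<bar>f x \<bullet> b\<bar> * \<bar>g (S x) \<bullet> b\<bar> \<le> norm (f x) * C" for x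
        using Basis_le_norm[OF that, of "g (S x)"] C[of "S x"] Basis_le_norm[OF that, of "f x"]
        by (intro mult_mono) auto
      then show "AE x in M. norm (f x \<bullet> b * (g (S x) \<bullet> b)) \<le> norm (C * norm (f x))"
        by (auto intro!: AE_I2 simp: abs_mult mult.commute[of C])
           (meson abs_ge_self mult_left_mono norm_ge_zero order_trans)
    qed (use f in auto)
    have "(\<integral>x. g (S x) \<bullet> (\<Sum>b\<in>Basis. h b (S x) *\<^sub>R b) \<partial>M)
        = (\<integral>x. (\<Sum>b\<in>Basis. h b (S x) * (g (S x) \<bullet> b)) \<partial>M)"
      by (simp add: inner_sum_right)
    also have "\<dots> = (\<Sum>b\<in>Basis. \<integral>x. h b (S x) * (g (S x) \<bullet> b) \<partial>M)"
      using b by (intro Bochner_Integration.integral_sum) auto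
    also have "\<dots> = (\<Sum>b\<in>Basis. \<integral>x. f x \<bullet> b * (g (S x) \<bullet> b) \<partial>M)"
      using b by (intro sum.cong) auto
    also have "\<dots> = (\<integral>x. (\<Sum>b\<in>Basis. f x \<bullet> b * (g (S x) \<bullet> b)) \<partial>M)"
      using fi by (intro Bochner_Integration.integral_sum[symmetric]) auto
    also have "\<dots> = (\<integral>x. g (S x) \<bullet> f x \<partial>M)"
      by (simp add: euclidean_inner[of "g _" "f _"] mult.commute)
    finally show "(\<integral>x. g (S x) \<bullet> (\<Sum>b\<in>Basis. h b (S x) *\<^sub>R b) \<partial>M) = (\<integral>x. g (S x) \<bullet> f x \<partial>M)" .
  qed (use hi in auto)
qed

text \<open>Testing against \<open>pow_dir p (h y)\<close>, truncated where \<open>\<parallel>h\<parallel> > n\<close>, and applying Young's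
  inequality.\<close>

lemma factor_density_powr_le:
  fixes f :: "'m \<Rightarrow> 'a::euclidean_space"
  assumes M: "finite_measure M" and S [measurable]: "S \<in> M \<rightarrow>\<^sub>M N"
    and f [measurable]: "f \<in> borel_measurable M"
    and h [measurable]: "h \<in> borel_measurable N"
    and eq: "\<And>g C. g \<in> borel_measurable N \<Longrightarrow> (\<And>y. norm (g y) \<le> C) \<Longrightarrow>
      (\<integral>x. g (S x) \<bullet> h (S x) \<partial>M) = (\<integral>x. g (S x) \<bullet> f x \<partial>M)"
    and p: "1 < p"
  shows "(\<integral>\<^sup>+x. ennreal (norm (h (S x)) powr p) \<partial>M) \<le> (\<integral>\<^sup>+x. ennreal (norm (f x) powr p) \<partial>M)"
proof (cases "(\<integral>\<^sup>+x. ennreal (norm (f x) powr p) \<partial>M) = \<infinity>")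
  case False
  interpret finite_measure M by fact
  define q where "q = p / (p - 1)"
  note c = conjugate_exponent[OF p q_def]
  have fi: "integrable M (\<lambda>x. norm (f x) powr p)"
    using False by (intro integrableI_nonneg) (auto simp: less_top)
  define A where "A n = {y \<in> space N. norm (h y) \<le> real n}" for n
  have [measurable]: "A n \<in> sets N" for n
    unfolding A_def by measurable
  have pd [measurable]: "pow_dir r \<in> borel_measurable borel" for r
    unfolding pow_dir_def by measurable
  let ?g = "\<lambda>n y. indicat_real (A n) y *\<^sub>R pow_dir p (h y)"
  have bound: "(\<integral>\<^sup>+x. ennreal (indicat_real (A n) (S x) * norm (h (S x)) powr p) \<partial>M)
      \<le> (\<integral>\<^sup>+x. ennreal (norm (f x) powr p) \<partial>M)" for n
  proof -
    have "norm (?g n y) \<le> real n powr (p - 1)" for y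
      using p by (auto simp: A_def indicator_def norm_pow_dir intro!: powr_mono2)
    then have e: "(\<integral>x. ?g n (S x) \<bullet> h (S x) \<partial>M) = (\<integral>x. ?g n (S x) \<bullet> f x \<partial>M)"
      by (intro eq) auto
    have i: "integrable M (\<lambda>x. indicat_real (A n) (S x) * norm (h (S x)) powr p)"
      using p by (intro integrable_const_bound[of _ "real n powr p"])
        (auto simp: A_def indicator_def intro!: powr_mono2)
    have gh: "?g n y \<bullet> h y = indicat_real (A n) y * norm (h y) powr p" for y
      using inner_pow_dir[of "h y" p] by (simp add: inner_commute)
    have gq: "norm (?g n y) powr q = indicat_real (A n) y * norm (h y) powr p" for y
      using c by (auto simp: indicator_def norm_pow_dir powr_powr)
    have "(\<integral>x. indicat_real (A n) (S x) * norm (h (S x)) powr p \<partial>M) = (\<integral>x. ?g n (S x) \<bullet> f x \<partial>M)"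
      using e unfolding gh .
    \<comment> \<open>By \<open>gq\<close> the second Young term is 1/q times the left-hand side
      again. The truncation makes that finite, so it can be absorbed, and the factor 1 - 1/q = 1/p
      remains.\<close>
    also have "\<dots> \<le> (\<integral>x. norm (f x) powr p / p + norm (?g n (S x)) powr q / q \<partial>M)"
    proof (rule integral_mono_AE')
      show "integrable M (\<lambda>x. norm (f x) powr p / p + norm (?g n (S x)) powr q / q)"
        unfolding gq using i fi by auto
      show "AE x in M. ?g n (S x) \<bullet> f x \<le> norm (f x) powr p / p + norm (?g n (S x)) powr q / q"
        by (intro AE_I2 Young_inner[OF p q_def])
      show "AE x in M. 0 \<le> norm (f x) powr p / p + norm (?g n (S x)) powr q / q"
        using p c(1) by (intro AE_I2) auto
    qed
    also have "\<dots> = (\<integral>x. norm (f x) powr p \<partial>M) / p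
        + (\<integral>x. indicat_real (A n) (S x) * norm (h (S x)) powr p \<partial>M) / q"
      unfolding gq using i fi by simp
    finally have "(\<integral>x. indicat_real (A n) (S x) * norm (h (S x)) powr p \<partial>M) * (1 - 1 / q)
        \<le> (\<integral>x. norm (f x) powr p \<partial>M) * (1 / p)"
      by (simp add: algebra_simps)
    moreover have "1 - 1 / q = 1 / p"
      using c(3) by simp
    ultimately have "(\<integral>x. indicat_real (A n) (S x) * norm (h (S x)) powr p \<partial>M)
        \<le> (\<integral>x. norm (f x) powr p \<partial>M)"
      using p by (simp add: divide_le_cancel)
    then show ?thesis
      using i fi by (simp add: nn_integral_eq_integral ennreal_leI)
  qed
  have lim: "(\<lambda>n. ennreal (indicat_real (A n) (S x) * norm (h (S x)) powr p))
      \<longlonglongrightarrow> ennreal (norm (h (S x)) powr p)" if "x \<in> space M" for x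
  proof (rule tendsto_eventually)
    have "\<forall>\<^sub>F n in sequentially. norm (h (S x)) \<le> real n"
      using filterlim_real_sequentially by (simp add: filterlim_at_top)
    then show "\<forall>\<^sub>F n in sequentially. ennreal (indicat_real (A n) (S x) * norm (h (S x)) powr p)
        = ennreal (norm (h (S x)) powr p)"
      by eventually_elim (use measurable_space[OF S that] in \<open>simp add: A_def\<close>)
  qed
  have "(\<integral>\<^sup>+x. ennreal (norm (h (S x)) powr p) \<partial>M)
      = (\<integral>\<^sup>+x. liminf (\<lambda>n. ennreal (indicat_real (A n) (S x) * norm (h (S x)) powr p)) \<partial>M)"
    by (intro nn_integral_cong lim_imp_Liminf[OF _ lim, symmetric]) simp_all
  also have "\<dots> \<le> liminf (\<lambda>n. \<integral>\<^sup>+x. ennreal (indicat_real (A n) (S x) * norm (h (S x)) powr p) \<partial>M)"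
    by (rule nn_integral_liminf) simp
  also have "\<dots> \<le> (\<integral>\<^sup>+x. ennreal (norm (f x) powr p) \<partial>M)"
    using bound by (intro Liminf_le) (auto intro!: always_eventually)
  finally show ?thesis .
qed simp

section \<open>A Benamou--Brenier competitor\<close>

lemma prob_space_unit_time: "prob_space unit_time"
  by (rule prob_space_restrict_space) auto

lemma measurable_unit_time [measurable]: "(\<lambda>t. t) \<in> unit_time \<rightarrow>\<^sub>M borel"
  by (rule measurable_restrict_space1) simp

lemma unit_time_eq_interval_integral:
  fixes f :: "real \<Rightarrow> 'b::{banach, second_countable_topology}"
  assumes f: "(\<lambda>t. indicator {0..1} t *\<^sub>R f t) \<in> borel_measurable lborel"
  shows "(\<integral>t. f t \<partial>unit_time) = (\<integral>t. indicator {0..1} t *\<^sub>R f t \<partial>lborel)"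
proof -
  have "AE t in lborel. t \<noteq> 0 \<and> t \<noteq> (1::real)"
    by (intro AE_conjI AE_lborel_singleton)
  then have *: "AE t in lborel. indicator {0<..<1} t *\<^sub>R f t = indicator {0..1} t *\<^sub>R f t"
    by eventually_elim (auto simp: indicator_def)
  have "(\<lambda>t. indicator {0<..<1} t *\<^sub>R indicator {0..1} t *\<^sub>R f t) \<in> borel_measurable lborel"
    using f by measurable
  also have "(\<lambda>t. indicator {0<..<1} t *\<^sub>R indicator {0..1} t *\<^sub>R f t)
      = (\<lambda>t. indicator {0<..<1} t *\<^sub>R f t)"
    by (auto simp: indicator_def)
  finally show ?thesis
    using f * by (simp add: integral_restrict_space) (rule integral_cong_AE, auto)
qed

lemma integrable_of_powr:
  fixes f :: "'m \<Rightarrow> 'b::{banach, second_countable_topology}"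
  assumes M: "finite_measure M" and [measurable]: "f \<in> borel_measurable M" and p: "1 \<le> p"
    and fin: "(\<integral>\<^sup>+x. ennreal (norm (f x) powr p) \<partial>M) < \<infinity>"
  shows "integrable M f" "integrable M (\<lambda>x. norm (f x) powr p)"
proof -
  interpret finite_measure M by fact
  show i: "integrable M (\<lambda>x. norm (f x) powr p)"
    using fin by (intro integrableI_nonneg) auto
  show "integrable M f"
  proof (rule Bochner_Integration.integrable_bound)
    show "integrable M (\<lambda>x. 1 + norm (f x) powr p)"
      using i by simp
    have "n \<le> 1 + n powr p" if "0 \<le> n" for n :: real
    proof (cases "n \<le> 1")
      case False
      then have "n powr 1 \<le> n powr p"
        using p by (intro powr_mono) auto
      then show ?thesis using False by simp
    qed (simp add: add_increasing2)
    then show "AE x in M. norm (f x) \<le> norm (1 + norm (f x) powr p)"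
      by (auto intro!: AE_I2 simp: abs_of_nonneg add_nonneg_nonneg)
  qed simp
qed

lemma norm_diff_powr_le:
  assumes "0 \<le> p"
  shows "norm (a - b) powr p \<le> 2 powr p * (norm a powr p + norm b powr p)"
proof -
  have "norm (a - b) powr p \<le> (2 * max (norm a) (norm b)) powr p"
    using norm_triangle_ineq4[of a b] assms by (intro powr_mono2) auto
  also have "\<dots> = 2 powr p * max (norm a) (norm b) powr p"
    by (simp add: powr_mult)
  also have "\<dots> \<le> 2 powr p * (norm a powr p + norm b powr p)"
    by (intro mult_left_mono) (auto simp: max_def)
  finally show ?thesis .
qed

lemma sets_prob_finite_moment: "\<mu> \<in> prob_finite_moment p \<Longrightarrow> sets \<mu> = sets borel"
  by (simp add: prob_finite_moment_def borel_prob_def)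

text \<open>Stated over an arbitrary space carrying both marginals, so that it serves transport maps
  and couplings alike.\<close>

lemma displacement_finite:
  fixes \<mu>\<^sub>0 \<mu>\<^sub>1 :: "'a::euclidean_space measure"
  assumes "0 \<le> p" "\<mu>\<^sub>0 \<in> prob_finite_moment p" "\<mu>\<^sub>1 \<in> prob_finite_moment p"
    and [measurable]: "f \<in> \<pi> \<rightarrow>\<^sub>M borel" "g \<in> \<pi> \<rightarrow>\<^sub>M borel"
    and "distr \<pi> borel f = \<mu>\<^sub>0" "distr \<pi> borel g = \<mu>\<^sub>1"
  shows "(\<integral>\<^sup>+z. ennreal (norm (g z - f z) powr p) \<partial>\<pi>) < \<infinity>"
proof -
  have m: "(\<integral>\<^sup>+z. ennreal (norm (f z) powr p) \<partial>\<pi>) < \<infinity>" "(\<integral>\<^sup>+z. ennreal (norm (g z) powr p) \<partial>\<pi>) < \<infinity>"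
    using assms by (auto simp: prob_finite_moment_def nn_integral_distr)
  have "(\<integral>\<^sup>+z. ennreal (norm (g z - f z) powr p) \<partial>\<pi>)
      \<le> (\<integral>\<^sup>+z. ennreal (2 powr p) * (ennreal (norm (g z) powr p) + ennreal (norm (f z) powr p)) \<partial>\<pi>)"
    using norm_diff_powr_le[OF assms(1)]
    by (intro nn_integral_mono) (simp flip: ennreal_plus ennreal_mult'' add: ennreal_leI)
  also have "\<dots> = ennreal (2 powr p) *
      ((\<integral>\<^sup>+z. ennreal (norm (g z) powr p) \<partial>\<pi>) + (\<integral>\<^sup>+z. ennreal (norm (f z) powr p) \<partial>\<pi>))"
    by (simp add: nn_integral_cmult nn_integral_add)
  also have "\<dots> < \<infinity>"
    using m by (simp add: ennreal_mult_less_top)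
  finally show ?thesis .
qed

text \<open>Displacement interpolation along an arbitrary transport map, which need not be optimal:
  where segments cross, the velocity is the conditional expectation of the displacement.\<close>

lemma displacement_interpolation_admissible:
  fixes \<mu>\<^sub>0 \<mu>\<^sub>1 :: "'a::euclidean_space measure"
  assumes p: "1 < p" and \<mu>0: "\<mu>\<^sub>0 \<in> prob_finite_moment p" and \<mu>1: "\<mu>\<^sub>1 \<in> prob_finite_moment p"
    and F: "F \<in> borel_measurable borel" and push: "distr \<mu>\<^sub>0 borel F = \<mu>\<^sub>1"
  obtains \<rho> v where "bb_admissible \<mu>\<^sub>0 \<mu>\<^sub>1 (\<rho>, v)"
    "bb_cost p (\<rho>, v) \<le> ennreal (1 / p) * (\<integral>\<^sup>+x. ennreal (norm (F x - x) powr p) \<partial>\<mu>\<^sub>0)"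
proof -
  interpret \<mu>0: prob_space \<mu>\<^sub>0
    using \<mu>0 by (simp add: prob_finite_moment_def borel_prob_def)
  interpret T: prob_space unit_time
    by (rule prob_space_unit_time)
  have s0 [simp]: "sets \<mu>\<^sub>0 = sets borel"
    using \<mu>0 by (rule sets_prob_finite_moment)
  have id0 [measurable]: "(\<lambda>x. x) \<in> borel_measurable \<mu>\<^sub>0"
    by (rule measurable_ident_sets) simp
  have F0 [measurable]: "F \<in> borel_measurable \<mu>\<^sub>0"
    using F by (simp only: measurable_cong_sets[OF s0 refl])
  note F [measurable]
  define M where "M = unit_time \<Otimes>\<^sub>M \<mu>\<^sub>0"
  interpret M: prob_space M
    unfolding M_def by (rule prob_space_pair) unfold_locales
  interpret P: pair_sigma_finite unit_time \<mu>\<^sub>0 ..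
  define seg where "seg t x = (1 - t) *\<^sub>R x + t *\<^sub>R F x" for t x
  \<comment> \<open>Position in space-time along the segments; a velocity that factors through
    \<open>S\<close> is a field on space-time, even where segments cross.\<close>
  define S where "S y = (fst y, seg (fst y) (snd y))" for y
  have fst_m [measurable]: "fst \<in> M \<rightarrow>\<^sub>M borel"
    unfolding M_def using measurable_compose[OF measurable_fst measurable_unit_time] by simp
  have snd_m [measurable]: "snd \<in> M \<rightarrow>\<^sub>M borel"
    unfolding M_def by (simp cong: measurable_cong_sets)
  have S [measurable]: "S \<in> M \<rightarrow>\<^sub>M borel"
    unfolding S_def seg_def borel_prod[symmetric] using F by measurable
  have seg_m [measurable]: "seg t \<in> borel_measurable \<mu>\<^sub>0" for t
    unfolding seg_def by measurable
  define w where "w y = F (snd y) - snd y" for y :: "real \<times> 'a"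
  have w_m [measurable]: "w \<in> borel_measurable M"
    unfolding w_def using F by measurable
  have cost: "(\<integral>\<^sup>+y. ennreal (norm (w y) powr p) \<partial>M) = (\<integral>\<^sup>+x. ennreal (norm (F x - x) powr p) \<partial>\<mu>\<^sub>0)"
  proof -
    have "(\<integral>\<^sup>+y. ennreal (norm (w y) powr p) \<partial>M)
        = (\<integral>\<^sup>+t. \<integral>\<^sup>+x. ennreal (norm (w (t, x)) powr p) \<partial>\<mu>\<^sub>0 \<partial>unit_time)"
      unfolding M_def by (rule \<mu>0.nn_integral_fst[symmetric]) (simp flip: M_def)
    moreover have "emeasure unit_time {0<..<1} = 1"
      using T.emeasure_space_1 by (simp add: space_restrict_space)
    ultimately show ?thesis
      by (simp add: w_def space_restrict_space)
  qed
  have fin: "(\<integral>\<^sup>+x. ennreal (norm (F x - x) powr p) \<partial>\<mu>\<^sub>0) < \<infinity>"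
    using p push by (intro displacement_finite[OF _ \<mu>0 \<mu>1])
      (auto simp: distr_id2 intro!: measurable_ident_sets)
  have wi: "integrable M w"
    using p fin cost by (intro integrable_of_powr(1)[OF M.finite_measure_axioms w_m, of p]) auto
  obtain h where h [measurable]: "h \<in> borel_measurable borel" and hi: "integrable M (\<lambda>y. h (S y))"
    and heq: "\<And>g C. g \<in> borel_measurable borel \<Longrightarrow> (\<And>y. norm (g y) \<le> C) \<Longrightarrow>
      (\<integral>y. g (S y) \<bullet> h (S y) \<partial>M) = (\<integral>y. g (S y) \<bullet> w y \<partial>M)"
    by (rule factor_density[OF M.finite_measure_axioms S wi]) blast
  define \<rho> where "\<rho> t = distr \<mu>\<^sub>0 borel (seg t)" for t
  define v where "v t x = h (t, x)" for t x
  have nn: "(\<integral>\<^sup>+t. \<integral>\<^sup>+x. k (t, x) \<partial>\<rho> t \<partial>unit_time) = (\<integral>\<^sup>+y. k (S y) \<partial>M)"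
    if [measurable]: "k \<in> borel_measurable borel" for k :: "real \<times> 'a \<Rightarrow> ennreal"
  proof -
    have "(\<lambda>x. k (t, x)) \<in> borel_measurable borel" for t
      using that by (simp flip: borel_prod)
    then have "(\<integral>\<^sup>+t. \<integral>\<^sup>+x. k (t, x) \<partial>\<rho> t \<partial>unit_time) = (\<integral>\<^sup>+t. \<integral>\<^sup>+x. k (S (t, x)) \<partial>\<mu>\<^sub>0 \<partial>unit_time)"
      by (simp add: \<rho>_def nn_integral_distr S_def)
    also have "\<dots> = (\<integral>\<^sup>+y. k (S y) \<partial>M)"
      unfolding M_def by (rule \<mu>0.nn_integral_fst) (simp flip: M_def)
    finally show ?thesis .
  qed
  have "bb_cost p (\<rho>, v) = ennreal (1 / p) * (\<integral>\<^sup>+y. ennreal (norm (h (S y)) powr p) \<partial>M)"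
    using nn[of "\<lambda>y. ennreal (norm (h y) powr p)"] by (simp add: bb_cost_def v_def)
  also have "\<dots> \<le> ennreal (1 / p) * (\<integral>\<^sup>+y. ennreal (norm (w y) powr p) \<partial>M)"
    by (intro mult_left_mono factor_density_powr_le[OF M.finite_measure_axioms S _ h heq p]) auto
  finally have cost_le: "bb_cost p (\<rho>, v)
      \<le> ennreal (1 / p) * (\<integral>\<^sup>+x. ennreal (norm (F x - x) powr p) \<partial>\<mu>\<^sub>0)"
    unfolding cost .
  have loc: "(\<integral>\<^sup>+t. \<integral>\<^sup>+x. ennreal (norm (v t x)) * indicator K (t, x) \<partial>\<rho> t \<partial>unit_time) < \<infinity>"
    if K: "compact K" for K
  proof -
    have [measurable]: "K \<in> sets borel"
      using K by (simp add: compact_imp_closed)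
    have "(\<integral>\<^sup>+t. \<integral>\<^sup>+x. ennreal (norm (v t x)) * indicator K (t, x) \<partial>\<rho> t \<partial>unit_time)
        = (\<integral>\<^sup>+y. ennreal (norm (h (S y))) * indicator K (S y) \<partial>M)"
      unfolding v_def by (rule nn[of "\<lambda>y. ennreal (norm (h y)) * indicator K y"]) measurable
    also have "\<dots> \<le> (\<integral>\<^sup>+y. ennreal (norm (h (S y))) \<partial>M)"
      by (intro nn_integral_mono) (auto simp: indicator_def)
    also have "\<dots> < \<infinity>"
      using hi by (simp add: integrable_iff_bounded)
    finally show ?thesis .
  qed
  have ce: "(\<integral>t. (\<integral>x. deriv (\<lambda>s. \<phi> (s, x)) t + gradient (\<lambda>y. \<phi> (t, y)) x \<bullet> v t x \<partial>\<rho> t)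
           \<partial>unit_time) = 0" if \<phi>: "\<phi> \<in> test_functions" for \<phi>
  proof -
    obtain A B C where A: "continuous_on UNIV A" and B: "continuous_on UNIV B"
      and C: "\<And>y. \<bar>A y\<bar> \<le> C" "\<And>y. norm (B y) \<le> C"
      and AB: "\<And>t x. deriv (\<lambda>s. \<phi> (s, x)) t = A (t, x)" "\<And>t x. gradient (\<lambda>y. \<phi> (t, y)) x = B (t, x)"
      and D: "\<And>y. (\<phi> has_derivative (\<lambda>h. fst h * A y + B y \<bullet> snd h)) (at y)"
      by (rule test_function_partials[OF \<phi>]) blast
    have [measurable]: "A \<in> borel_measurable borel" "B \<in> borel_measurable borel"
      using A B by (auto intro: borel_measurable_continuous_onI)
    have iA: "integrable M (\<lambda>y. A (S y))"
      using C(1) by (intro M.integrable_const_bound[of _ C]) auto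
    have iB: "integrable M (\<lambda>y. B (S y) \<bullet> k y)" if k: "integrable M k" for k
    proof (rule Bochner_Integration.integrable_bound[of M "\<lambda>y. C * norm (k y)"])
      have "\<bar>B (S y) \<bullet> k y\<bar> \<le> \<bar>C * norm (k y)\<bar>" for y
        using Cauchy_Schwarz_ineq2[of "B (S y)" "k y"] mult_right_mono[OF C(2)[of "S y"], of "norm (k y)"]
        by simp
      then show "AE y in M. norm (B (S y) \<bullet> k y) \<le> norm (C * norm (k y))"
        by simp
    qed (use k in auto)
    have mh: "(\<lambda>x. A (t, x) + B (t, x) \<bullet> h (t, x)) \<in> borel_measurable borel" for t
    proof -
      have "(\<lambda>y. A y + B y \<bullet> h y) \<in> borel_measurable (borel \<Otimes>\<^sub>M borel)"
        unfolding borel_prod by measurable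
      then show ?thesis by measurable
    qed
    have "(\<integral>t. (\<integral>x. A (t, x) + B (t, x) \<bullet> h (t, x) \<partial>\<rho> t) \<partial>unit_time)
        = (\<integral>t. (\<integral>x. A (S (t, x)) + B (S (t, x)) \<bullet> h (S (t, x)) \<partial>\<mu>\<^sub>0) \<partial>unit_time)"
      using mh by (simp add: \<rho>_def integral_distr S_def)
    also have "\<dots> = (\<integral>y. A (S y) + B (S y) \<bullet> h (S y) \<partial>M)"
      unfolding M_def by (rule P.integral_fst') (use iA iB[OF hi] in \<open>simp flip: M_def\<close>)
    also have "\<dots> = (\<integral>y. A (S y) \<partial>M) + (\<integral>y. B (S y) \<bullet> h (S y) \<partial>M)"
      using iA iB[OF hi] by simp
    \<comment> \<open>The test gradient depends on the particle only through \<open>S\<close>, so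
      the conditional velocity may be exchanged for the displacement of the individual
      particle.\<close>
    also have "\<dots> = (\<integral>y. A (S y) \<partial>M) + (\<integral>y. B (S y) \<bullet> w y \<partial>M)"
      by (subst heq[OF _ C(2)]) simp_all
    also have "\<dots> = (\<integral>y. A (S y) + B (S y) \<bullet> w y \<partial>M)"
      using iA iB[OF wi] by simp
    also have "\<dots> = (\<integral>x. (\<integral>t. A (S (t, x)) + B (S (t, x)) \<bullet> w (t, x) \<partial>unit_time) \<partial>\<mu>\<^sub>0)"
    proof -
      define k where "k y = A (S y) + B (S y) \<bullet> w y" for y
      have "integrable M k"
        unfolding k_def using iA iB[OF wi] by simp
      then have "integrable (unit_time \<Otimes>\<^sub>M \<mu>\<^sub>0) (\<lambda>(t, x). k (t, x))"
        by (simp add: M_def)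
      from P.integral_snd[OF this] have "integral\<^sup>L M k = (\<integral>x. (\<integral>t. k (t, x) \<partial>unit_time) \<partial>\<mu>\<^sub>0)"
        by (simp add: M_def)
      then show ?thesis
        unfolding k_def .
    qed
    \<comment> \<open>For fixed \<open>x\<close> the integrand is the time derivative of
      \<open>\<phi>\<close> along the segment, and \<open>\<phi>\<close> vanishes at times 0 and
      1.\<close>
    also have "\<dots> = (\<integral>x. 0 \<partial>\<mu>\<^sub>0)"
    proof (rule Bochner_Integration.integral_cong)
      fix x
      define u where "u = F x - x"
      have seg: "seg t x = x + t *\<^sub>R u" for t
        by (simp add: seg_def u_def algebra_simps)
      have d: "((\<lambda>t. \<phi> (S (t, x))) has_vector_derivative A (S (t, x)) + B (S (t, x)) \<bullet> u) (at t within T)"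
        for t T
      proof -
        have "((\<lambda>t. (t, x + t *\<^sub>R u)) has_derivative (\<lambda>k. (k, k *\<^sub>R u))) (at t within T)"
          by (auto intro!: derivative_eq_intros)
        from has_derivative_compose[OF this D]
        have "((\<lambda>t. \<phi> (S (t, x))) has_derivative (\<lambda>k. k * A (S (t, x)) + B (S (t, x)) \<bullet> k *\<^sub>R u)) (at t within T)"
          by (simp add: S_def seg)
        then show ?thesis
          by (simp add: has_vector_derivative_def algebra_simps)
      qed
      have cont: "continuous_on {0..1} (\<lambda>t. A (S (t, x)) + B (S (t, x)) \<bullet> u)"
      proof -
        have "continuous_on {0..1} (\<lambda>t. S (t, x))"
          unfolding S_def fst_conv snd_conv seg by (intro continuous_intros)
        then show ?thesis
          by (intro continuous_intros continuous_on_compose2[OF A] continuous_on_compose2[OF B]) auto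
      qed
      have "(\<integral>t. A (S (t, x)) + B (S (t, x)) \<bullet> w (t, x) \<partial>unit_time)
          = (\<integral>t. indicator {0..1} t *\<^sub>R (A (S (t, x)) + B (S (t, x)) \<bullet> u) \<partial>lborel)"
        using has_bochner_integral_FTC_Icc[OF zero_le_one d cont, THEN integrable.intros]
        by (subst unit_time_eq_interval_integral) (auto simp: w_def u_def has_bochner_integral_iff)
      also have "\<dots> = \<phi> (S (1, x)) - \<phi> (S (0, x))"
        by (rule integral_FTC_Icc[OF _ d cont]) simp
      also have "\<dots> = 0"
        by (simp add: S_def test_function_time_bounds[OF \<phi>])
      finally show "(\<integral>t. A (S (t, x)) + B (S (t, x)) \<bullet> w (t, x) \<partial>unit_time) = 0" .
    qed simp
    finally show ?thesis
      by (simp add: AB v_def)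
  qed
  have narrow: "narrowly_continuous \<rho>"
    unfolding narrowly_continuous_def
  proof (intro allI impI)
    fix f :: "'a \<Rightarrow> real" assume f: "continuous_on UNIV f" "bounded (range f)"
    then obtain B where B: "\<And>x. \<bar>f x\<bar> \<le> B"
      by (auto simp: bounded_iff)
    have fm [measurable]: "f \<in> borel_measurable borel"
      using f by (intro borel_measurable_continuous_onI)
    show "continuous_on {0..1} (\<lambda>t. \<integral>x. f x \<partial>\<rho> t)"
    proof (rule continuous_on_sequentiallyI)
      fix u :: "nat \<Rightarrow> real" and a assume u: "u \<longlonglongrightarrow> a"
      have "(\<lambda>n. \<integral>x. f (seg (u n) x) \<partial>\<mu>\<^sub>0) \<longlonglongrightarrow> (\<integral>x. f (seg a x) \<partial>\<mu>\<^sub>0)"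
      proof (rule integral_dominated_convergence[where w = "\<lambda>_. B"])
        show "AE x in \<mu>\<^sub>0. (\<lambda>n. f (seg (u n) x)) \<longlonglongrightarrow> f (seg a x)"
        proof (rule AE_I2)
          fix x
          have "(\<lambda>n. seg (u n) x) \<longlonglongrightarrow> seg a x"
            unfolding seg_def by (intro tendsto_intros u)
          moreover have "isCont f (seg a x)"
            using f(1) by (simp add: continuous_on_eq_continuous_at)
          ultimately show "(\<lambda>n. f (seg (u n) x)) \<longlonglongrightarrow> f (seg a x)"
            by (rule isCont_tendsto_compose[rotated])
        qed
      qed (use B in auto)
      then show "(\<lambda>n. \<integral>x. f x \<partial>\<rho> (u n)) \<longlonglongrightarrow> (\<integral>x. f x \<partial>\<rho> a)"
        by (simp add: \<rho>_def integral_distr)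
    qed
  qed
  have ends: "\<rho> 0 = \<mu>\<^sub>0" "\<rho> 1 = \<mu>\<^sub>1"
    using push by (simp_all add: \<rho>_def seg_def[abs_def] distr_id2)
  have vm: "(\<lambda>(t, x). v t x) \<in> borel_measurable (restrict_space borel ({0<..<1} \<times> UNIV))"
    unfolding v_def by (simp add: split_beta measurable_restrict_space1)
  have bp: "borel_prob (\<rho> t)" for t
    unfolding \<rho>_def borel_prob_def by (auto intro: \<mu>0.prob_space_distr)
  have "bb_admissible \<mu>\<^sub>0 \<mu>\<^sub>1 (\<rho>, v)"
    unfolding bb_admissible_def prod.case
  proof (intro conjI)
    show "continuity_equation \<rho> v"
      unfolding continuity_equation_def
    proof (intro conjI allI impI ballI)
      fix K :: "(real \<times> 'a) set" assume "compact K"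
      then show "(\<integral>\<^sup>+t. \<integral>\<^sup>+x. ennreal (norm (v t x)) * indicator K (t, x) \<partial>\<rho> t \<partial>unit_time) < \<infinity>"
        by (rule loc)
    qed (rule ce)
  qed (use bp narrow ends vm in simp_all)
  then show thesis
    using cost_le by (rule that)
qed

section \<open>Trajectories of a minimizer\<close>

lemma borel_measurable_Pair_const:
  "Pair (t :: 'b::euclidean_space) \<in> borel_measurable (borel :: 'a::euclidean_space measure)"
  by (rule borel_measurable_continuous_onI) (intro continuous_intros)

lemma abs_cont_curve_affine: "abs_cont_curve (restrict (\<lambda>t. x + t *\<^sub>R w) {0..1})"
  unfolding abs_cont_curve_def
proof (intro allI impI)
  fix \<epsilon> :: real assume \<epsilon>: "0 < \<epsilon>"
  let ?z = "restrict (\<lambda>t. x + t *\<^sub>R w) {0..1}"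
  have "(\<Sum>i<n. norm (?z (b i) - ?z (a i))) < \<epsilon>"
    if ab: "\<forall>i<n. 0 \<le> a i \<and> a i \<le> b i \<and> b i \<le> 1" and s: "(\<Sum>i<n. b i - a i) < \<epsilon> / (norm w + 1)"
    for n :: nat and a b
  proof -
    have nw: "0 < norm w + 1"
      by (simp add: add_nonneg_pos)
    have "norm (?z (b i) - ?z (a i)) \<le> (norm w + 1) * (b i - a i)" if "i < n" for i
    proof -
      have i: "0 \<le> a i" "a i \<le> b i" "b i \<le> 1"
        using ab that by auto
      then have "?z (b i) - ?z (a i) = (b i - a i) *\<^sub>R w"
        by (auto simp: algebra_simps)
      then have "norm (?z (b i) - ?z (a i)) = norm w * (b i - a i)"
        using i by simp
      also have "\<dots> \<le> (norm w + 1) * (b i - a i)"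
        using i by (intro mult_right_mono) auto
      finally show ?thesis .
    qed
    then have "(\<Sum>i<n. norm (?z (b i) - ?z (a i))) \<le> (norm w + 1) * (\<Sum>i<n. b i - a i)"
      unfolding sum_distrib_left by (intro sum_mono) auto
    also have "\<dots> < \<epsilon>"
      using s nw by (simp add: field_simps)
    finally show ?thesis .
  qed
  moreover have "0 < \<epsilon> / (norm w + 1)"
    using \<epsilon> by (simp add: add_nonneg_pos)
  ultimately show "\<exists>\<delta>>0. \<forall>(n::nat) a b. (\<forall>i<n. 0 \<le> a i \<and> a i \<le> b i \<and> b i \<le> 1) \<longrightarrow>
      disjoint_family_on (\<lambda>i. {a i<..<b i}) {..<n} \<longrightarrow>
      (\<Sum>i<n. b i - a i) < \<delta> \<longrightarrow> (\<Sum>i<n. norm (?z (b i) - ?z (a i))) < \<epsilon>"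
    by blast
qed

text \<open>The line is cut off by \<open>restrict\<close> because solutions are
  \<open>extensional\<close>; at interior times this does not affect the derivative.\<close>

lemma solves_ivp_affine:
  assumes "AE t in unit_time. \<Phi> t differentiable (at (x + t *\<^sub>R w)) \<and>
    induced_velocity q \<Phi> t (x + t *\<^sub>R w) = w"
  shows "solves_ivp q \<Phi> x (restrict (\<lambda>t. x + t *\<^sub>R w) {0..1})"
proof -
  have "AE t in lborel. t \<in> {0<..<1} \<longrightarrow> \<Phi> t differentiable (at (x + t *\<^sub>R w)) \<and>
      induced_velocity q \<Phi> t (x + t *\<^sub>R w) = w"
    using assms by (subst (asm) AE_restrict_space_iff) simp_all
  then have "AE t in lborel. t \<in> {0<..<1} \<longrightarrow>
      \<Phi> t differentiable (at (restrict (\<lambda>t. x + t *\<^sub>R w) {0..1} t)) \<and>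
      (restrict (\<lambda>t. x + t *\<^sub>R w) {0..1} has_vector_derivative
        induced_velocity q \<Phi> t (restrict (\<lambda>t. x + t *\<^sub>R w) {0..1} t)) (at t)"
  proof eventually_elim
    case (elim t)
    show ?case
    proof
      assume t: "t \<in> {0<..<1}"
      have "((\<lambda>t. x + t *\<^sub>R w) has_vector_derivative w) (at t)"
        by (auto intro!: derivative_eq_intros)
      then have "(restrict (\<lambda>t. x + t *\<^sub>R w) {0..1} has_vector_derivative w) (at t)"
        by (rule has_vector_derivative_transform_within_open[of _ _ _ "{0<..<1}"]) (use t in auto)
      then show "\<Phi> t differentiable (at (restrict (\<lambda>t. x + t *\<^sub>R w) {0..1} t)) \<and>
          (restrict (\<lambda>t. x + t *\<^sub>R w) {0..1} has_vector_derivative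
            induced_velocity q \<Phi> t (restrict (\<lambda>t. x + t *\<^sub>R w) {0..1} t)) (at t)"
        using elim t by auto
    qed
  qed
  then show ?thesis
    unfolding solves_ivp_def using abs_cont_curve_affine by (auto simp: AE_restrict_space_iff)
qed

context
  fixes q :: real and \<Phi> :: "real \<Rightarrow> 'a::euclidean_space \<Rightarrow> real"
  assumes regular: "flow_regular q \<Phi>"
begin

lemma flow_solves: "solves_ivp q \<Phi> x (\<lambda>t. flow q \<Phi> t x)"
proof -
  have "\<exists>!z. solves_ivp q \<Phi> x z"
    using regular by (simp add: flow_regular_def)
  then have "solves_ivp q \<Phi> x (THE z. solves_ivp q \<Phi> x z)"
    by (rule theI')
  then show ?thesis
    unfolding flow_def .
qed

lemma flow_unique:
  assumes "solves_ivp q \<Phi> x z" shows "flow q \<Phi> t x = z t"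
proof -
  have "\<exists>!z. solves_ivp q \<Phi> x z"
    using regular by (simp add: flow_regular_def)
  then have "(\<lambda>t. flow q \<Phi> t x) = z"
    using flow_solves assms by blast
  then show ?thesis by meson
qed

lemma flow_zero: "flow q \<Phi> 0 x = x"
  using flow_solves[of x] by (simp add: solves_ivp_def)

lemma flow_affine:
  assumes "AE t in unit_time. \<Phi> t differentiable (at (x + t *\<^sub>R w)) \<and>
    induced_velocity q \<Phi> t (x + t *\<^sub>R w) = w" and "t \<in> {0..1}"
  shows "flow q \<Phi> t x = x + t *\<^sub>R w"
  using flow_unique[OF solves_ivp_affine[OF assms(1)], of t] assms(2) by simp

lemma flow_measurable_joint: "(\<lambda>(t, x). flow q \<Phi> t x) \<in> borel_measurable (restrict_space borel ({0..1} \<times> UNIV))"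
  using regular by (simp add: flow_regular_def)

lemma flow_measurable:
  assumes "t \<in> {0..1}"
  shows "flow q \<Phi> t \<in> borel_measurable borel"
proof -
  have "(\<lambda>x :: 'a. (t, x)) \<in> borel \<rightarrow>\<^sub>M restrict_space borel ({0..1} \<times> UNIV)"
    using assms by (intro measurable_restrict_space2 borel_measurable_Pair_const) auto
  from measurable_compose[OF this flow_measurable_joint] show ?thesis
    by simp
qed

lemma flow_measurable_pair:
  assumes "sets \<mu> = sets borel"
  shows "(\<lambda>y. flow q \<Phi> (fst y) (snd y)) \<in> borel_measurable (unit_time \<Otimes>\<^sub>M \<mu>)"
proof -
  have "fst \<in> unit_time \<Otimes>\<^sub>M \<mu> \<rightarrow>\<^sub>M borel"
    using measurable_compose[OF measurable_fst measurable_unit_time] by simp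
  moreover have "snd \<in> unit_time \<Otimes>\<^sub>M \<mu> \<rightarrow>\<^sub>M borel"
    using assms by (simp cong: measurable_cong_sets)
  ultimately have "(\<lambda>y. (fst y, snd y)) \<in> unit_time \<Otimes>\<^sub>M \<mu> \<rightarrow>\<^sub>M restrict_space borel ({0..1} \<times> UNIV)"
    by (intro measurable_restrict_space2 borel_measurable_Pair)
       (auto simp: space_pair_measure space_restrict_space)
  from measurable_compose[OF this flow_measurable_joint] show ?thesis
    by simp
qed

end

text \<open>Jensen's inequality with its equality case. Young's inequality is applied to
  \<open>g t\<close> and the fixed covector \<open>\<xi>\<close> dual to the total displacement
  \<open>m\<close>; as the velocity integrates to \<open>m\<close>, the Young defect
  \<open>r\<close> has integral (energy - \<open>norm m powr p\<close>) / p. It is nonnegative, and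
  if it vanishes then equality in Young's inequality gives \<open>g t = pow_dir q \<xi> = m\<close>
  for almost every time.\<close>

lemma abs_cont_curve_energy:
  fixes z :: "real \<Rightarrow> 'a::euclidean_space"
  assumes p: "1 < p" and z: "abs_cont_curve z"
    and deriv: "AE t in unit_time. (z has_vector_derivative g t) (at t)"
    and g [measurable]: "g \<in> borel_measurable unit_time"
  shows "ennreal (norm (z 1 - z 0) powr p) \<le> (\<integral>\<^sup>+t. ennreal (norm (g t) powr p) \<partial>unit_time)" (is ?le)
    and "(\<integral>\<^sup>+t. ennreal (norm (g t) powr p) \<partial>unit_time) = ennreal (norm (z 1 - z 0) powr p)
      \<Longrightarrow> AE t in unit_time. g t = z 1 - z 0" (is "?e \<Longrightarrow> ?eq")
proof -
  interpret prob_space unit_time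
    by (rule prob_space_unit_time)
  define q where "q = p / (p - 1)"
  note c = conjugate_exponent[OF p q_def]
  define m where "m = z 1 - z 0"
  define \<xi> where "\<xi> = pow_dir p m"
  have \<xi>: "norm \<xi> powr q = norm m powr p" "\<xi> \<bullet> m = norm m powr p" "pow_dir q \<xi> = m"
    using norm_pow_dir_powr[OF c(1,2)] inner_pow_dir[of m p] pow_dir_inverse[OF p q_def]
    by (auto simp: \<xi>_def inner_commute)
  have key: "?le \<and> (?e \<longrightarrow> ?eq)" if fin: "(\<integral>\<^sup>+t. ennreal (norm (g t) powr p) \<partial>unit_time) < \<infinity>"
  proof -
    have gi: "integrable unit_time g" and gp: "integrable unit_time (\<lambda>t. norm (g t) powr p)"
      using integrable_of_powr[OF finite_measure_axioms g _ fin] p by auto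
    have "set_integrable lborel {0<..<1} g"
      using gi by (simp add: set_integrable_def integrable_restrict_space)
    then have "(g has_integral (LINT t:{0<..<1}|lborel. g t)) {0<..<1}"
      using set_borel_integral_eq_integral[of "{0<..<1}" g] by (simp add: has_integral_integral)
    then have "(g has_integral (LINT t:{0<..<1}|lborel. g t)) {0..1}"
      by (simp add: has_integral_Icc_iff_Ioo)
    moreover have "(g has_integral m) {0..1}"
      unfolding m_def by (rule abs_cont_curve_has_integral[OF z _ _ _ deriv]) auto
    ultimately have "(LINT t:{0<..<1}|lborel. g t) = m"
      by (rule has_integral_unique)
    then have "(\<integral>t. g t \<partial>unit_time) = m"
      by (simp add: set_lebesgue_integral_def integral_restrict_space)
    then have g\<xi>: "(\<integral>t. \<xi> \<bullet> g t \<partial>unit_time) = norm m powr p"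
      using gi \<xi>(2) by simp
    define r where "r t = norm (g t) powr p / p + norm \<xi> powr q / q - \<xi> \<bullet> g t" for t
    have r0: "0 \<le> r t" for t
      using Young_inner[OF p q_def, of \<xi> "g t"] by (simp add: r_def)
    have ri: "integrable unit_time r"
      unfolding r_def using gi gp by auto
    have "1 - 1 / q = 1 / p"
      using c(3) by simp
    then have "norm m powr p / q - norm m powr p = - (norm m powr p / p)"
      by (metis (no_types, opaque_lifting) minus_diff_eq mult.right_neutral right_diff_distrib times_divide_eq_right)
    then have "(\<integral>t. r t \<partial>unit_time) = ((\<integral>t. norm (g t) powr p \<partial>unit_time) - norm m powr p) / p"
      unfolding r_def using gi gp g\<xi> prob_space \<xi>(1) by (simp add: diff_divide_distrib)
    moreover have "0 \<le> (\<integral>t. r t \<partial>unit_time)"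
      using r0 by simp
    ultimately have le: "norm m powr p \<le> (\<integral>t. norm (g t) powr p \<partial>unit_time)"
      and zero: "(\<integral>t. norm (g t) powr p \<partial>unit_time) = norm m powr p \<Longrightarrow> (\<integral>t. r t \<partial>unit_time) = 0"
      using p by (auto simp: zero_le_divide_iff)
    have ee: "(\<integral>\<^sup>+t. ennreal (norm (g t) powr p) \<partial>unit_time) = ennreal (\<integral>t. norm (g t) powr p \<partial>unit_time)"
      using gp by (intro nn_integral_eq_integral) auto
    have ?le
      unfolding ee m_def[symmetric] using le by (rule ennreal_leI)
    moreover have ?eq if ?e
    proof -
      have "(\<integral>t. r t \<partial>unit_time) = 0"
        using that unfolding ee m_def[symmetric] by (intro zero) simp
      then have "AE t in unit_time. r t = 0"
        using integral_nonneg_eq_0_iff_AE[OF ri] r0 by simp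
      then show ?eq
      proof eventually_elim
        case (elim t)
        then have "\<xi> \<bullet> g t = norm (g t) powr p / p + norm \<xi> powr q / q"
          by (simp add: r_def)
        from Young_inner_eq[OF p q_def this] show ?case
          using \<xi>(3) by (simp add: m_def)
      qed
    qed
    ultimately show ?thesis by blast
  qed
  show ?le
  proof (cases "(\<integral>\<^sup>+t. ennreal (norm (g t) powr p) \<partial>unit_time) < \<infinity>")
    case False
    then show ?thesis by (simp add: not_less top_unique)
  qed (use key in blast)
  show ?eq if ?e
    using key that by auto
qed

lemma abs_cont_curve_constant_velocity:
  fixes z :: "real \<Rightarrow> 'a::euclidean_space"
  assumes z: "abs_cont_curve z" and deriv: "AE t in unit_time. (z has_vector_derivative m) (at t)"
    and t: "t \<in> {0..1}"
  shows "z t = z 0 + t *\<^sub>R m"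
proof -
  have "((\<lambda>_. m) has_integral z t - z 0) {0..t}"
    using t by (intro abs_cont_curve_has_integral[OF z _ _ _ deriv]) auto
  moreover have "((\<lambda>_. m) has_integral t *\<^sub>R m) {0..t}"
    using has_integral_const_real[of m 0 t] t by simp
  ultimately have "z t - z 0 = t *\<^sub>R m"
    by (rule has_integral_unique)
  then show ?thesis
    by (simp add: algebra_simps)
qed

text \<open>The displacement interpolation of the terminal map is a competitor, so the trajectories of a
  minimizer cannot carry more energy than their chords.\<close>

lemma bb_minimizer_straight:
  fixes \<mu>\<^sub>0 \<mu>\<^sub>1 :: "'a::euclidean_space measure"
  assumes p: "1 < p" and \<mu>0: "\<mu>\<^sub>0 \<in> prob_finite_moment p" and \<mu>1: "\<mu>\<^sub>1 \<in> prob_finite_moment p"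
    and min: "is_arg_min (bb_cost p) (bb_admissible \<mu>\<^sub>0 \<mu>\<^sub>1) (\<rho>s, vs)"
    and reg: "flow_regular q \<Phi>"
    and \<rho>s: "\<And>t. t \<in> {0..1} \<Longrightarrow> \<rho>s t = induced_law q \<mu>\<^sub>0 \<Phi> t"
    and vs: "\<And>t x. t \<in> {0<..<1} \<Longrightarrow> vs t x = induced_velocity q \<Phi> t x"
  defines "F \<equiv> terminal_map q \<Phi>"
  shows "distr \<mu>\<^sub>0 borel F = \<mu>\<^sub>1"
    and "bb_cost p (\<rho>s, vs) = ennreal (1 / p) * (\<integral>\<^sup>+x. ennreal (norm (F x - x) powr p) \<partial>\<mu>\<^sub>0)"
    and "AE x in \<mu>\<^sub>0. AE t in unit_time. \<Phi> t differentiable (at (x + t *\<^sub>R (F x - x))) \<and>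
      induced_velocity q \<Phi> t (x + t *\<^sub>R (F x - x)) = F x - x"
proof -
  interpret \<mu>0: prob_space \<mu>\<^sub>0
    using \<mu>0 by (simp add: prob_finite_moment_def borel_prob_def)
  interpret T: prob_space unit_time
    by (rule prob_space_unit_time)
  interpret P: pair_sigma_finite unit_time \<mu>\<^sub>0 ..
  have s0 [simp]: "sets \<mu>\<^sub>0 = sets borel"
    using \<mu>0 by (rule sets_prob_finite_moment)
  have sp0: "space \<mu>\<^sub>0 = UNIV"
    using sets_eq_imp_space_eq[OF s0] by simp
  have adm: "bb_admissible \<mu>\<^sub>0 \<mu>\<^sub>1 (\<rho>s, vs)" and
    least: "\<And>y. bb_admissible \<mu>\<^sub>0 \<mu>\<^sub>1 y \<Longrightarrow> bb_cost p (\<rho>s, vs) \<le> bb_cost p y"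
    using min by (auto simp: is_arg_min_def not_less)
  have F [measurable]: "F \<in> borel_measurable borel"
    unfolding F_def terminal_map_def by (rule flow_measurable[OF reg]) simp
  show push: "distr \<mu>\<^sub>0 borel F = \<mu>\<^sub>1"
    using adm \<rho>s[of 1] by (simp add: bb_admissible_def F_def terminal_map_def[abs_def] induced_law_def)
  have id0 [measurable]: "(\<lambda>x. x) \<in> borel_measurable \<mu>\<^sub>0"
    by (rule measurable_ident_sets) simp
  have F0 [measurable]: "F \<in> borel_measurable \<mu>\<^sub>0"
    using F by (simp only: measurable_cong_sets[OF s0 refl])
  have fin: "(\<integral>\<^sup>+x. ennreal (norm (F x - x) powr p) \<partial>\<mu>\<^sub>0) < \<infinity>"
    using p push by (intro displacement_finite[OF _ \<mu>0 \<mu>1]) (auto simp: distr_id2)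
  obtain \<rho> v where "bb_admissible \<mu>\<^sub>0 \<mu>\<^sub>1 (\<rho>, v)"
      "bb_cost p (\<rho>, v) \<le> ennreal (1 / p) * (\<integral>\<^sup>+x. ennreal (norm (F x - x) powr p) \<partial>\<mu>\<^sub>0)"
    by (rule displacement_interpolation_admissible[OF p \<mu>0 \<mu>1 F push]) blast
  then have upper: "bb_cost p (\<rho>s, vs) \<le> ennreal (1 / p) * (\<integral>\<^sup>+x. ennreal (norm (F x - x) powr p) \<partial>\<mu>\<^sub>0)"
    using least order_trans by blast
  \<comment> \<open>Velocity felt at time \<open>fst y\<close> by the particle started at
    \<open>snd y\<close>. It is written with \<open>vs\<close>, whose joint measurability is part of
    admissibility.\<close>
  define G where "G y = vs (fst y) (flow q \<Phi> (fst y) (snd y))" for y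
  have vm: "(\<lambda>(t, x). vs t x) \<in> borel_measurable (restrict_space borel ({0<..<1} \<times> UNIV))"
    using adm by (simp add: bb_admissible_def)
  have vst: "vs t \<in> borel_measurable borel" if "t \<in> {0<..<1}" for t
  proof -
    have "(\<lambda>x :: 'a. (t, x)) \<in> borel \<rightarrow>\<^sub>M restrict_space borel ({0<..<1} \<times> UNIV)"
      using that by (intro measurable_restrict_space2 borel_measurable_Pair_const) auto
    from measurable_compose[OF this vm] show ?thesis
      by simp
  qed
  have G [measurable]: "G \<in> borel_measurable (unit_time \<Otimes>\<^sub>M \<mu>\<^sub>0)"
  proof -
    have "fst \<in> unit_time \<Otimes>\<^sub>M \<mu>\<^sub>0 \<rightarrow>\<^sub>M borel"
      using measurable_compose[OF measurable_fst measurable_unit_time] by simp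
    then have "(\<lambda>y. (fst y, flow q \<Phi> (fst y) (snd y)))
        \<in> unit_time \<Otimes>\<^sub>M \<mu>\<^sub>0 \<rightarrow>\<^sub>M restrict_space borel ({0<..<1} \<times> UNIV)"
      using flow_measurable_pair[OF reg s0] by (intro measurable_restrict_space2 borel_measurable_Pair)
       (auto simp: space_pair_measure space_restrict_space)
    from measurable_compose[OF this vm] show ?thesis
      unfolding G_def[abs_def] by simp
  qed
  have cost: "bb_cost p (\<rho>s, vs) = ennreal (1 / p) *
      (\<integral>\<^sup>+x. \<integral>\<^sup>+t. ennreal (norm (G (t, x)) powr p) \<partial>unit_time \<partial>\<mu>\<^sub>0)"
  proof -
    have "(\<integral>\<^sup>+t. \<integral>\<^sup>+x. ennreal (norm (vs t x) powr p) \<partial>\<rho>s t \<partial>unit_time)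
        = (\<integral>\<^sup>+t. \<integral>\<^sup>+x. ennreal (norm (G (t, x)) powr p) \<partial>\<mu>\<^sub>0 \<partial>unit_time)"
    proof (rule nn_integral_cong)
      fix t assume "t \<in> space unit_time"
      then have t: "t \<in> {0<..<1}"
        by (simp add: space_restrict_space)
      have fl: "flow q \<Phi> t \<in> \<mu>\<^sub>0 \<rightarrow>\<^sub>M borel"
        using flow_measurable[OF reg, of t] t by (simp cong: measurable_cong_sets)
      have "\<rho>s t = distr \<mu>\<^sub>0 borel (flow q \<Phi> t)"
        using \<rho>s[of t] t by (simp add: induced_law_def)
      then show "(\<integral>\<^sup>+x. ennreal (norm (vs t x) powr p) \<partial>\<rho>s t)
          = (\<integral>\<^sup>+x. ennreal (norm (G (t, x)) powr p) \<partial>\<mu>\<^sub>0)"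
        using vst[OF t] fl by (simp add: nn_integral_distr G_def)
    qed
    also have "\<dots> = (\<integral>\<^sup>+x. \<integral>\<^sup>+t. ennreal (norm (G (t, x)) powr p) \<partial>unit_time \<partial>\<mu>\<^sub>0)"
      by (rule P.Fubini[symmetric]) measurable
    finally show ?thesis
      by (simp add: bb_cost_def)
  qed
  \<comment> \<open>\<open>a x\<close> is the energy of the trajectory from \<open>x\<close>, and
    \<open>b x\<close> below that of its chord.\<close>
  define a where "a x = (\<integral>\<^sup>+t. ennreal (norm (G (t, x)) powr p) \<partial>unit_time)" for x
  define b where "b x = ennreal (norm (F x - x) powr p)" for x
  have Gx: "(\<lambda>t. G (t, x)) \<in> borel_measurable unit_time" for x
    using measurable_compose[OF measurable_Pair2'[of x \<mu>\<^sub>0 unit_time] G] sp0 by simp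
  have curve: "abs_cont_curve (\<lambda>t. flow q \<Phi> t x)" "AE t in unit_time. \<Phi> t differentiable (at (flow q \<Phi> t x))"
    "AE t in unit_time. ((\<lambda>t. flow q \<Phi> t x) has_vector_derivative G (t, x)) (at t)" for x
  proof -
    have *: "abs_cont_curve (\<lambda>t. flow q \<Phi> t x)" "AE t in unit_time. \<Phi> t differentiable (at (flow q \<Phi> t x)) \<and>
        ((\<lambda>t. flow q \<Phi> t x) has_vector_derivative induced_velocity q \<Phi> t (flow q \<Phi> t x)) (at t)"
      using flow_solves[OF reg, of x] by (auto simp: solves_ivp_def)
    then show "abs_cont_curve (\<lambda>t. flow q \<Phi> t x)" "AE t in unit_time. \<Phi> t differentiable (at (flow q \<Phi> t x))"
      by auto
    have "AE t in unit_time. t \<in> {0<..<1}"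
      using AE_space[of unit_time] by (simp add: space_restrict_space)
    with *(2) show "AE t in unit_time. ((\<lambda>t. flow q \<Phi> t x) has_vector_derivative G (t, x)) (at t)"
      by eventually_elim (simp add: G_def vs)
  qed
  have ends: "flow q \<Phi> 1 x - flow q \<Phi> 0 x = F x - x" for x
    by (simp add: flow_zero[OF reg] F_def terminal_map_def)
  have ba: "b x \<le> a x" for x
    using abs_cont_curve_energy(1)[OF p curve(1,3) Gx, of x] by (simp add: ends a_def b_def)
  have am [measurable]: "a \<in> borel_measurable \<mu>\<^sub>0"
    unfolding a_def by (rule T.borel_measurable_nn_integral) simp
  have bm [measurable]: "b \<in> borel_measurable \<mu>\<^sub>0"
    unfolding b_def by measurable
  have "(\<integral>\<^sup>+x. b x \<partial>\<mu>\<^sub>0) \<le> (\<integral>\<^sup>+x. a x \<partial>\<mu>\<^sub>0)"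
    using ba by (intro nn_integral_mono)
  moreover have "(\<integral>\<^sup>+x. a x \<partial>\<mu>\<^sub>0) \<le> (\<integral>\<^sup>+x. b x \<partial>\<mu>\<^sub>0)"
  proof -
    have "ennreal p * (ennreal (1 / p) * X) = X" for X
      using p by (simp add: mult.assoc[symmetric] flip: ennreal_mult')
    then show ?thesis
      using mult_left_mono[OF upper[unfolded cost], of "ennreal p"] by (simp add: a_def b_def)
  qed
  ultimately have ab: "(\<integral>\<^sup>+x. a x \<partial>\<mu>\<^sub>0) = (\<integral>\<^sup>+x. b x \<partial>\<mu>\<^sub>0)"
    by simp
  then show "bb_cost p (\<rho>s, vs) = ennreal (1 / p) * (\<integral>\<^sup>+x. ennreal (norm (F x - x) powr p) \<partial>\<mu>\<^sub>0)"
    unfolding cost by (simp add: a_def b_def)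
  \<comment> \<open>Equal integrals and \<open>b x \<le> a x\<close> force equality almost
    everywhere; the subtraction is legitimate because the chords have finite total energy.\<close>
  have "(\<integral>\<^sup>+x. a x - b x \<partial>\<mu>\<^sub>0) = (\<integral>\<^sup>+x. a x \<partial>\<mu>\<^sub>0) - (\<integral>\<^sup>+x. b x \<partial>\<mu>\<^sub>0)"
    using fin ba by (intro nn_integral_diff) (auto simp: b_def)
  moreover have "(\<integral>\<^sup>+x. b x \<partial>\<mu>\<^sub>0) \<noteq> \<top>"
    using fin by (simp add: b_def)
  ultimately have "(\<integral>\<^sup>+x. a x - b x \<partial>\<mu>\<^sub>0) = 0"
    by (simp add: ab ennreal_diff_self)
  then have "AE x in \<mu>\<^sub>0. a x - b x = 0"
    by (simp add: nn_integral_0_iff_AE)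
  then show "AE x in \<mu>\<^sub>0. AE t in unit_time. \<Phi> t differentiable (at (x + t *\<^sub>R (F x - x))) \<and>
      induced_velocity q \<Phi> t (x + t *\<^sub>R (F x - x)) = F x - x"
  proof eventually_elim
    case (elim x)
    then have "a x = b x"
      using ba[of x] by (metis antisym diff_eq_0_iff_ennreal)
    then have GF: "AE t in unit_time. G (t, x) = F x - x"
      using abs_cont_curve_energy(2)[OF p curve(1,3) Gx, of x] by (simp add: ends a_def b_def)
    then have "AE t in unit_time. ((\<lambda>t. flow q \<Phi> t x) has_vector_derivative F x - x) (at t)"
      using curve(3)[of x] by eventually_elim simp
    then have z: "flow q \<Phi> t x = x + t *\<^sub>R (F x - x)" if "t \<in> {0..1}" for t
      using abs_cont_curve_constant_velocity[OF curve(1) _ that, of x "F x - x"] by (simp add: flow_zero[OF reg])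
    have "AE t in unit_time. t \<in> {0<..<1}"
      using AE_space[of unit_time] by (simp add: space_restrict_space)
    with GF curve(2)[of x] show ?case
      by eventually_elim (simp add: G_def vs flip: z)
  qed
qed

section \<open>The Hamilton--Jacobi equation\<close>

context
  fixes \<Phi> :: "real \<Rightarrow> 'a::euclidean_space \<Rightarrow> real"
  assumes C2: "Ck_on 2 ({0<..<1} \<times> UNIV) (\<lambda>(t, x). \<Phi> t x)"
begin

private abbreviation (input) "\<Psi> \<equiv> (\<lambda>(t, x). \<Phi> t x)"

private definition "D y = frechet_derivative \<Psi> (at y)"

text \<open>Row \<open>b\<close> of the space-time Hessian.\<close>

private definition "H b y = frechet_derivative (\<lambda>y. D y b) (at y)"

definition time_partial :: "real \<times> 'a \<Rightarrow> real" where
  "time_partial y = D y (1, 0)"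

definition space_partial :: "real \<times> 'a \<Rightarrow> 'a" where
  "space_partial y = (\<Sum>b\<in>Basis. D y (0, b) *\<^sub>R b)"

private lemma C2':
  assumes "t \<in> {0<..<1}"
  shows "(\<Psi> has_derivative D (t, x)) (at (t, x))"
    "b \<in> Basis \<Longrightarrow> ((\<lambda>y. D y b) has_derivative H b (t, x)) (at (t, x))"
    "b \<in> Basis \<Longrightarrow> b' \<in> Basis \<Longrightarrow> continuous_on ({0<..<1} \<times> UNIV) (\<lambda>y. H b y b')"
proof -
  have "Ck_on (Suc (Suc 0)) ({0<..<1} \<times> UNIV) \<Psi>"
    using C2 by (simp add: numeral_2_eq_2)
  then have *: "\<forall>y\<in>{0<..<1} \<times> UNIV. \<Psi> differentiable (at y)"
      "\<forall>b\<in>Basis. (\<forall>y\<in>{0<..<1} \<times> UNIV. (\<lambda>y. D y b) differentiable (at y)) \<and>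
        (\<forall>b'\<in>Basis. continuous_on ({0<..<1} \<times> UNIV) (\<lambda>y. H b y b'))"
    unfolding Ck_on.simps D_def[symmetric] H_def[symmetric] by blast+
  have "(t, x) \<in> {0<..<1} \<times> UNIV"
    using assms by simp
  then show "(\<Psi> has_derivative D (t, x)) (at (t, x))"
    "b \<in> Basis \<Longrightarrow> ((\<lambda>y. D y b) has_derivative H b (t, x)) (at (t, x))"
    "b \<in> Basis \<Longrightarrow> b' \<in> Basis \<Longrightarrow> continuous_on ({0<..<1} \<times> UNIV) (\<lambda>y. H b y b')"
    using * frechet_derivative_works unfolding D_def H_def by blast+
qed

private lemma basis: "(1, 0) \<in> (Basis :: (real \<times> 'a) set)" "b \<in> Basis \<Longrightarrow> (0, b) \<in> (Basis :: (real \<times> 'a) set)"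
  by (auto simp: Basis_prod_def)

lemma potential_differentiable:
  assumes "t \<in> {0<..<1}" shows "\<Phi> t differentiable (at x)"
  using has_derivative_space_slice[OF C2'(1)[OF assms, of x]] by (auto simp: differentiable_def)

lemma gradient_potential:
  assumes "t \<in> {0<..<1}" shows "gradient (\<Phi> t) x = space_partial (t, x)"
  using gradient_space_slice[OF C2'(1)[OF assms, of x]] by (simp add: space_partial_def)

private lemma D_eq:
  assumes "t \<in> {0<..<1}" shows "D (t, x) (s, w) = s * time_partial (t, x) + space_partial (t, x) \<bullet> w"
  using derivative_eq_time_gradient[OF C2'(1)[OF assms, of x], of s w] gradient_potential[OF assms, of x]
  by (simp add: time_partial_def)

lemma partials_has_derivative:
  assumes "t \<in> {0<..<1}"
  shows "(time_partial has_derivative H (1, 0) (t, x)) (at (t, x))"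
    "(space_partial has_derivative (\<lambda>k. \<Sum>b\<in>Basis. H (0, b) (t, x) k *\<^sub>R b)) (at (t, x))"
  unfolding time_partial_def space_partial_def
  using C2'(2)[OF assms, of _ x] basis by (auto intro!: has_derivative_sum has_derivative_scaleR_left)

lemma potential_along_line:
  assumes "t \<in> {0<..<1}"
  shows "((\<lambda>r. \<Phi> r (m + r *\<^sub>R w)) has_real_derivative
    (time_partial (t, m + t *\<^sub>R w) + space_partial (t, m + t *\<^sub>R w) \<bullet> w)) (at t)"
proof -
  have "((\<lambda>r. (r, m + r *\<^sub>R w)) has_derivative (\<lambda>k. (k, k *\<^sub>R w))) (at t)"
    by (auto intro!: derivative_eq_intros)
  from has_derivative_compose[OF this C2'(1)[OF assms]]
  have "((\<lambda>r. \<Phi> r (m + r *\<^sub>R w)) has_derivative (\<lambda>k. D (t, m + t *\<^sub>R w) (k, k *\<^sub>R w))) (at t)"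
    by simp
  then show ?thesis
    unfolding has_field_derivative_def
    by (rule has_derivative_eq_rhs) (auto simp: D_eq[OF assms] fun_eq_iff algebra_simps)
qed

text \<open>Differentiating the constant \<open>\<nabla>\<Phi>\<close> along a straight characteristic and exchanging the mixed
  partials shows that the spatial gradient of \<open>\<partial>\<^sub>t\<Phi> - \<parallel>\<nabla>\<Phi>\<parallel>\<^sup>q / q\<close> vanishes there.\<close>

lemma hamilton_jacobi:
  assumes p: "1 < p" "q = p / (p - 1)"
    and dense: "\<And>t U. t \<in> {0<..<1} \<Longrightarrow> open U \<Longrightarrow> U \<noteq> {} \<Longrightarrow>
      \<exists>a w. a + t *\<^sub>R w \<in> U \<and> (\<forall>r\<in>{0<..<1}. induced_velocity q \<Phi> r (a + r *\<^sub>R w) = w)"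
  obtains c where "continuous_on {0<..<1} c"
    "\<And>t x. t \<in> {0<..<1} \<Longrightarrow> time_partial (t, x) - norm (space_partial (t, x)) powr q / q = c t"
proof -
  note e = conjugate_exponent[OF p]
  define G where "G y = time_partial y - norm (space_partial y) powr q / q" for y
  \<comment> \<open>The derivative of \<open>G\<close> in the spatial direction \<open>h\<close>, as
    \<open>Gx\<close> confirms; it is shown to vanish on characteristics and then
    everywhere.\<close>
  define K where "K h y = H (1, 0) y (0, h) - pow_dir q (space_partial y) \<bullet> (\<Sum>b\<in>Basis. H (0, b) y (0, h) *\<^sub>R b)"
    for h and y
  have Gd: "(G has_derivative (\<lambda>k. H (1, 0) (t, x) k -
      pow_dir q (space_partial (t, x)) \<bullet> (\<Sum>b\<in>Basis. H (0, b) (t, x) k *\<^sub>R b))) (at (t, x))"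
    if t: "t \<in> {0<..<1}" for t x
    unfolding G_def
    by (intro has_derivative_diff partials_has_derivative[OF t]
        has_derivative_compose[OF partials_has_derivative(2)[OF t] has_derivative_norm_powr[OF e(1)]])
  have Gx: "((\<lambda>x. G (t, x)) has_derivative (\<lambda>h. K h (t, x))) (at x)" if t: "t \<in> {0<..<1}" for t x
  proof -
    have "((\<lambda>x. (t, x)) has_derivative (\<lambda>h. (0, h))) (at x)"
      by (auto intro!: derivative_eq_intros)
    from has_derivative_compose[OF this Gd[OF t]] show ?thesis
      unfolding K_def .
  qed
  have zero: "K h (t, a + t *\<^sub>R w) = 0"
    if t: "t \<in> {0<..<1}" and v: "\<And>r. r \<in> {0<..<1} \<Longrightarrow> induced_velocity q \<Phi> r (a + r *\<^sub>R w) = w"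
      and h: "h \<in> Basis" for t a w h
  proof -
    let ?y = "(t, a + t *\<^sub>R w)"
    have g: "space_partial (r, a + r *\<^sub>R w) = - pow_dir p w" if "r \<in> {0<..<1}" for r
    proof -
      have "pow_dir q (space_partial (r, a + r *\<^sub>R w)) = - w"
        using v[OF that] by (simp add: induced_velocity_def gradient_potential[OF that] minus_equation_iff)
      then show ?thesis
        using pow_dir_inverse[OF e(1,2), of "space_partial (r, a + r *\<^sub>R w)"] by simp
    qed
    have "((\<lambda>r. (r, a + r *\<^sub>R w)) has_derivative (\<lambda>k. (k, k *\<^sub>R w))) (at t)"
      by (auto intro!: derivative_eq_intros)
    from has_derivative_compose[OF this partials_has_derivative(2)[OF t]]
    have "((\<lambda>r. space_partial (r, a + r *\<^sub>R w)) has_derivative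
        (\<lambda>k. \<Sum>b\<in>Basis. H (0, b) ?y (k, k *\<^sub>R w) *\<^sub>R b)) (at t)" .
    moreover have "((\<lambda>r. space_partial (r, a + r *\<^sub>R w)) has_derivative (\<lambda>k. 0)) (at t)"
      by (rule has_derivative_transform_within_open[of "\<lambda>_. - pow_dir p w" _ _ _ "{0<..<1}"])
         (use t g in auto)
    ultimately have "(\<lambda>k. \<Sum>b\<in>Basis. H (0, b) ?y (k, k *\<^sub>R w) *\<^sub>R b) = (\<lambda>k. 0)"
      by (rule has_derivative_unique)
    then have "(\<Sum>b\<in>Basis. H (0, b) ?y (1, 1 *\<^sub>R w) *\<^sub>R b) = 0"
      by meson
    then have "(\<Sum>b\<in>Basis. H (0, b) ?y (1, w) *\<^sub>R b) \<bullet> h = 0"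
      by simp
    then have H0: "H (0, h) ?y (1, w) = 0"
      using h by (simp add: inner_sum_left inner_Basis if_distrib cong: if_cong)
    have opn: "open ({0<..<1::real} \<times> (UNIV :: 'a set))" "?y \<in> {0<..<1} \<times> UNIV"
      using t by (auto intro: open_Times)
    have sym: "H b ?y b' = H b' ?y b" if "b \<in> Basis" "b' \<in> Basis" for b b'
      by (rule mixed_partials_symmetric[OF opn, of \<Psi> D])
         (use C2'(1) C2'(2)[OF t] that in auto)
    have lin: "linear (H (0, h) ?y)"
      using C2'(2)[OF t basis(2)[OF h]] by (rule has_derivative_linear)
    have "pow_dir q (space_partial ?y) = - w"
      using g[OF t] pow_dir_inverse[OF p, of w] by simp
    \<comment> \<open>Symmetry of the Hessian turns both terms into values of the single linear form
      \<open>H (0, h) ?y\<close>, at \<open>(1, 0)\<close> and \<open>(0, w)\<close>. Their sum is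
      the value at \<open>(1, w)\<close>, which is zero by \<open>H0\<close>.\<close>
    then have "K h ?y = H (1, 0) ?y (0, h) + (\<Sum>b\<in>Basis. (w \<bullet> b) * H (0, b) ?y (0, h))"
      by (simp add: K_def inner_sum_right mult.commute sum_negf)
    also have "\<dots> = H (0, h) ?y (1, 0) + (\<Sum>b\<in>Basis. (w \<bullet> b) * H (0, h) ?y (0, b))"
      using sym basis h by (intro arg_cong2[of _ _ _ _ "(+)"] sum.cong) auto
    also have "(\<Sum>b\<in>Basis. (w \<bullet> b) * H (0, h) ?y (0, b)) = H (0, h) ?y (\<Sum>b\<in>Basis. (w \<bullet> b) *\<^sub>R (0, b))"
      using lin by (simp add: linear_sum linear_cmul del: scaleR_Pair)
    also have "(\<Sum>b\<in>Basis. (w \<bullet> b) *\<^sub>R ((0::real), b)) = (0, w)"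
      by (simp add: prod_eq_iff fst_sum snd_sum euclidean_representation)
    also have "H (0, h) ?y (1, 0) + H (0, h) ?y (0, w) = H (0, h) ?y ((1, 0) + (0, w))"
      using lin by (simp add: linear_add del: add_Pair)
    finally show ?thesis
      using H0 by simp
  qed
  have Kc: "continuous_on UNIV (\<lambda>x. K h (t, x))" if t: "t \<in> {0<..<1}" and h: "h \<in> Basis" for t h
  proof -
    have c: "continuous_on UNIV (\<lambda>x. H b (t, x) (0, h))" if "b \<in> Basis" for b
      by (rule continuous_on_compose2[OF C2'(3)[OF t that basis(2)[OF h]]])
         (use t in \<open>auto intro!: continuous_intros\<close>)
    have "isCont (\<lambda>x. space_partial (t, x)) x" for x
      by (rule isCont_o2[where f = "\<lambda>x. (t, x)"])
         (use has_derivative_continuous[OF partials_has_derivative(2)[OF t]] in \<open>auto intro!: continuous_intros\<close>)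
    then have "continuous_on UNIV (\<lambda>x. pow_dir q (space_partial (t, x)))"
      by (intro continuous_at_imp_continuous_on ballI isCont_o2[OF _ continuous_pow_dir[OF e(1)]])
    then show ?thesis
      unfolding K_def using basis by (intro continuous_intros c) auto
  qed
  \<comment> \<open>Continuity of the second partials makes the set where \<open>K h\<close> is
    nonzero open at each time, so if nonempty it would meet a characteristic.\<close>
  have K0: "K h (t, x) = 0" if t: "t \<in> {0<..<1}" and h: "h \<in> Basis" for t h x
  proof (rule ccontr)
    assume "K h (t, x) \<noteq> 0"
    then have "{x. K h (t, x) \<noteq> 0} \<noteq> {}"
      by blast
    then have "\<exists>a w. a + t *\<^sub>R w \<in> {x. K h (t, x) \<noteq> 0} \<and>
        (\<forall>r\<in>{0<..<1}. induced_velocity q \<Phi> r (a + r *\<^sub>R w) = w)"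
      by (intro dense t open_Collect_neq Kc h continuous_on_const)
    then obtain a w where "K h (t, a + t *\<^sub>R w) \<noteq> 0"
        and v: "\<forall>r\<in>{0<..<1}. induced_velocity q \<Phi> r (a + r *\<^sub>R w) = w"
      by auto
    then show False
      using zero[OF t bspec[OF v] h] by simp
  qed
  have const: "G (t, x) = G (t, 0)" if t: "t \<in> {0<..<1}" for t x
  proof -
    have "((\<lambda>x. G (t, x)) has_derivative (\<lambda>h. 0)) (at x)" for x
    proof -
      have lin: "linear (\<lambda>h. K h (t, x))"
        using Gx[OF t] by (rule has_derivative_linear)
      have "K h (t, x) = 0" for h
      proof -
        have "K (\<Sum>b\<in>Basis. (h \<bullet> b) *\<^sub>R b) (t, x) = (\<Sum>b\<in>Basis. (h \<bullet> b) *\<^sub>R K b (t, x))"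
          using linear_sum[OF lin, of "\<lambda>b. (h \<bullet> b) *\<^sub>R b"] linear_cmul[OF lin] by simp
        then show ?thesis
          by (simp add: euclidean_representation K0[OF t])
      qed
      then show ?thesis
        using Gx[OF t, of x] by simp
    qed
    then have "\<exists>c. \<forall>x\<in>UNIV. G (t, x) = c"
      by (intro has_derivative_zero_constant) auto
    then show ?thesis
      by force
  qed
  show thesis
  \<comment> \<open>The origin is an arbitrary base point, since \<open>G\<close> does not depend on
    position. Continuity in time is what provides an antiderivative of \<open>c\<close> later
    on.\<close>
  proof (rule that[of "\<lambda>t. G (t, 0)"])
    have "isCont (\<lambda>t. G (t, 0)) t" if t: "t \<in> {0<..<1}" for t
      by (rule isCont_o2[where f = "\<lambda>t. (t, 0)"])
         (use has_derivative_continuous[OF Gd[OF t]] in \<open>auto intro!: continuous_intros\<close>)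
    then show "continuous_on {0<..<1} (\<lambda>t. G (t, 0))"
      by (intro continuous_at_imp_continuous_on) auto
    show "time_partial (t, x) - norm (space_partial (t, x)) powr q / q = G (t, 0)"
      if "t \<in> {0<..<1}" for t x
      using const[OF that, of x] by (simp add: G_def)
  qed
qed

text \<open>\<open>C\<close> is an antiderivative of the function of time left over in the
  Hamilton-Jacobi equation. After its subtraction, the derivative of potential plus action along a
  line of velocity \<open>w\<close> is the Young defect of \<open>w\<close> and the negative spatial
  gradient. It is therefore nonnegative, and zero exactly if \<open>w\<close> is the induced
  velocity.\<close>

lemma action_along_lines:
  assumes p: "1 < p" "q = p / (p - 1)"
    and dense: "\<And>t U. t \<in> {0<..<1} \<Longrightarrow> open U \<Longrightarrow> U \<noteq> {} \<Longrightarrow>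
      \<exists>a w. a + t *\<^sub>R w \<in> U \<and> (\<forall>r\<in>{0<..<1}. induced_velocity q \<Phi> r (a + r *\<^sub>R w) = w)"
  obtains C where "\<And>m w t. t \<in> {0<..<1} \<Longrightarrow>
    \<exists>\<delta>\<ge>0. ((\<lambda>r. \<Phi> r (m + r *\<^sub>R w) - C r + r * (norm w powr p / p)) has_real_derivative \<delta>) (at t) \<and>
      (\<delta> = 0 \<longleftrightarrow> induced_velocity q \<Phi> t (m + t *\<^sub>R w) = w)"
proof -
  note e = conjugate_exponent[OF p]
  obtain c where c: "continuous_on {0<..<1} c"
    and hj: "\<And>t x. t \<in> {0<..<1} \<Longrightarrow> time_partial (t, x) - norm (space_partial (t, x)) powr q / q = c t"
    using hamilton_jacobi[OF p dense] by blast
  have "isCont c t" if "ereal 0 < ereal t" "ereal t < ereal 1" for t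
    using c that by (simp add: continuous_on_eq_continuous_at)
  then obtain C where C: "\<And>t. 0 < t \<Longrightarrow> t < 1 \<Longrightarrow> (C has_vector_derivative c t) (at t)"
    using einterval_antiderivative[of "ereal 0" "ereal 1" c] by auto
  show thesis
  proof (rule that[of C])
    fix m w :: 'a and t :: real assume t: "t \<in> {0<..<1}"
    let ?y = "(t, m + t *\<^sub>R w)"
    define g where "g = - space_partial ?y"
    define \<delta> where "\<delta> = norm w powr p / p + norm g powr q / q - g \<bullet> w"
    have "(C has_real_derivative c t) (at t)"
      using C t by (simp add: has_real_derivative_iff_has_vector_derivative)
    then have "((\<lambda>r. \<Phi> r (m + r *\<^sub>R w) - C r + r * (norm w powr p / p)) has_real_derivative
        (time_partial ?y + space_partial ?y \<bullet> w - c t + norm w powr p / p)) (at t)"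
      by (intro DERIV_add DERIV_diff potential_along_line[OF t] DERIV_cmult_right[of "\<lambda>r. r" 1, simplified]) auto
    moreover have "time_partial ?y + space_partial ?y \<bullet> w - c t + norm w powr p / p = \<delta>"
      using hj[OF t, of "m + t *\<^sub>R w"] by (simp add: \<delta>_def g_def)
    moreover have "0 \<le> \<delta>"
      using Young_inner[OF p, of g w] by (simp add: \<delta>_def)
    moreover have "\<delta> = 0 \<longleftrightarrow> w = pow_dir q g"
    proof
      assume "\<delta> = 0"
      then show "w = pow_dir q g"
        by (intro Young_inner_eq[OF p]) (simp add: \<delta>_def)
    next
      assume w: "w = pow_dir q g"
      have "g \<bullet> w = norm g powr q" "norm w powr p = norm g powr q"
        using inner_pow_dir[of g q] norm_pow_dir_powr[OF p, of g] unfolding w by simp_all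
      moreover have "x / p + x / q = x" for x :: real
        using e(3) by (metis distrib_left mult.right_neutral times_divide_eq_right)
      ultimately show "\<delta> = 0"
        by (simp add: \<delta>_def)
    qed
    moreover have "induced_velocity q \<Phi> t (m + t *\<^sub>R w) = pow_dir q g"
      by (simp add: induced_velocity_def gradient_potential[OF t] g_def)
    ultimately show "\<exists>\<delta>\<ge>0. ((\<lambda>r. \<Phi> r (m + r *\<^sub>R w) - C r + r * (norm w powr p / p)) has_real_derivative \<delta>) (at t) \<and>
        (\<delta> = 0 \<longleftrightarrow> induced_velocity q \<Phi> t (m + t *\<^sub>R w) = w)"
      by (intro exI[of _ \<delta>]) auto
  qed
qed

end

section \<open>Dual potentials\<close>

text \<open>Value of \<open>u\<close> at time \<open>r\<close> on the segment plus the action spent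
  so far, which grows linearly because the velocity \<open>y - x\<close> is constant.\<close>

definition segment_action :: "real \<Rightarrow> (real \<Rightarrow> 'a::euclidean_space \<Rightarrow> real) \<Rightarrow> 'a \<Rightarrow> 'a \<Rightarrow> real \<Rightarrow> real" where
  "segment_action p u x y r = u r (x + r *\<^sub>R (y - x)) + r * (norm (y - x) powr p / p)"

text \<open>Stands for the value of \<open>u\<close> at time 0. As the action increases along a
  segment, the infimum over \<open>r\<close> is its limit at time 0; taking it over all
  \<open>y\<close> as well makes the value independent of the direction of approach. It need not be
  finite.\<close>

definition initial_potential :: "real \<Rightarrow> (real \<Rightarrow> 'a::euclidean_space \<Rightarrow> real) \<Rightarrow> 'a \<Rightarrow> ereal" where
  "initial_potential p u x = (INF (y, r) \<in> UNIV \<times> {0<..<1}. ereal (segment_action p u x y r))"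

text \<open>The mirror image at time 1: the action of the whole segment is subtracted, and the
  supremum over \<open>r\<close> is the limit at time 1.\<close>

definition terminal_potential :: "real \<Rightarrow> (real \<Rightarrow> 'a::euclidean_space \<Rightarrow> real) \<Rightarrow> 'a \<Rightarrow> ereal" where
  "terminal_potential p u y = (SUP (x, r) \<in> UNIV \<times> {0<..<1}.
    ereal (segment_action p u x y r - norm (y - x) powr p / p))"

locale action_increasing =
  fixes p :: real and u :: "real \<Rightarrow> 'a::euclidean_space \<Rightarrow> real"
  assumes p: "1 < p"
    and u_cont: "\<And>r. r \<in> {0<..<1} \<Longrightarrow> continuous_on UNIV (u r)"
    and u_mono: "\<And>m w s r. 0 < s \<Longrightarrow> s \<le> r \<Longrightarrow> r < 1 \<Longrightarrow>
      u s (m + s *\<^sub>R w) + s * (norm w powr p / p) \<le> u r (m + r *\<^sub>R w) + r * (norm w powr p / p)"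
begin

lemma initial_potential_le: "r \<in> {0<..<1} \<Longrightarrow> initial_potential p u x \<le> ereal (segment_action p u x y r)"
  unfolding initial_potential_def by (rule INF_lower2[of "(y, r)"]) auto

lemma terminal_potential_ge:
  "r \<in> {0<..<1} \<Longrightarrow> ereal (segment_action p u x y r - norm (y - x) powr p / p) \<le> terminal_potential p u y"
  unfolding terminal_potential_def by (rule SUP_upper2[of "(x, r)"]) auto

text \<open>The action at any one interior time bounds the initial potential from above and, shifted
  by the cost, the terminal one from below; time 1/2 is a convenient choice.\<close>

lemma potentials_le: "initial_potential p u x \<le> terminal_potential p u y + ereal (norm (y - x) powr p / p)"
proof -
  have "ereal (segment_action p u x y (1/2)) =
      ereal (segment_action p u x y (1/2) - norm (y - x) powr p / p) + ereal (norm (y - x) powr p / p)"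
    by simp
  also have "\<dots> \<le> terminal_potential p u y + ereal (norm (y - x) powr p / p)"
    by (intro add_right_mono terminal_potential_ge) simp
  finally show ?thesis
    using initial_potential_le[of "1/2" x y] by (auto intro: order_trans)
qed

lemma continuous_norm_powr: "continuous_on UNIV (\<lambda>w::'a. norm w powr p / p)"
  using has_derivative_norm_powr[OF p]
  by (auto intro!: continuous_at_imp_continuous_on has_derivative_continuous)

lemma continuous_segment_action:
  assumes r: "r \<in> {0<..<1}"
  shows "continuous_on UNIV (\<lambda>x. segment_action p u x y r)" "continuous_on UNIV (\<lambda>y. segment_action p u x y r)"
  unfolding segment_action_def
  by (intro continuous_on_add continuous_on_mult continuous_on_const
      continuous_on_compose2[OF u_cont[OF r]] continuous_on_compose2[OF continuous_norm_powr];
      auto intro!: continuous_intros)+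

text \<open>An infimum of continuous functions is upper semicontinuous: strict sublevel sets are
  unions of open sets. The terminal potential is treated dually.\<close>

lemma borel_measurable_initial_potential: "initial_potential p u \<in> borel_measurable borel"
proof (rule borel_measurableI_less)
  fix c
  have "{x. initial_potential p u x < c}
      = (\<Union>(y, r)\<in>UNIV \<times> {0<..<1}. {x. ereal (segment_action p u x y r) < c})"
    by (auto simp: initial_potential_def INF_less_iff)
  also have "open \<dots>"
    by (intro open_UN ballI)
       (auto intro!: open_Collect_less continuous_on_ereal continuous_segment_action)
  finally show "{x \<in> space borel. initial_potential p u x < c} \<in> sets borel"
    by simp
qed

lemma borel_measurable_terminal_potential: "terminal_potential p u \<in> borel_measurable borel"
proof (rule borel_measurableI_greater)
  fix c
  have "{y. c < terminal_potential p u y}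
      = (\<Union>(x, r)\<in>UNIV \<times> {0<..<1}. {y. c < ereal (segment_action p u x y r - norm (y - x) powr p / p)})"
    by (auto simp: terminal_potential_def less_SUP_iff)
  also have "open \<dots>"
    by (intro open_UN ballI)
       (auto intro!: open_Collect_less continuous_on_ereal continuous_on_diff continuous_segment_action
         continuous_on_compose2[OF continuous_norm_powr] continuous_intros)
  finally show "{y \<in> space borel. c < terminal_potential p u y} \<in> sets borel"
    by simp
qed

text \<open>This is \<open>u_mono\<close> on the line through the space-time points
  \<open>(s, P)\<close> and \<open>(r, Q)\<close>, whose velocity is (Q-P)/(r-s).\<close>

lemma u_two_point:
  assumes "0 < s" "s < r" "r < 1"
  shows "u s P \<le> u r Q + (r - s) * (norm ((1 / (r - s)) *\<^sub>R (Q - P)) powr p / p)"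
proof -
  define w where "w = (1 / (r - s)) *\<^sub>R (Q - P)"
  have "(r - s) *\<^sub>R w = Q - P"
    using assms by (simp add: w_def)
  then have "r *\<^sub>R w = s *\<^sub>R w + (Q - P)"
    by (simp add: algebra_simps)
  then have "(P - s *\<^sub>R w) + r *\<^sub>R w = Q"
    by simp
  moreover have "(P - s *\<^sub>R w) + s *\<^sub>R w = P"
    by simp
  ultimately have "u s P + s * (norm w powr p / p) \<le> u r Q + r * (norm w powr p / p)"
    using u_mono[of s r "P - s *\<^sub>R w" w] assms by simp
  then show ?thesis
    unfolding w_def[symmetric] left_diff_distrib by linarith
qed

text \<open>Compare with the two-point inequality between the segment at time \<open>s\<close> and an arbitrary
  space-time point, and let \<open>s\<close> tend to an endpoint of the unit interval.\<close>

lemma potentials_on_characteristic: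
  assumes h: "\<And>r. r \<in> {0<..<1} \<Longrightarrow> segment_action p u a b r = h"
  shows "initial_potential p u a = ereal h" "terminal_potential p u b = ereal (h - norm (b - a) powr p / p)"
proof -
  let ?L = "\<lambda>w::'a. norm w powr p / p"
  have ua: "u s (a + s *\<^sub>R (b - a)) = h - s * ?L (b - a)" if "0 < s" "s < 1" for s
    using h[of s] that by (simp add: segment_action_def algebra_simps)
  have isCont_L: "isCont ?L w" for w
    using continuous_norm_powr by (simp add: continuous_on_eq_continuous_at)
  have "h \<le> segment_action p u a y r" if r: "0 < r" "r < 1" for y r
  proof (rule tendsto_le)
    define P where "P = a + r *\<^sub>R (y - a)"
    \<comment> \<open>The velocity needed to reach \<open>P\<close> at time \<open>r\<close> from
      the characteristic at time \<open>s\<close>; its limit is \<open>y - a\<close> because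
      \<open>P\<close> lies on the segment from \<open>a\<close> to \<open>y\<close>.\<close>
    have "((\<lambda>s. (1 / (r - s)) *\<^sub>R (P - (a + s *\<^sub>R (b - a)))) \<longlongrightarrow> (1 / (r - 0)) *\<^sub>R (P - (a + 0 *\<^sub>R (b - a)))) (at_right 0)"
      using r by (intro tendsto_intros) auto
    then have "((\<lambda>s. (1 / (r - s)) *\<^sub>R (P - (a + s *\<^sub>R (b - a)))) \<longlongrightarrow> y - a) (at_right 0)"
      using r by (simp add: P_def)
    from isCont_tendsto_compose[OF isCont_L this]
    have "((\<lambda>s. u r P + (r - s) * ?L ((1 / (r - s)) *\<^sub>R (P - (a + s *\<^sub>R (b - a)))))
        \<longlongrightarrow> u r P + (r - 0) * ?L (y - a)) (at_right 0)"
      by (rule tendsto_add[OF tendsto_const tendsto_mult[OF tendsto_diff[OF tendsto_const tendsto_ident_at]]])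
    then show "((\<lambda>s. u r P + (r - s) * ?L ((1 / (r - s)) *\<^sub>R (P - (a + s *\<^sub>R (b - a)))))
        \<longlongrightarrow> segment_action p u a y r) (at_right 0)"
      by (simp add: segment_action_def P_def)
    have "((\<lambda>s. h - s * ?L (b - a)) \<longlongrightarrow> h - 0 * ?L (b - a)) (at_right 0)"
      by (rule tendsto_diff[OF tendsto_const tendsto_mult[OF tendsto_ident_at tendsto_const]])
    then show "((\<lambda>s. h - s * ?L (b - a)) \<longlongrightarrow> h) (at_right 0)"
      by simp
    have "\<forall>\<^sub>F s in at_right (0::real). s \<in> {0<..<r}"
      by (rule eventually_at_right_real[OF r(1)])
    then show "\<forall>\<^sub>F s in at_right 0. h - s * ?L (b - a)
        \<le> u r P + (r - s) * ?L ((1 / (r - s)) *\<^sub>R (P - (a + s *\<^sub>R (b - a))))"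
    proof eventually_elim
      case (elim s)
      then show ?case
        using u_two_point[of s r "a + s *\<^sub>R (b - a)" P] ua[of s] r by simp
    qed
  qed simp
  then have "ereal h \<le> initial_potential p u a"
    unfolding initial_potential_def by (intro INF_greatest) auto
  moreover have "initial_potential p u a \<le> ereal h"
    using initial_potential_le[of "1/2" a b] h[of "1/2"] by simp
  ultimately show "initial_potential p u a = ereal h"
    by (rule antisym[rotated])
  \<comment> \<open>The same comparison at time 1 with the roles exchanged: now the point
    \<open>P\<close> comes first and the point on the characteristic is the later one.\<close>
  have "segment_action p u x b r - ?L (b - x) \<le> h - ?L (b - a)" if r: "0 < r" "r < 1" for x r
  proof -
    define P where "P = x + r *\<^sub>R (b - x)"
    have bP: "b - P = (1 - r) *\<^sub>R (b - x)"
      by (simp add: P_def algebra_simps)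
    have "u r P \<le> h - 1 * ?L (b - a) + (1 - r) * ?L (b - x)"
    proof (rule tendsto_lowerbound)
      have "((\<lambda>t. (1 / (t - r)) *\<^sub>R ((a + t *\<^sub>R (b - a)) - P)) \<longlongrightarrow> (1 / (1 - r)) *\<^sub>R ((a + 1 *\<^sub>R (b - a)) - P)) (at_left 1)"
        using r by (intro tendsto_intros) auto
      then have "((\<lambda>t. (1 / (t - r)) *\<^sub>R ((a + t *\<^sub>R (b - a)) - P)) \<longlongrightarrow> b - x) (at_left 1)"
        using r by (simp add: bP)
      from isCont_tendsto_compose[OF isCont_L this]
      show "((\<lambda>t. h - t * ?L (b - a) + (t - r) * ?L ((1 / (t - r)) *\<^sub>R ((a + t *\<^sub>R (b - a)) - P)))
          \<longlongrightarrow> h - 1 * ?L (b - a) + (1 - r) * ?L (b - x)) (at_left 1)"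
        by (rule tendsto_add[OF tendsto_diff[OF tendsto_const tendsto_mult[OF tendsto_ident_at tendsto_const]]
            tendsto_mult[OF tendsto_diff[OF tendsto_ident_at tendsto_const]]])
      have "\<forall>\<^sub>F t in at_left (1::real). t \<in> {r<..<1}"
        by (rule eventually_at_left_real[OF r(2)])
      then show "\<forall>\<^sub>F t in at_left 1. u r P \<le>
          h - t * ?L (b - a) + (t - r) * ?L ((1 / (t - r)) *\<^sub>R ((a + t *\<^sub>R (b - a)) - P))"
      proof eventually_elim
        case (elim t)
        then show ?case
          using u_two_point[of r t P "a + t *\<^sub>R (b - a)"] ua[of t] r by simp
      qed
    qed simp
    then show ?thesis
      unfolding segment_action_def P_def[symmetric] left_diff_distrib mult_1_left by linarith
  qed
  then have "terminal_potential p u b \<le> ereal (h - ?L (b - a))"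
    unfolding terminal_potential_def by (intro SUP_least) auto
  moreover have "ereal (h - ?L (b - a)) \<le> terminal_potential p u b"
    using terminal_potential_ge[of "1/2" a b] h[of "1/2"] by simp
  ultimately show "terminal_potential p u b = ereal (h - ?L (b - a))"
    by (rule antisym)
qed

text \<open>When the dual inequality is tight for a pair of endpoints, the upper and the lower bound
  that the potentials give for the action coincide at every interior time.\<close>

lemma characteristic_of_potentials:
  assumes "initial_potential p u x = ereal k + ereal (norm (y - x) powr p / p)" "terminal_potential p u y = ereal k"
    and "r \<in> {0<..<1}"
  shows "segment_action p u x y r = k + norm (y - x) powr p / p"
  using initial_potential_le[OF assms(3), of x y] terminal_potential_ge[OF assms(3), of x y]
  by (simp add: assms(1,2))

end

section \<open>Optimality from dual potentials\<close>

lemma graph_coupling: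
  fixes \<mu>\<^sub>0 :: "'a::euclidean_space measure"
  assumes "borel_prob \<mu>\<^sub>0" and T: "T \<in> borel_measurable borel" "distr \<mu>\<^sub>0 borel T = \<mu>\<^sub>1"
  shows "distr \<mu>\<^sub>0 borel (\<lambda>x. (x, T x)) \<in> couplings \<mu>\<^sub>0 \<mu>\<^sub>1"
    and "(\<integral>\<^sup>+z. ennreal (norm (fst z - snd z) powr p) \<partial>distr \<mu>\<^sub>0 borel (\<lambda>x. (x, T x)))
      = (\<integral>\<^sup>+x. ennreal (norm (T x - x) powr p) \<partial>\<mu>\<^sub>0)"
proof -
  have s0 [simp]: "sets \<mu>\<^sub>0 = sets borel" and "prob_space \<mu>\<^sub>0"
    using assms(1) by (auto simp: borel_prob_def)
  have id: "(\<lambda>x. x) \<in> borel_measurable \<mu>\<^sub>0" and T0: "T \<in> borel_measurable \<mu>\<^sub>0"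
    using T(1) by (simp_all add: measurable_ident_sets measurable_cong_sets[OF s0 refl])
  have m: "(\<lambda>x. (x, T x)) \<in> borel_measurable \<mu>\<^sub>0"
    by (rule borel_measurable_Pair[OF id T0])
  have fst_snd: "fst \<in> borel_measurable (borel :: ('a \<times> 'a) measure)" "snd \<in> borel_measurable (borel :: ('a \<times> 'a) measure)"
    by (auto intro!: borel_measurable_continuous_onI continuous_intros)
  show "distr \<mu>\<^sub>0 borel (\<lambda>x. (x, T x)) \<in> couplings \<mu>\<^sub>0 \<mu>\<^sub>1"
    using T(2) m fst_snd prob_space.prob_space_distr[OF \<open>prob_space \<mu>\<^sub>0\<close> m]
    by (simp add: couplings_def borel_prob_def distr_distr comp_def distr_id2)
  have "(\<lambda>z :: 'a \<times> 'a. ennreal (norm (fst z - snd z) powr p)) \<in> borel_measurable borel"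
    using fst_snd by measurable
  then show "(\<integral>\<^sup>+z. ennreal (norm (fst z - snd z) powr p) \<partial>distr \<mu>\<^sub>0 borel (\<lambda>x. (x, T x)))
      = (\<integral>\<^sup>+x. ennreal (norm (T x - x) powr p) \<partial>\<mu>\<^sub>0)"
    using m by (simp add: nn_integral_distr norm_minus_commute)
qed

text \<open>The easy half of Kantorovich duality with complementary slackness: the integral of
  \<open>\<phi>\<close> at the source minus \<open>\<psi>\<close> at the target depends only on the
  marginals, never exceeds the cost divided by p, and attains it for \<open>F\<close>. For a second
  optimal map the slack is nonnegative with integral zero.\<close>

lemma optimal_by_potentials:
  fixes \<mu>\<^sub>0 \<mu>\<^sub>1 :: "'a::euclidean_space measure" and \<phi> \<psi> :: "'a \<Rightarrow> ereal"
  assumes p: "1 < p" and \<mu>0: "\<mu>\<^sub>0 \<in> prob_finite_moment p" and \<mu>1: "\<mu>\<^sub>1 \<in> prob_finite_moment p"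
    and F [measurable]: "F \<in> borel_measurable borel" and push: "distr \<mu>\<^sub>0 borel F = \<mu>\<^sub>1"
    and [measurable]: "\<phi> \<in> borel_measurable borel" "\<psi> \<in> borel_measurable borel"
    and le: "\<And>x y. \<phi> x \<le> \<psi> y + ereal (norm (y - x) powr p / p)"
    and eq: "AE x in \<mu>\<^sub>0. \<exists>k. \<phi> x = ereal k + ereal (norm (F x - x) powr p / p) \<and> \<psi> (F x) = ereal k"
  shows "optimal_monge_map p \<mu>\<^sub>0 \<mu>\<^sub>1 F"
    and "optimal_monge_map p \<mu>\<^sub>0 \<mu>\<^sub>1 T \<Longrightarrow>
      AE x in \<mu>\<^sub>0. \<exists>k. \<phi> x = ereal k + ereal (norm (T x - x) powr p / p) \<and> \<psi> (T x) = ereal k"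
proof -
  have bp: "borel_prob \<mu>\<^sub>0"
    using \<mu>0 by (simp add: prob_finite_moment_def)
  interpret \<mu>0: prob_space \<mu>\<^sub>0
    using bp by (simp add: borel_prob_def)
  have s0 [simp]: "sets \<mu>\<^sub>0 = sets borel"
    using \<mu>0 by (rule sets_prob_finite_moment)
  have id0 [measurable]: "(\<lambda>x. x) \<in> borel_measurable \<mu>\<^sub>0"
    by (rule measurable_ident_sets) simp
  have F0 [measurable]: "F \<in> borel_measurable \<mu>\<^sub>0"
    using F by (simp only: measurable_cong_sets[OF s0 refl])
  define L where "L w = norm w powr p / p" for w :: 'a
  have L0: "0 \<le> L w" for w
    using p by (simp add: L_def)
  have L_m [measurable]: "L \<in> borel_measurable borel"
    unfolding L_def by measurable
  \<comment> \<open>The potentials may be infinite, and \<open>real_of_ereal\<close> sends infinite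
    values to 0; hence \<open>f\<close> and \<open>g\<close> obey the dual inequality only where
    they agree with the potentials, which is almost everywhere.\<close>
  define f g where "f x = real_of_ereal (\<phi> x)" and "g x = real_of_ereal (\<psi> x)" for x
  have [measurable]: "f \<in> borel_measurable borel" "g \<in> borel_measurable borel"
    unfolding f_def g_def by measurable
  have ae: "AE x in \<mu>\<^sub>0. \<phi> x = ereal (f x) \<and> \<psi> (F x) = ereal (g (F x)) \<and> f x = g (F x) + L (F x - x)"
    using eq by eventually_elim (auto simp: f_def g_def L_def)
  have ineq: "f x \<le> g y + L (y - x)" if "\<phi> x = ereal (f x)" "\<psi> y = ereal (g y)" for x y
    using le[of x y] that by (simp add: L_def)
  have ae0: "AE x in \<mu>\<^sub>0. \<phi> x = ereal (f x)"
    using ae by eventually_elim simp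
  have ae1: "AE y in \<mu>\<^sub>1. \<psi> y = ereal (g y)"
  proof -
    have "{y \<in> space borel. \<psi> y = ereal (g y)} \<in> sets borel"
      by measurable
    moreover have "AE x in \<mu>\<^sub>0. \<psi> (F x) = ereal (g (F x))"
      using ae by eventually_elim simp
    ultimately show ?thesis
      unfolding push[symmetric] by (simp only: AE_distr_iff[OF F0])
  qed
  have pL: "integrable M (\<lambda>x. L (k x - h x))"
    if "k \<in> borel_measurable M" "h \<in> borel_measurable M"
      "integrable M (\<lambda>x. norm (k x) powr p)" "integrable M (\<lambda>x. norm (h x) powr p)"
    for k h and M :: "'a measure"
  proof (rule Bochner_Integration.integrable_bound)
    show "integrable M (\<lambda>x. 2 powr p * (norm (k x) powr p + norm (h x) powr p) / p)"
      using that by simp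
    show "(\<lambda>x. L (k x - h x)) \<in> borel_measurable M"
      using that by measurable
    show "AE x in M. norm (L (k x - h x)) \<le> norm (2 powr p * (norm (k x) powr p + norm (h x) powr p) / p)"
      using p norm_diff_powr_le[of p] by (auto intro!: AE_I2 divide_right_mono simp: L_def)
  qed
  have mom: "integrable \<mu>\<^sub>0 (\<lambda>x. norm x powr p)" "integrable \<mu>\<^sub>0 (\<lambda>x. norm (F x) powr p)"
    using \<mu>0 \<mu>1 push[symmetric] by (auto intro!: integrableI_nonneg simp: prob_finite_moment_def nn_integral_distr)
  have FL: "integrable \<mu>\<^sub>0 (\<lambda>x. L (F x - x))"
    using mom by (intro pL) auto
  obtain x0 where x0: "\<phi> x0 = ereal (f x0)" "\<psi> (F x0) = ereal (g (F x0))"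
    using eventually_happens'[OF \<mu>0.ae_filter_bot ae] by blast
  \<comment> \<open>No growth of the potentials is known in advance. Testing the dual inequality on
    \<open>(x, F x0)\<close> bounds \<open>f x\<close> from above, and on \<open>(x0, F x)\<close>
    from below, by costs to one fixed good point \<open>x0\<close>.\<close>
  have fi: "integrable \<mu>\<^sub>0 f"
  proof (rule Bochner_Integration.integrable_bound)
    show "integrable \<mu>\<^sub>0 (\<lambda>x. \<bar>f x0\<bar> + \<bar>g (F x0)\<bar> + L (F x0 - x) + L (F x - x0))"
      using mom by (intro Bochner_Integration.integrable_add pL) auto
    show "AE x in \<mu>\<^sub>0. norm (f x) \<le> norm (\<bar>f x0\<bar> + \<bar>g (F x0)\<bar> + L (F x0 - x) + L (F x - x0))"
      using ae
    proof eventually_elim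
      case (elim x)
      from L0[of "F x0 - x"] L0[of "F x - x0"] L0[of "F x - x"] show ?case
        using ineq[of x "F x0"] ineq[of x0 "F x"] elim x0 by auto
    qed
  qed measurable
  have m: "(\<lambda>x. L (F x - x)) \<in> borel_measurable \<mu>\<^sub>0" "(\<lambda>x. g (F x)) \<in> borel_measurable \<mu>\<^sub>0"
      "f \<in> borel_measurable \<mu>\<^sub>0"
    by measurable
  have "AE x in \<mu>\<^sub>0. f x - L (F x - x) = g (F x)"
    using ae by eventually_elim simp
  from integrable_cong_AE_imp[OF Bochner_Integration.integrable_diff[OF fi FL] m(2) this]
  have gi: "integrable \<mu>\<^sub>0 (\<lambda>x. g (F x))" .
  have "AE x in \<mu>\<^sub>0. L (F x - x) = f x - g (F x)"
    using ae by eventually_elim simp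
  from integral_cong_AE[OF m(1) borel_measurable_diff[OF m(3,2)] this]
  have "(\<integral>x. L (F x - x) \<partial>\<mu>\<^sub>0) = (\<integral>x. f x - g (F x) \<partial>\<mu>\<^sub>0)" .
  also have "\<dots> = (\<integral>x. f x \<partial>\<mu>\<^sub>0) - (\<integral>x. g (F x) \<partial>\<mu>\<^sub>0)"
    using fi gi by simp
  also have "(\<integral>x. g (F x) \<partial>\<mu>\<^sub>0) = (\<integral>y. g y \<partial>\<mu>\<^sub>1)"
    unfolding push[symmetric] by (simp add: integral_distr)
  finally have LF: "(\<integral>x. L (F x - x) \<partial>\<mu>\<^sub>0) = (\<integral>x. f x \<partial>\<mu>\<^sub>0) - (\<integral>y. g y \<partial>\<mu>\<^sub>1)" .
  have g1: "integrable \<mu>\<^sub>1 g"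
    using gi unfolding push[symmetric] by (simp add: integrable_distr_eq)
  have nnL: "(\<integral>\<^sup>+z. ennreal (norm (Y z - X z) powr p) \<partial>N) = ennreal (p * (\<integral>z. L (Y z - X z) \<partial>N))"
    if "integrable N (\<lambda>z. L (Y z - X z))" for N :: "'c measure" and X Y
  proof -
    have "(\<integral>\<^sup>+z. ennreal (norm (Y z - X z) powr p) \<partial>N) = (\<integral>\<^sup>+z. ennreal (p * L (Y z - X z)) \<partial>N)"
      using p by (simp add: L_def)
    also have "\<dots> = ennreal (\<integral>z. p * L (Y z - X z) \<partial>N)"
      using that p L0 by (intro nn_integral_eq_integral) auto
    finally show ?thesis
      by simp
  qed
  \<comment> \<open>Transport plans are presented as two maps \<open>X\<close>, \<open>Y\<close> on
    a common space, which covers the projections of a coupling as well as the pair of the identity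
    and \<open>T\<close>.\<close>
  have gen: "(\<integral>\<^sup>+x. ennreal (norm (F x - x) powr p) \<partial>\<mu>\<^sub>0) \<le> (\<integral>\<^sup>+z. ennreal (norm (Y z - X z) powr p) \<partial>N)"
      "(\<integral>\<^sup>+z. ennreal (norm (Y z - X z) powr p) \<partial>N) = (\<integral>\<^sup>+x. ennreal (norm (F x - x) powr p) \<partial>\<mu>\<^sub>0) \<Longrightarrow>
        AE z in N. \<exists>k. \<phi> (X z) = ereal k + ereal (norm (Y z - X z) powr p / p) \<and> \<psi> (Y z) = ereal k"
    if X [measurable]: "X \<in> borel_measurable N" and Y [measurable]: "Y \<in> borel_measurable N"
      and XY: "distr N borel X = \<mu>\<^sub>0" "distr N borel Y = \<mu>\<^sub>1" for N :: "'c measure" and X Y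
  proof -
    have "(\<integral>\<^sup>+z. ennreal (norm (Y z - X z) powr p) \<partial>N) < \<infinity>"
      using p XY by (intro displacement_finite[OF _ \<mu>0 \<mu>1]) auto
    then have iN: "integrable N (\<lambda>z. L (Y z - X z))"
      unfolding L_def by (intro integrable_divide integrableI_nonneg) auto
    have fX: "integrable N (\<lambda>z. f (X z))" "(\<integral>z. f (X z) \<partial>N) = (\<integral>x. f x \<partial>\<mu>\<^sub>0)"
      using fi unfolding XY(1)[symmetric] by (simp_all add: integrable_distr_eq integral_distr)
    have gY: "integrable N (\<lambda>z. g (Y z))" "(\<integral>z. g (Y z) \<partial>N) = (\<integral>y. g y \<partial>\<mu>\<^sub>1)"
      using g1 unfolding XY(2)[symmetric] by (simp_all add: integrable_distr_eq integral_distr)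
    have "AE z in N. \<phi> (X z) = ereal (f (X z))"
      using ae0 unfolding XY(1)[symmetric] by (subst (asm) AE_distr_iff) auto
    moreover have "AE z in N. \<psi> (Y z) = ereal (g (Y z))"
      using ae1 unfolding XY(2)[symmetric] by (subst (asm) AE_distr_iff) auto
    ultimately have fin: "AE z in N. \<phi> (X z) = ereal (f (X z)) \<and> \<psi> (Y z) = ereal (g (Y z))"
      by eventually_elim simp
    define r where "r z = L (Y z - X z) - (f (X z) - g (Y z))" for z
    have ri: "integrable N r"
      unfolding r_def using iN fX gY by auto
    have r0: "AE z in N. 0 \<le> r z"
      using fin by eventually_elim (use ineq in \<open>fastforce simp: r_def\<close>)
    have rint: "(\<integral>z. r z \<partial>N) = (\<integral>z. L (Y z - X z) \<partial>N) - (\<integral>x. L (F x - x) \<partial>\<mu>\<^sub>0)"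
      unfolding r_def LF using iN fX gY by simp
    moreover have "0 \<le> (\<integral>z. r z \<partial>N)"
      using r0 by (rule integral_nonneg_AE)
    ultimately show "(\<integral>\<^sup>+x. ennreal (norm (F x - x) powr p) \<partial>\<mu>\<^sub>0) \<le> (\<integral>\<^sup>+z. ennreal (norm (Y z - X z) powr p) \<partial>N)"
      using p unfolding nnL[OF iN] nnL[OF FL] by (intro ennreal_leI mult_left_mono) auto
    assume "(\<integral>\<^sup>+z. ennreal (norm (Y z - X z) powr p) \<partial>N) = (\<integral>\<^sup>+x. ennreal (norm (F x - x) powr p) \<partial>\<mu>\<^sub>0)"
    then have "(\<integral>z. L (Y z - X z) \<partial>N) = (\<integral>x. L (F x - x) \<partial>\<mu>\<^sub>0)"
      unfolding nnL[OF iN] nnL[OF FL] using p L0 by (subst (asm) ennreal_inj) auto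
    then have "AE z in N. r z = 0"
      using integral_nonneg_eq_0_iff_AE[OF ri r0] rint by simp
    with fin show "AE z in N. \<exists>k. \<phi> (X z) = ereal k + ereal (norm (Y z - X z) powr p / p) \<and> \<psi> (Y z) = ereal k"
    proof eventually_elim
      case (elim z)
      then show ?case
        by (intro exI[of _ "g (Y z)"]) (simp add: r_def L_def)
    qed
  qed
  have "(\<integral>\<^sup>+x. ennreal (norm (F x - x) powr p) \<partial>\<mu>\<^sub>0) \<le> (\<integral>\<^sup>+z. ennreal (norm (fst z - snd z) powr p) \<partial>\<pi>)"
    if \<pi>: "\<pi> \<in> couplings \<mu>\<^sub>0 \<mu>\<^sub>1" for \<pi>
  proof -
    have s: "sets \<pi> = sets borel"
      using \<pi> by (simp add: couplings_def borel_prob_def)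
    have "fst \<in> borel_measurable (borel :: ('a \<times> 'a) measure)" "snd \<in> borel_measurable (borel :: ('a \<times> 'a) measure)"
      by (auto intro!: borel_measurable_continuous_onI continuous_intros)
    then have "fst \<in> borel_measurable \<pi>" "snd \<in> borel_measurable \<pi>"
      by (simp_all only: measurable_cong_sets[OF s refl])
    then show ?thesis
      using gen(1)[of fst \<pi> snd] \<pi> by (simp add: couplings_def norm_minus_commute)
  qed
  then have cost: "(\<integral>\<^sup>+x. ennreal (norm (F x - x) powr p) \<partial>\<mu>\<^sub>0) = transport_cost p \<mu>\<^sub>0 \<mu>\<^sub>1"
    unfolding transport_cost_def
    by (intro antisym INF_greatest INF_lower2[OF graph_coupling(1)[OF bp F push]])
       (auto simp: graph_coupling(2)[OF bp F push])
  then show "optimal_monge_map p \<mu>\<^sub>0 \<mu>\<^sub>1 F"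
    using F push by (simp add: optimal_monge_map_def)
  assume T: "optimal_monge_map p \<mu>\<^sub>0 \<mu>\<^sub>1 T"
  then have "T \<in> borel_measurable \<mu>\<^sub>0"
    by (simp add: optimal_monge_map_def measurable_cong_sets[OF s0 refl])
  then show "AE x in \<mu>\<^sub>0. \<exists>k. \<phi> x = ereal k + ereal (norm (T x - x) powr p / p) \<and> \<psi> (T x) = ereal k"
    using T cost by (intro gen(2)[OF id0]) (auto simp: optimal_monge_map_def distr_id2)
qed

section \<open>Vanishing loss\<close>

text \<open>The exceptional set is relatively open in an open set and Lebesgue-null, hence
  empty.\<close>

lemma continuous_on_open_AE_const:
  fixes f :: "real \<Rightarrow> 'b::t2_space"
  assumes "open S" "continuous_on S f" and ae: "AE t in lborel. t \<in> S \<longrightarrow> f t = c" and "t \<in> S"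
  shows "f t = c"
proof -
  have "open (S \<inter> f -` (- {c}))"
    using assms(1,2) by (intro continuous_open_preimage) auto
  then have "closed (- (S \<inter> f -` (- {c})))"
    by (rule closed_Compl)
  moreover have "AE t\<in>S in lebesgue. t \<in> - (S \<inter> f -` (- {c}))"
    using AE_completion[OF ae] by eventually_elim auto
  ultimately have "t \<in> - (S \<inter> f -` (- {c}))"
    using assms(1,4) mem_closed_if_AE_lebesgue_open by blast
  then show ?thesis
    using assms(4) by auto
qed

lemma terminal_segment_eq: "terminal_segment q \<Phi> t x = x + t *\<^sub>R (terminal_map q \<Phi> x - x)"
  by (simp add: terminal_segment_def algebra_simps)

text \<open>Links the loss to the dynamics: the residual vanishes at a point exactly when the
  induced velocity there is the displacement. It rests on \<open>pow_dir_inverse\<close> in both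
  directions.\<close>

lemma induced_velocity_eq_iff:
  assumes "1 < p" "q = p / (p - 1)"
  shows "induced_velocity q \<Phi> t y = w \<longleftrightarrow> gradient (\<Phi> t) y + pow_dir p w = 0"
proof
  note e = conjugate_exponent[OF assms]
  assume "induced_velocity q \<Phi> t y = w"
  then have "pow_dir q (gradient (\<Phi> t) y) = - w"
    by (auto simp: induced_velocity_def)
  then have "gradient (\<Phi> t) y = - pow_dir p w"
    using pow_dir_inverse[OF e(1,2), of "gradient (\<Phi> t) y"] by simp
  then show "gradient (\<Phi> t) y + pow_dir p w = 0"
    by simp
next
  assume "gradient (\<Phi> t) y + pow_dir p w = 0"
  then have "gradient (\<Phi> t) y = - pow_dir p w"
    by (simp add: eq_neg_iff_add_eq_0)
  then show "induced_velocity q \<Phi> t y = w"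
    by (simp add: induced_velocity_def pow_dir_inverse[OF assms])
qed

lemma pm_loss_zeroI:
  assumes "1 < p" "q = p / (p - 1)"
    and "AE x in \<mu>\<^sub>0. AE t in unit_time. induced_velocity q \<Phi> t (x + t *\<^sub>R (terminal_map q \<Phi> x - x))
      = terminal_map q \<Phi> x - x"
  shows "pm_loss p q \<mu>\<^sub>0 \<Phi> = 0"
proof -
  have "AE x in \<mu>\<^sub>0. (\<integral>\<^sup>+t. ennreal ((norm (pm_residual p q \<Phi> t x))\<^sup>2) \<partial>unit_time) = 0"
    using assms(3)
  proof eventually_elim
    case (elim x)
    then have "AE t in unit_time. ennreal ((norm (pm_residual p q \<Phi> t x))\<^sup>2) = 0"
      by eventually_elim (simp add: pm_residual_def terminal_segment_eq induced_velocity_eq_iff[OF assms(1,2)])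
    from nn_integral_cong_AE[OF this] show ?case
      by simp
  qed
  from nn_integral_cong_AE[OF this] show ?thesis
    by (simp add: pm_loss_def)
qed

text \<open>The integrand is measurable only for the completion of the product, whereas the loss is
  an iterated integral. A version \<open>g\<close> measurable for the product itself has the same
  iterated integral, so it vanishes almost everywhere on the product, and with it
  \<open>f\<close>.\<close>

lemma pm_loss_zeroD:
  assumes p: "1 < p" "q = p / (p - 1)" and \<mu>0: "prob_space \<mu>\<^sub>0"
    and wd: "pm_loss_well_defined p q \<mu>\<^sub>0 \<Phi>" and zero: "pm_loss p q \<mu>\<^sub>0 \<Phi> = 0"
  shows "AE x in \<mu>\<^sub>0. AE t in unit_time.
    \<Phi> t differentiable (at (x + t *\<^sub>R (terminal_map q \<Phi> x - x))) \<and>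
    induced_velocity q \<Phi> t (x + t *\<^sub>R (terminal_map q \<Phi> x - x)) = terminal_map q \<Phi> x - x"
proof -
  interpret \<mu>0: prob_space \<mu>\<^sub>0 by fact
  interpret T: prob_space unit_time by (rule prob_space_unit_time)
  interpret P: pair_sigma_finite \<mu>\<^sub>0 unit_time ..
  define f where "f y = (norm (pm_residual p q \<Phi> (snd y) (fst y)))\<^sup>2" for y
  have "f = (\<lambda>(x, t). (norm (pm_residual p q \<Phi> t x))\<^sup>2)"
    by (auto simp: f_def)
  then have "f \<in> borel_measurable (completion (\<mu>\<^sub>0 \<Otimes>\<^sub>M unit_time))"
    using wd by (simp add: pm_loss_well_defined_def)
  then obtain g where g [measurable]: "g \<in> borel_measurable (\<mu>\<^sub>0 \<Otimes>\<^sub>M unit_time)"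
    and fg: "AE y in \<mu>\<^sub>0 \<Otimes>\<^sub>M unit_time. f y = g y"
    using completion_ex_borel_measurable_real by blast
  have fg': "AE x in \<mu>\<^sub>0. AE t in unit_time. f (x, t) = g (x, t)"
    by (rule P.AE_pair[OF fg])
  have "(\<integral>\<^sup>+y. ennreal (g y) \<partial>(\<mu>\<^sub>0 \<Otimes>\<^sub>M unit_time)) = (\<integral>\<^sup>+x. \<integral>\<^sup>+t. ennreal (g (x, t)) \<partial>unit_time \<partial>\<mu>\<^sub>0)"
    by (rule T.nn_integral_fst[symmetric]) measurable
  also have "\<dots> = (\<integral>\<^sup>+x. \<integral>\<^sup>+t. ennreal (f (x, t)) \<partial>unit_time \<partial>\<mu>\<^sub>0)"
  proof (rule nn_integral_cong_AE)
    show "AE x in \<mu>\<^sub>0. (\<integral>\<^sup>+t. ennreal (g (x, t)) \<partial>unit_time) = (\<integral>\<^sup>+t. ennreal (f (x, t)) \<partial>unit_time)"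
      using fg'
    proof eventually_elim
      case (elim x)
      then have "AE t in unit_time. ennreal (g (x, t)) = ennreal (f (x, t))"
        by eventually_elim simp
      then show ?case
        by (rule nn_integral_cong_AE)
    qed
  qed
  also have "\<dots> = 0"
    using zero by (simp add: pm_loss_def f_def)
  finally have "AE y in \<mu>\<^sub>0 \<Otimes>\<^sub>M unit_time. ennreal (g y) = 0"
    by (subst (asm) nn_integral_0_iff_AE) auto
  then have "AE y in \<mu>\<^sub>0 \<Otimes>\<^sub>M unit_time. f y = 0"
    using fg
  proof eventually_elim
    case (elim y)
    have "0 \<le> f y"
      by (simp add: f_def)
    with elim show ?case
      by (simp add: ennreal_eq_0_iff)
  qed
  moreover have "AE y in \<mu>\<^sub>0 \<Otimes>\<^sub>M unit_time. \<Phi> (snd y) differentiable (at (terminal_segment q \<Phi> (snd y) (fst y)))"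
    using wd by (simp add: pm_loss_well_defined_def split_beta)
  ultimately have "AE y in \<mu>\<^sub>0 \<Otimes>\<^sub>M unit_time.
      \<Phi> (snd y) differentiable (at (fst y + snd y *\<^sub>R (terminal_map q \<Phi> (fst y) - fst y))) \<and>
      induced_velocity q \<Phi> (snd y) (fst y + snd y *\<^sub>R (terminal_map q \<Phi> (fst y) - fst y))
        = terminal_map q \<Phi> (fst y) - fst y"
    by eventually_elim
       (simp add: f_def pm_residual_def terminal_segment_eq induced_velocity_eq_iff[OF p])
  from P.AE_pair[OF this] show ?thesis
    by simp
qed

lemma induced_velocity_continuous:
  assumes C2: "Ck_on 2 ({0<..<1} \<times> UNIV) (\<lambda>(t, x :: 'a::euclidean_space). \<Phi> t x)" and "1 < q"
  shows "continuous_on ({0<..<1} \<times> UNIV) (\<lambda>(t, x). induced_velocity q \<Phi> t x)"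
proof -
  have "isCont (space_partial \<Phi>) y" if "y \<in> {0<..<1} \<times> UNIV" for y
  proof -
    obtain t x where y: "y = (t, x)" "t \<in> {0<..<1}"
      using \<open>y \<in> {0<..<1} \<times> UNIV\<close> by auto
    show ?thesis
      unfolding y(1) by (rule has_derivative_continuous[OF partials_has_derivative(2)[OF C2 y(2)]])
  qed
  then have "continuous_on ({0<..<1} \<times> UNIV) (\<lambda>y. - pow_dir q (space_partial \<Phi> y))"
    by (intro continuous_at_imp_continuous_on ballI continuous_minus isCont_o2[OF _ continuous_pow_dir[OF assms(2)]])
  then show ?thesis
    by (rule continuous_on_eq) (auto simp: induced_velocity_def gradient_potential[OF C2])
qed

text \<open>A competing optimal map is optimal for the same potentials, so its segments are
  characteristics as well, and these are determined by their starting point.\<close>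

lemma zero_loss_optimal:
  fixes \<mu>\<^sub>0 \<mu>\<^sub>1 :: "'a::euclidean_space measure"
  assumes p: "1 < p" "q = p / (p - 1)"
    and \<mu>0: "\<mu>\<^sub>0 \<in> prob_finite_moment p" and \<mu>1: "\<mu>\<^sub>1 \<in> prob_finite_moment p"
    and reg: "flow_regular q \<Phi>" and C2: "Ck_on 2 ({0<..<1} \<times> UNIV) (\<lambda>(t, x). \<Phi> t x)"
    and supp: "\<And>t. t \<in> {0<..<1} \<Longrightarrow> measure_support (induced_law q \<mu>\<^sub>0 \<Phi> t) = UNIV"
    and push: "distr \<mu>\<^sub>0 borel (terminal_map q \<Phi>) = \<mu>\<^sub>1"
    and straight: "AE x in \<mu>\<^sub>0. AE t in unit_time.
      \<Phi> t differentiable (at (x + t *\<^sub>R (terminal_map q \<Phi> x - x))) \<and>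
      induced_velocity q \<Phi> t (x + t *\<^sub>R (terminal_map q \<Phi> x - x)) = terminal_map q \<Phi> x - x"
  shows "optimal_monge_map p \<mu>\<^sub>0 \<mu>\<^sub>1 (terminal_map q \<Phi>)"
    and "optimal_monge_map p \<mu>\<^sub>0 \<mu>\<^sub>1 T \<Longrightarrow> AE x in \<mu>\<^sub>0. T x = terminal_map q \<Phi> x"
proof -
  note e = conjugate_exponent[OF p]
  interpret \<mu>0: prob_space \<mu>\<^sub>0
    using \<mu>0 by (simp add: prob_finite_moment_def borel_prob_def)
  have s0 [simp]: "sets \<mu>\<^sub>0 = sets borel"
    using \<mu>0 by (rule sets_prob_finite_moment)
  define F where "F = terminal_map q \<Phi>"
  have F: "F \<in> borel_measurable borel"
    unfolding F_def terminal_map_def[abs_def] by (rule flow_measurable[OF reg]) simp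
  define good where "good x \<longleftrightarrow> (\<forall>t\<in>{0<..<1}. induced_velocity q \<Phi> t (x + t *\<^sub>R (F x - x)) = F x - x)" for x
  have affine: "flow q \<Phi> t x = x + t *\<^sub>R w"
    if v: "\<And>t. t \<in> {0<..<1} \<Longrightarrow> induced_velocity q \<Phi> t (x + t *\<^sub>R w) = w" and t: "t \<in> {0..1}" for x w t
  proof (rule flow_affine[OF reg _ t])
    have "AE t in unit_time. t \<in> {0<..<1}"
      using AE_space[of unit_time] by (simp add: space_restrict_space)
    then show "AE t in unit_time. \<Phi> t differentiable (at (x + t *\<^sub>R w)) \<and> induced_velocity q \<Phi> t (x + t *\<^sub>R w) = w"
      by eventually_elim (simp add: v potential_differentiable[OF C2])
  qed
  \<comment> \<open>Continuity of the velocity in time upgrades almost every \<open>t\<close> in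
    \<open>straight\<close> to every interior \<open>t\<close>.\<close>
  have "AE x in \<mu>\<^sub>0. good x"
    using straight
  proof eventually_elim
    case (elim x)
    show ?case
      unfolding good_def
    proof
      fix t :: real assume "t \<in> {0<..<1}"
      show "induced_velocity q \<Phi> t (x + t *\<^sub>R (F x - x)) = F x - x"
      proof (rule continuous_on_open_AE_const[of "{0<..<1}" "\<lambda>t. induced_velocity q \<Phi> t (x + t *\<^sub>R (F x - x))"])
        have "continuous_on {0<..<1} (\<lambda>t. (t, x + t *\<^sub>R (F x - x)))"
          by (intro continuous_intros)
        from continuous_on_compose2[OF induced_velocity_continuous[OF C2 e(1)] this]
        show "continuous_on {0<..<1} (\<lambda>t. induced_velocity q \<Phi> t (x + t *\<^sub>R (F x - x)))"
          by auto
        have "AE t in unit_time. induced_velocity q \<Phi> t (x + t *\<^sub>R (F x - x)) = F x - x"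
          using elim by eventually_elim (simp add: F_def)
        then show "AE t in lborel. t \<in> {0<..<1} \<longrightarrow> induced_velocity q \<Phi> t (x + t *\<^sub>R (F x - x)) = F x - x"
          by (subst (asm) AE_restrict_space_iff) simp_all
      qed (use \<open>t \<in> {0<..<1}\<close> in auto)
    qed
  qed
  note good = this
  \<comment> \<open>Full support gives \<open>U\<close> positive mass at time \<open>t\<close>, so
    the null set of bad starting points cannot account for all trajectories in \<open>U\<close>:
    some straight one passes through.\<close>
  have dense: "\<exists>a w. a + t *\<^sub>R w \<in> U \<and> (\<forall>r\<in>{0<..<1}. induced_velocity q \<Phi> r (a + r *\<^sub>R w) = w)"
    if t: "t \<in> {0<..<1}" and U: "open U" "U \<noteq> {}" for t and U :: "'a set"
  proof (rule ccontr)
    assume no: "\<not> ?thesis"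
    have fl: "flow q \<Phi> t \<in> \<mu>\<^sub>0 \<rightarrow>\<^sub>M borel"
      using flow_measurable[OF reg, of t] t by (simp add: measurable_cong_sets[OF s0 refl])
    have "AE x in \<mu>\<^sub>0. flow q \<Phi> t x \<notin> U"
      using good
    proof eventually_elim
      case (elim x)
      then have v: "\<And>r. r \<in> {0<..<1} \<Longrightarrow> induced_velocity q \<Phi> r (x + r *\<^sub>R (F x - x)) = F x - x"
        by (simp add: good_def)
      then have "flow q \<Phi> t x = x + t *\<^sub>R (F x - x)"
        using t by (intro affine) auto
      with no v show ?case
        by metis
    qed
    then have "AE y in induced_law q \<mu>\<^sub>0 \<Phi> t. y \<notin> U"
      unfolding induced_law_def
    proof (subst AE_distr_iff[OF fl])
      have "{y \<in> space borel. y \<notin> U} = - U"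
        by auto
      then show "{y \<in> space borel. y \<notin> U} \<in> sets borel"
        using U by simp
    qed
    then have "emeasure (induced_law q \<mu>\<^sub>0 \<Phi> t) U = 0"
      using U by (subst (asm) AE_iff_measurable[where N = U]) (auto simp: induced_law_def)
    moreover obtain x where x: "x \<in> U"
      using U by blast
    moreover have "x \<in> measure_support (induced_law q \<mu>\<^sub>0 \<Phi> t)"
      using supp[OF t] by simp
    then have "0 < emeasure (induced_law q \<mu>\<^sub>0 \<Phi> t) U"
      using U x by (simp add: measure_support_def)
    ultimately show False
      by simp
  qed
  obtain C where C: "\<And>m w t. t \<in> {0<..<1} \<Longrightarrow>
    \<exists>\<delta>\<ge>0. ((\<lambda>r. \<Phi> r (m + r *\<^sub>R w) - C r + r * (norm w powr p / p)) has_real_derivative \<delta>) (at t) \<and>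
      (\<delta> = 0 \<longleftrightarrow> induced_velocity q \<Phi> t (m + t *\<^sub>R w) = w)"
    using action_along_lines[OF C2 p dense] by blast
  define u where "u r x = \<Phi> r x - C r" for r x
  have u_cont: "continuous_on UNIV (u r)" if "r \<in> {0<..<1}" for r
    unfolding u_def using potential_differentiable[OF C2 that]
    by (intro continuous_intros continuous_at_imp_continuous_on ballI differentiable_imp_continuous_within)
  have u_mono: "u s (m + s *\<^sub>R w) + s * (norm w powr p / p) \<le> u r (m + r *\<^sub>R w) + r * (norm w powr p / p)"
    if "0 < s" "s \<le> r" "r < 1" for m w s r
  proof -
    have "\<exists>y. ((\<lambda>r. \<Phi> r (m + r *\<^sub>R w) - C r + r * (norm w powr p / p)) has_real_derivative y) (at x) \<and> 0 \<le> y"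
      if "s \<le> x" "x \<le> r" for x
      using C[of x m w] that \<open>0 < s\<close> \<open>r < 1\<close> by auto
    from DERIV_nonneg_imp_nondecreasing[OF \<open>s \<le> r\<close> this] show ?thesis
      by (simp add: u_def)
  qed
  interpret action_increasing p u
    by unfold_locales (fact p(1) u_cont u_mono)+
  let ?\<phi> = "initial_potential p u" and ?\<psi> = "terminal_potential p u"
  have eq: "AE x in \<mu>\<^sub>0. \<exists>k. ?\<phi> x = ereal k + ereal (norm (F x - x) powr p / p) \<and> ?\<psi> (F x) = ereal k"
    using good
  proof eventually_elim
    case (elim x)
    \<comment> \<open>Good segments are characteristics, where the derivative of the action is zero;
      the constant action then yields equality in duality.\<close>
    have "((\<lambda>r. segment_action p u x (F x) r) has_real_derivative 0) (at t)" if t: "t \<in> {0<..<1}" for t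
    proof -
      obtain \<delta> where "((\<lambda>r. \<Phi> r (x + r *\<^sub>R (F x - x)) - C r + r * (norm (F x - x) powr p / p)) has_real_derivative \<delta>) (at t)"
          "\<delta> = 0 \<longleftrightarrow> induced_velocity q \<Phi> t (x + t *\<^sub>R (F x - x)) = F x - x"
        using C[OF t, of x "F x - x"] by blast
      then show ?thesis
        using elim t by (simp add: good_def segment_action_def[abs_def] u_def)
    qed
    then have "\<exists>h. \<forall>r\<in>{0<..<1}. segment_action p u x (F x) r = h"
      by (intro has_field_derivative_zero_constant) (auto intro: has_field_derivative_at_within)
    then obtain h where "\<And>r. r \<in> {0<..<1} \<Longrightarrow> segment_action p u x (F x) r = h"
      by blast
    from potentials_on_characteristic[OF this] show ?case
      by (intro exI[of _ "h - norm (F x - x) powr p / p"]) simp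
  qed
  note opt = optimal_by_potentials[OF p(1) \<mu>0 \<mu>1 F push[folded F_def]
      borel_measurable_initial_potential borel_measurable_terminal_potential
      potentials_le eq]
  from opt(1) show "optimal_monge_map p \<mu>\<^sub>0 \<mu>\<^sub>1 (terminal_map q \<Phi>)"
    by (simp add: F_def)
  assume "optimal_monge_map p \<mu>\<^sub>0 \<mu>\<^sub>1 T"
  from opt(2)[OF this] show "AE x in \<mu>\<^sub>0. T x = terminal_map q \<Phi> x"
  proof eventually_elim
    case (elim x)
    then obtain k where "?\<phi> x = ereal k + ereal (norm (T x - x) powr p / p)" "?\<psi> (T x) = ereal k"
      by blast
    then have sa: "segment_action p u x (T x) r = k + norm (T x - x) powr p / p" if "r \<in> {0<..<1}" for r
      using characteristic_of_potentials[OF _ _ that] by blast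
    have "induced_velocity q \<Phi> t (x + t *\<^sub>R (T x - x)) = T x - x" if t: "t \<in> {0<..<1}" for t
    proof -
      obtain \<delta> where \<delta>: "((\<lambda>r. \<Phi> r (x + r *\<^sub>R (T x - x)) - C r + r * (norm (T x - x) powr p / p)) has_real_derivative \<delta>) (at t)"
          "\<delta> = 0 \<longleftrightarrow> induced_velocity q \<Phi> t (x + t *\<^sub>R (T x - x)) = T x - x"
        using C[OF t, of x "T x - x"] by blast
      \<comment> \<open>The action along the segment towards \<open>T x\<close> is constant by
        tightness, so its derivative \<open>\<delta>\<close> is zero, which is the criterion for a
        characteristic.\<close>
      then have "(segment_action p u x (T x) has_real_derivative \<delta>) (at t)"
        by (simp add: segment_action_def[abs_def] u_def)
      moreover have "(segment_action p u x (T x) has_real_derivative 0) (at t)"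
      proof (rule has_field_derivative_transform_within_open[OF DERIV_const, of "{0<..<1}"])
        show "k + norm (T x - x) powr p / p = segment_action p u x (T x) r" if "r \<in> {0<..<1}" for r
          using sa[OF that] by simp
      qed (use t in auto)
      ultimately have "\<delta> = 0"
        by (rule DERIV_unique)
      then show ?thesis
        using \<delta>(2) by simp
    qed
    \<comment> \<open>The segment towards \<open>T x\<close> solves the initial-value problem from
      \<open>x\<close>, so the flow reaches \<open>T x\<close> at time 1.\<close>
    from affine[OF this, of 1] show ?case
      by (simp add: terminal_map_def)
  qed
qed

theorem theorem3p2:
  fixes p q lam_pm lam_term :: real
    and \<mu>\<^sub>0 \<mu>\<^sub>1 :: "'a::euclidean_space measure"
    and D :: "'a measure \<Rightarrow> 'a measure \<Rightarrow> ennreal"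
    and \<rho>s :: "real \<Rightarrow> 'a measure" and vs :: "real \<Rightarrow> 'a \<Rightarrow> 'a"
    and \<Phi>s :: "real \<Rightarrow> 'a \<Rightarrow> real"
  assumes "1 < p" and "q = p / (p - 1)"
    and "\<mu>\<^sub>0 \<in> prob_finite_moment p" and "\<mu>\<^sub>1 \<in> prob_finite_moment p"
    and "\<And>P Q. borel_prob P \<Longrightarrow> borel_prob Q \<Longrightarrow> D P Q = 0 \<longleftrightarrow> P = Q"
    and "0 < lam_pm" and "0 < lam_term"
    and "absolutely_continuous lborel \<mu>\<^sub>0"
    and "is_arg_min (bb_cost p) (bb_admissible \<mu>\<^sub>0 \<mu>\<^sub>1) (\<rho>s, vs)"
    and "\<Phi>s \<in> pmot_domain p q \<mu>\<^sub>0"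
    and "\<forall>t\<in>{0..1}. \<rho>s t = induced_law q \<mu>\<^sub>0 \<Phi>s t"
    and "\<forall>t\<in>{0<..<1}. \<forall>x. vs t x = induced_velocity q \<Phi>s t x"
  shows "is_arg_min (pmot_loss lam_pm lam_term D p q \<mu>\<^sub>0 \<mu>\<^sub>1) (\<lambda>\<Phi>. \<Phi> \<in> pmot_domain p q \<mu>\<^sub>0) \<Phi>s \<and>
    pmot_loss lam_pm lam_term D p q \<mu>\<^sub>0 \<mu>\<^sub>1 \<Phi>s = 0 \<and>
    (\<forall>\<Phi>. is_arg_min (pmot_loss lam_pm lam_term D p q \<mu>\<^sub>0 \<mu>\<^sub>1) (\<lambda>\<Phi>. \<Phi> \<in> pmot_domain p q \<mu>\<^sub>0) \<Phi> \<longrightarrow>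
      Ck_on 2 ({0<..<1} \<times> UNIV) (\<lambda>(t, x). \<Phi> t x) \<longrightarrow>
      (\<forall>t\<in>{0<..<1}. measure_support (induced_law q \<mu>\<^sub>0 \<Phi> t) = UNIV) \<longrightarrow>
        (AE t in unit_time. AE x in induced_law q \<mu>\<^sub>0 \<Phi> t. induced_velocity q \<Phi> t x = vs t x) \<and>
        optimal_monge_map p \<mu>\<^sub>0 \<mu>\<^sub>1 (terminal_map q \<Phi>) \<and>
        (\<forall>T. optimal_monge_map p \<mu>\<^sub>0 \<mu>\<^sub>1 T \<longrightarrow> (AE x in \<mu>\<^sub>0. T x = terminal_map q \<Phi> x)))"
proof -
  note p = assms(1,2) and \<mu>0 = assms(3) and \<mu>1 = assms(4) and D = assms(5)
  note lam = assms(6,7) and min = assms(9)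
  note e = conjugate_exponent[OF p]
  let ?dom = "\<lambda>\<Phi>. \<Phi> \<in> pmot_domain p q \<mu>\<^sub>0" and ?loss = "pmot_loss lam_pm lam_term D p q \<mu>\<^sub>0 \<mu>\<^sub>1"
  have bp0: "borel_prob \<mu>\<^sub>0" and bp1: "borel_prob \<mu>\<^sub>1"
    using \<mu>0 \<mu>1 by (auto simp: prob_finite_moment_def)
  interpret \<mu>0: prob_space \<mu>\<^sub>0
    using bp0 by (simp add: borel_prob_def)
  interpret T: prob_space unit_time
    by (rule prob_space_unit_time)
  interpret P: pair_sigma_finite unit_time \<mu>\<^sub>0 ..
  have s0 [simp]: "sets \<mu>\<^sub>0 = sets borel"
    using \<mu>0 by (rule sets_prob_finite_moment)
  have in_time: "AE t in unit_time. t \<in> {0<..<1}"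
    using AE_space[of unit_time] by (simp add: space_restrict_space)
  have reg_s: "flow_regular q \<Phi>s"
    using assms(10) by (simp add: pmot_domain_def)
  define Fs where "Fs = terminal_map q \<Phi>s"
  have push_s: "distr \<mu>\<^sub>0 borel Fs = \<mu>\<^sub>1"
    and cost_s: "bb_cost p (\<rho>s, vs) = ennreal (1 / p) * (\<integral>\<^sup>+x. ennreal (norm (Fs x - x) powr p) \<partial>\<mu>\<^sub>0)"
    and straight_s: "AE x in \<mu>\<^sub>0. AE t in unit_time. \<Phi>s t differentiable (at (x + t *\<^sub>R (Fs x - x))) \<and>
      induced_velocity q \<Phi>s t (x + t *\<^sub>R (Fs x - x)) = Fs x - x"
    unfolding Fs_def using bb_minimizer_straight[OF p(1) \<mu>0 \<mu>1 min reg_s] assms(11,12) by blast+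
  have law: "induced_law q \<mu>\<^sub>0 \<Phi> 1 = distr \<mu>\<^sub>0 borel (terminal_map q \<Phi>)" for \<Phi>
    by (simp add: induced_law_def terminal_map_def[abs_def])
  have F_meas: "terminal_map q \<Phi> \<in> borel_measurable borel" if "flow_regular q \<Phi>" for \<Phi>
    unfolding terminal_map_def[abs_def] by (rule flow_measurable[OF that]) simp
  have bp: "borel_prob (induced_law q \<mu>\<^sub>0 \<Phi> 1)" if "flow_regular q \<Phi>" for \<Phi>
  proof -
    have "terminal_map q \<Phi> \<in> borel_measurable \<mu>\<^sub>0"
      using F_meas[OF that] by (simp only: measurable_cong_sets[OF s0 refl])
    then show ?thesis
      unfolding law borel_prob_def by (auto intro: \<mu>0.prob_space_distr)
  qed
  have "pm_loss p q \<mu>\<^sub>0 \<Phi>s = 0"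
  proof (rule pm_loss_zeroI[OF p])
    show "AE x in \<mu>\<^sub>0. AE t in unit_time. induced_velocity q \<Phi>s t (x + t *\<^sub>R (terminal_map q \<Phi>s x - x))
        = terminal_map q \<Phi>s x - x"
      using straight_s by eventually_elim (simp add: Fs_def)
  qed
  moreover have "term_loss D q \<mu>\<^sub>0 \<mu>\<^sub>1 \<Phi>s = 0"
    using D[OF bp[OF reg_s] bp1] push_s by (simp add: term_loss_def law Fs_def)
  ultimately have zero: "?loss \<Phi>s = 0"
    by (simp add: pmot_loss_def)
  then have arg_min: "is_arg_min ?loss ?dom \<Phi>s"
    using assms(10) by (simp add: is_arg_min_def)
  have vs_m: "(\<lambda>(t, x). vs t x) \<in> borel_measurable (restrict_space borel ({0<..<1} \<times> UNIV))"
    using min by (simp add: is_arg_min_def bb_admissible_def)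
  have "(AE t in unit_time. AE x in induced_law q \<mu>\<^sub>0 \<Phi> t. induced_velocity q \<Phi> t x = vs t x) \<and>
        optimal_monge_map p \<mu>\<^sub>0 \<mu>\<^sub>1 (terminal_map q \<Phi>) \<and>
        (\<forall>T. optimal_monge_map p \<mu>\<^sub>0 \<mu>\<^sub>1 T \<longrightarrow> (AE x in \<mu>\<^sub>0. T x = terminal_map q \<Phi> x))"
    if \<Phi>: "is_arg_min ?loss ?dom \<Phi>" and C2: "Ck_on 2 ({0<..<1} \<times> UNIV) (\<lambda>(t, x). \<Phi> t x)"
      and supp: "\<forall>t\<in>{0<..<1}. measure_support (induced_law q \<mu>\<^sub>0 \<Phi> t) = UNIV" for \<Phi>
  proof -
    define F where "F = terminal_map q \<Phi>"
    have reg: "flow_regular q \<Phi>" and wd: "pm_loss_well_defined p q \<mu>\<^sub>0 \<Phi>"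
      using \<Phi> by (auto simp: is_arg_min_def pmot_domain_def)
    \<comment> \<open>A minimizer cannot exceed the value 0 attained at \<open>\<Phi>s\<close>; as
      both weights are positive, each of the two losses vanishes separately.\<close>
    have "?loss \<Phi> = 0"
      using \<Phi> assms(10) zero by (auto simp: is_arg_min_def)
    then have pm: "pm_loss p q \<mu>\<^sub>0 \<Phi> = 0" and "D (induced_law q \<mu>\<^sub>0 \<Phi> 1) \<mu>\<^sub>1 = 0"
      using lam by (auto simp: pmot_loss_def term_loss_def ennreal_eq_0_iff)
    then have push: "distr \<mu>\<^sub>0 borel F = \<mu>\<^sub>1"
      using D[OF bp[OF reg] bp1] by (simp add: law F_def)
    have straight: "AE x in \<mu>\<^sub>0. AE t in unit_time. \<Phi> t differentiable (at (x + t *\<^sub>R (F x - x))) \<and>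
        induced_velocity q \<Phi> t (x + t *\<^sub>R (F x - x)) = F x - x"
      unfolding F_def by (rule pm_loss_zeroD[OF p \<mu>0.prob_space_axioms wd pm])
    have opt: "optimal_monge_map p \<mu>\<^sub>0 \<mu>\<^sub>1 F"
        "\<And>T. optimal_monge_map p \<mu>\<^sub>0 \<mu>\<^sub>1 T \<Longrightarrow> AE x in \<mu>\<^sub>0. T x = F x"
      using zero_loss_optimal[OF p \<mu>0 \<mu>1 reg C2 _ push[unfolded F_def] straight[unfolded F_def]] supp
      unfolding F_def by blast+
    \<comment> \<open>Optimality of \<open>Fs\<close> is a squeeze: \<open>cost_s\<close> and
      minimality bound its cost from above by that of \<open>F\<close>, and its graph coupling
      bounds it from below.\<close>
    have FsF: "AE x in \<mu>\<^sub>0. Fs x = F x"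
    proof (rule opt(2))
      obtain \<rho> v where "bb_admissible \<mu>\<^sub>0 \<mu>\<^sub>1 (\<rho>, v)"
          "bb_cost p (\<rho>, v) \<le> ennreal (1 / p) * (\<integral>\<^sup>+x. ennreal (norm (F x - x) powr p) \<partial>\<mu>\<^sub>0)"
        by (rule displacement_interpolation_admissible[OF p(1) \<mu>0 \<mu>1 F_meas[OF reg] push[unfolded F_def], folded F_def]) blast
      moreover have "bb_cost p (\<rho>s, vs) \<le> bb_cost p (\<rho>, v)"
        using min calculation(1) by (auto simp: is_arg_min_def not_less)
      ultimately have "ennreal (1 / p) * (\<integral>\<^sup>+x. ennreal (norm (Fs x - x) powr p) \<partial>\<mu>\<^sub>0)
          \<le> ennreal (1 / p) * (\<integral>\<^sup>+x. ennreal (norm (F x - x) powr p) \<partial>\<mu>\<^sub>0)"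
        unfolding cost_s by simp
      from mult_left_mono[OF this, of "ennreal p"]
      have "(\<integral>\<^sup>+x. ennreal (norm (Fs x - x) powr p) \<partial>\<mu>\<^sub>0) \<le> (\<integral>\<^sup>+x. ennreal (norm (F x - x) powr p) \<partial>\<mu>\<^sub>0)"
        using p(1) by (simp add: mult.assoc[symmetric] flip: ennreal_mult')
      also have "\<dots> = transport_cost p \<mu>\<^sub>0 \<mu>\<^sub>1"
        using opt(1) by (simp add: optimal_monge_map_def)
      finally have le: "(\<integral>\<^sup>+x. ennreal (norm (Fs x - x) powr p) \<partial>\<mu>\<^sub>0) \<le> transport_cost p \<mu>\<^sub>0 \<mu>\<^sub>1" .
      have Fs: "Fs \<in> borel_measurable borel"
        unfolding Fs_def by (rule F_meas[OF reg_s])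
      have "transport_cost p \<mu>\<^sub>0 \<mu>\<^sub>1 \<le> (\<integral>\<^sup>+x. ennreal (norm (Fs x - x) powr p) \<partial>\<mu>\<^sub>0)"
        unfolding transport_cost_def
        by (rule INF_lower2[OF graph_coupling(1)[OF bp0 Fs push_s]]) (simp add: graph_coupling(2)[OF bp0 Fs push_s])
      with le show "optimal_monge_map p \<mu>\<^sub>0 \<mu>\<^sub>1 Fs"
        using Fs push_s by (simp add: optimal_monge_map_def)
    qed
    \<comment> \<open>The trajectory of \<open>\<Phi>\<close> is the segment towards
      \<open>F x\<close>, which is also the segment of \<open>\<Phi>s\<close> since
      \<open>Fs x = F x\<close>; both fields equal \<open>F x - x\<close> on it.\<close>
    have agree: "AE x in \<mu>\<^sub>0. AE t in unit_time.
        induced_velocity q \<Phi> t (flow q \<Phi> t x) = vs t (flow q \<Phi> t x)"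
      using straight straight_s FsF
    proof eventually_elim
      case (elim x)
      have "flow q \<Phi> t x = x + t *\<^sub>R (F x - x)" if "t \<in> {0..1}" for t
        using elim(1) that by (rule flow_affine[OF reg])
      note z = this
      show ?case
        using elim(1) elim(2) in_time
      proof eventually_elim
        case (elim t)
        then have "vs t (x + t *\<^sub>R (F x - x)) = F x - x"
          using assms(12) \<open>Fs x = F x\<close> by simp
        then show ?case
          using elim z[of t] by simp
      qed
    qed
    let ?\<Omega> = "restrict_space borel ({0<..<1} \<times> UNIV) :: (real \<times> 'a) measure"
    \<comment> \<open>\<open>agree\<close> quantifies over starting points first and times second.
      Exchanging the two requires a measurable zero set on the product, which the difference
      \<open>W\<close> along the flow provides.\<close>
    define W where "W = (\<lambda>y. (case y of (t, x) \<Rightarrow> induced_velocity q \<Phi> t x) - (case y of (t, x) \<Rightarrow> vs t x))"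
    have W: "W \<in> borel_measurable ?\<Omega>"
      unfolding W_def
      by (intro borel_measurable_diff vs_m borel_measurable_continuous_on_restrict induced_velocity_continuous[OF C2 e(1)])
    have pair: "(\<lambda>y. (fst y, flow q \<Phi> (fst y) (snd y))) \<in> unit_time \<Otimes>\<^sub>M \<mu>\<^sub>0 \<rightarrow>\<^sub>M ?\<Omega>"
      using flow_measurable_pair[OF reg s0] measurable_compose[OF measurable_fst measurable_unit_time]
      by (intro measurable_restrict_space2 borel_measurable_Pair)
        (auto simp: space_pair_measure space_restrict_space)
    have Wp: "(\<lambda>y. W (fst y, flow q \<Phi> (fst y) (snd y))) \<in> borel_measurable (unit_time \<Otimes>\<^sub>M \<mu>\<^sub>0)"
      by (rule measurable_compose[OF pair W])
    have "{y \<in> space (unit_time \<Otimes>\<^sub>M \<mu>\<^sub>0). W (fst y, flow q \<Phi> (fst y) (snd y)) = 0} \<in> sets (unit_time \<Otimes>\<^sub>M \<mu>\<^sub>0)"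
      using Wp by measurable
    from P.AE_commute[OF this]
    have "AE t in unit_time. AE x in \<mu>\<^sub>0. W (t, flow q \<Phi> t x) = 0"
      using agree by (simp add: W_def)
    then have "AE t in unit_time. AE x in induced_law q \<mu>\<^sub>0 \<Phi> t. induced_velocity q \<Phi> t x = vs t x"
      using in_time
    proof eventually_elim
      case (elim t)
      have fl: "flow q \<Phi> t \<in> \<mu>\<^sub>0 \<rightarrow>\<^sub>M borel"
        using flow_measurable[OF reg, of t] elim by (simp add: measurable_cong_sets[OF s0 refl])
      have "(\<lambda>x :: 'a. (t, x)) \<in> borel \<rightarrow>\<^sub>M ?\<Omega>"
        using elim by (intro measurable_restrict_space2 borel_measurable_Pair_const) auto
      from measurable_compose[OF this W]
      have "{x \<in> space borel. W (t, x) = 0} \<in> sets borel"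
        by measurable
      from AE_distr_iff[OF fl this] show ?case
        unfolding induced_law_def using elim by (simp add: W_def)
    qed
    then show ?thesis
      using opt by (auto simp: F_def)
  qed
  then show ?thesis
    using arg_min zero by blast
qed

end
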